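(* Let $\Omega\subsetneq\mathbb{R}^n$ ($n\ge 2$) be an arbitrary domain, let $p_0,p_1,\dots,p_n\in C^+(\overline{\Omega})$, let $f\in L_1(\Omega)$, and let $a=(a_1,\dots,a_n)$ and $b$ satisfy the structural assumptions (A0)–(A5) listed in the context. Let $u\in\mathring{\mathcal T}^1_{\overrightarrow{\mathbf p}(\cdot)}(\Omega)$ be an entropy solution, obtained by the approximation procedure described in the context, of the Dirichlet problem $$\operatorname{div} a(x,u,\nabla u)=|u|^{p_0(x)-2}u+b(x,u,\nabla u)+f,\quad x\in\Omega,\qquad u|_{\partial\Omega}=0;$$ that is, $u$ is an entropy solution which is the a.e. limit in $\Omega$ of a subsequence of a sequence $\{u^m\}_{m\in\mathbb{N}}$ of generalized solutions of the approximate problems. Then $u$ is a renormalized solution of this Dirichlet problem.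
   Context: **Setting.** $n\ge2$; $\Omega\subsetneq\mathbb{R}^n$ is a domain (not assumed bounded). $C^+(\overline{\Omega})$ is the set of $p\in C(\overline{\Omega})$ with $1<p^-\le p^+<\infty$, where $p^-=\inf_\Omega p$, $p^+=\sup_\Omega p$. For $p\in C^+(\overline\Omega)$, $p'(x)=p(x)/(p(x)-1)$, and $L_{p(\cdot)}(\Omega)$ is the space of measurable real functions $v$ on $\Omega$ with $\int_\Omega|v|^{p(x)}dx<\infty$, with the Luxemburg norm $\|v\|_{p(\cdot)}=\inf\{k>0:\int_\Omega|v/k|^{p(x)}dx\le1\}$. The space $\mathring{W}^1_{\overrightarrow{\mathbf p}(\cdot)}(\Omega)$, $\overrightarrow{\mathbf p}=(p_0,p_1,\dots,p_n)$, is the completion of $C_0^\infty(\Omega)$ in the norm $\|v\|_{p_0(\cdot)}+\sum_{i=1}^n\|v_{x_i}\|_{p_i(\cdot)}$. Notation: $\mathrm{P}(x,s)=\sum_{i=1}^n|s_i|^{p_i(x)}$ for $s=(s_1,\dots,s_n)\in\mathbb{R}^n$; $\mathbb{R}^+=[0,\infty)$. **Structural assumptions.** The functions $a_i(x,s_0,s)$ ($i=1,\dots,n$) and $b(x,s_0,s)$, defined on $\Omega\times\mathbb{R}\times\mathbb{R}^n$ and real-valued, are measurable in $x\in\Omega$ for all $(s_0,s)$ and continuous in $(s_0,s)\in\mathbb{R}^{n+1}$ for a.a. $x\in\Omega$. There are nonnegative functions $\Phi_i\in L_{p_i'(\cdot)}(\Omega)$, $\phi\in L_1(\Omega)$, $\Phi_0\in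 L_1(\Omega)$, continuous nondecreasing functions $\widehat a_i:\mathbb{R}^+\to\mathbb{R}^+\setminus\{0\}$ and $\widehat b:\mathbb{R}^+\to\mathbb{R}^+$, and a number $\overline a>0$ such that for a.a. $x\in\Omega$ and all $s_0\in\mathbb{R}$, $s,t\in\mathbb{R}^n$: - (A0) $\max_{1\le i\le n}p_i(x)\le p_0(x)$ (for all $x\in\Omega$); - (A1) $|a_i(x,s_0,s)|\le\widehat a_i(|s_0|)\big(\mathrm{P}(x,s)^{1/p_i'(x)}+\Phi_i(x)\big)$, $i=1,\dots,n$; - (A2) $(a(x,s_0,s)-a(x,s_0,t))\cdot(s-t)>0$ for $s\ne t$; - (A3) $a(x,s_0,s)\cdot s\ge\overline a\,\mathrm{P}(x,s)-\phi(x)$; - (A4) $|b(x,s_0,s)|\le\widehat b(|s_0|)\big(\mathrm{P}(x,s)+\Phi_0(x)\big)$; - (A5) $b(x,s_0,s)s_0\ge0$. **Entropy solution.** For $k>0$, $T_k(r)=\max(-k,\min(k,r))$. $\mathring{\mathcal T}^1_{\overrightarrow{\mathbf p}(\cdot)}(\Omega)$ is the set of measurable $u:\Omega\to\mathbb{R}$ with $T_k(u)\in\mathring{W}^1_{\overrightarrow{\mathbf p}(\cdot)}(\Omega)$ for every $k>0$; for such $u$, $\nabla u$ denotes the measurable vector function with $\nabla T_k(u)=\chi_{\{|u|<k\}}\nabla u$ a.e. for all $k>0$. An entropy solution is a function $u\in\mathring{\mathcal T}^1_{\overrightarrow{\mathbf p}(\cdot)}(\Omega)$ such that (1) $b(x,u,\nabla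 u)\in L_1(\Omega)$; (2) for all $k>0$ and all $\xi\in C_0^1(\Omega)$, $$\int_\Omega\big(b(x,u,\nabla u)+|u|^{p_0(x)-2}u+f\big)T_k(u-\xi)\,dx+\int_\Omega a(x,u,\nabla u)\cdot\nabla T_k(u-\xi)\,dx\le0.$$ **Approximation procedure.** For $m\in\mathbb{N}$ put $\Omega(m)=\{x\in\Omega:|x|<m\}$, $$f^m(x)=\frac{f(x)}{1+|f(x)|/m}\chi_{\Omega(m)}(x),\qquad b^m(x,s_0,s)=\frac{b(x,s_0,s)}{1+|b(x,s_0,s)|/m}\chi_{\Omega(m)}(x).$$ A generalized solution of the $m$-th approximate problem is a function $u^m\in\mathring{W}^1_{\overrightarrow{\mathbf p}(\cdot)}(\Omega)$ such that for all $v\in\mathring{W}^1_{\overrightarrow{\mathbf p}(\cdot)}(\Omega)$ $$\int_\Omega a(x,T_m(u^m),\nabla u^m)\cdot\nabla v\,dx+\int_\Omega\big(b^m(x,u^m,\nabla u^m)+|u^m|^{p_0(x)-2}u^m+f^m\big)v\,dx=0.$$ **Renormalized solution.** A renormalized solution is a function $u\in\mathring{\mathcal T}^1_{\overrightarrow{\mathbf p}(\cdot)}(\Omega)$ such that (1) $b(x,u,\nabla u)\in L_1(\Omega)$; (2) $\lim_{h\to\infty}\int_{\{x\in\Omega:\,h\le|u|<h+1\}}\mathrm{P}(x,\nabla u)\,dx=0$; (3) for any smooth function $S\in W^1_\infty(\mathbb{R})$ with compact support and any $\xi\in C_0^1(\Omega)$, $$\int_\Omega\big(b(x,u,\nabla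 u)+|u|^{p_0(x)-2}u+f\big)S(u)\xi\,dx+\int_\Omega a(x,u,\nabla u)\cdot\big(S'(u)\xi\nabla u+S(u)\nabla\xi\big)\,dx=0.$$ *)

theory Defs
  imports "HOL-Analysis.Analysis"
begin

text \<open>
  Functions on a domain \<open>\<Omega>\<close> are total functions on the whole space of which only the values on
  \<open>\<Omega>\<close> matter; measurability, integrals and ``almost everywhere'' refer to Lebesgue measure on
  \<open>\<Omega>\<close>, that is \<^term>\<open>lebesgue_on \<Omega>\<close>.
\<close>

section \<open>Classical test functions\<close>

text \<open>\<open>C_k k f\<close>: \<open>f\<close> is \<open>k\<close> times continuously differentiable on the whole space.\<close>

primrec C_k :: "nat \<Rightarrow> ('a::euclidean_space \<Rightarrow> real) \<Rightarrow> bool" where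
  "C_k 0 f \<longleftrightarrow> continuous_on UNIV f"
| "C_k (Suc k) f \<longleftrightarrow> (\<forall>x. f differentiable (at x)) \<and>
     (\<forall>e\<in>Basis. C_k k (\<lambda>x. frechet_derivative f (at x) e))"

definition smooth :: "('a::euclidean_space \<Rightarrow> real) \<Rightarrow> bool" where
  "smooth f \<longleftrightarrow> (\<forall>k. C_k k f)"

definition supp :: "('a::euclidean_space \<Rightarrow> real) \<Rightarrow> 'a set" where
  "supp f = closure {x. f x \<noteq> 0}"

text \<open>A function with compact support in the open set \<open>\<Omega>\<close> is represented by its extension by zero.\<close>

definition C0_1 :: "'a::euclidean_space set \<Rightarrow> ('a \<Rightarrow> real) set" where
  "C0_1 \<Omega> = {f. C_k 1 f \<and> compact (supp f) \<and> supp f \<subseteq> \<Omega>}"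

definition C0_infty :: "'a::euclidean_space set \<Rightarrow> ('a \<Rightarrow> real) set" where
  "C0_infty \<Omega> = {f. smooth f \<and> compact (supp f) \<and> supp f \<subseteq> \<Omega>}"

definition grad :: "(real^'n \<Rightarrow> real) \<Rightarrow> real^'n \<Rightarrow> real^'n" where
  "grad f x = (\<chi> i. frechet_derivative f (at x) (axis i 1))"

section \<open>Variable exponent spaces\<close>

definition domain :: "'a::euclidean_space set \<Rightarrow> bool" where
  "domain \<Omega> \<longleftrightarrow> open \<Omega> \<and> connected \<Omega> \<and> \<Omega> \<noteq> {}"

text \<open>The two boundedness conditions make the real-valued infimum and supremum meaningful.\<close>

definition C_plus :: "'a::euclidean_space set \<Rightarrow> ('a \<Rightarrow> real) set" where
  "C_plus \<Omega> = {p. continuous_on (closure \<Omega>) p \<and> bdd_below (p ` \<Omega>) \<and> bdd_above (p ` \<Omega>)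
                  \<and> 1 < (INF x\<in>\<Omega>. p x)}"

definition conj_exp :: "('a \<Rightarrow> real) \<Rightarrow> 'a \<Rightarrow> real" where
  "conj_exp p x = p x / (p x - 1)"

definition L1 :: "'a::euclidean_space set \<Rightarrow> ('a \<Rightarrow> real) set" where
  "L1 \<Omega> = {v. integrable (lebesgue_on \<Omega>) v}"

definition Lp_var :: "'a::euclidean_space set \<Rightarrow> ('a \<Rightarrow> real) \<Rightarrow> ('a \<Rightarrow> real) set" where
  "Lp_var \<Omega> p = {v. v \<in> borel_measurable (lebesgue_on \<Omega>) \<and>
                     integrable (lebesgue_on \<Omega>) (\<lambda>x. \<bar>v x\<bar> powr p x)}"

definition lux_norm :: "'a::euclidean_space set \<Rightarrow> ('a \<Rightarrow> real) \<Rightarrow> ('a \<Rightarrow> real) \<Rightarrow> real" where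
  "lux_norm \<Omega> p v =
     Inf {k. k > 0 \<and> (\<integral>\<^sup>+ x. ennreal (\<bar>v x / k\<bar> powr p x) \<partial>lebesgue_on \<Omega>) \<le> 1}"

text \<open>
  The completion of \<open>C0_infty \<Omega>\<close> in the norm
  \<open>lux_norm \<Omega> p0 v + (\<Sum>i. lux_norm \<Omega> (p i) (v_x_i))\<close>, realised as the closure of the pairs
  \<open>(\<phi>, grad \<phi>)\<close> in the product of the Banach spaces \<open>Lp_var \<Omega> p0\<close> and \<open>Lp_var \<Omega> (p i)\<close>.
  The second component of a pair is the (weak) gradient of the first one and is determined by it
  almost everywhere, so the elements of the completion are identified with their first components.
\<close>

definition W0_pairs ::
  "(real^'n) set \<Rightarrow> (real^'n \<Rightarrow> real) \<Rightarrow> ('n \<Rightarrow> real^'n \<Rightarrow> real) \<Rightarrow>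
   ((real^'n \<Rightarrow> real) \<times> (real^'n \<Rightarrow> real^'n)) set" where
  "W0_pairs \<Omega> p0 p = {(v, g). v \<in> Lp_var \<Omega> p0 \<and> (\<forall>i. (\<lambda>x. g x $ i) \<in> Lp_var \<Omega> (p i)) \<and>
     (\<exists>\<phi>::nat \<Rightarrow> real^'n \<Rightarrow> real. (\<forall>j. \<phi> j \<in> C0_infty \<Omega>) \<and>
        (\<lambda>j. lux_norm \<Omega> p0 (\<lambda>x. \<phi> j x - v x)
             + (\<Sum>i\<in>UNIV. lux_norm \<Omega> (p i) (\<lambda>x. grad (\<phi> j) x $ i - g x $ i)))
        \<longlonglongrightarrow> 0)}"

definition W0 ::
  "(real^'n) set \<Rightarrow> (real^'n \<Rightarrow> real) \<Rightarrow> ('n \<Rightarrow> real^'n \<Rightarrow> real) \<Rightarrow> (real^'n \<Rightarrow> real) set" where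
  "W0 \<Omega> p0 p = {v. \<exists>g. (v, g) \<in> W0_pairs \<Omega> p0 p}"

definition wgrad ::
  "(real^'n) set \<Rightarrow> (real^'n \<Rightarrow> real) \<Rightarrow> ('n \<Rightarrow> real^'n \<Rightarrow> real) \<Rightarrow>
   (real^'n \<Rightarrow> real) \<Rightarrow> real^'n \<Rightarrow> real^'n" where
  "wgrad \<Omega> p0 p v = (SOME g. (v, g) \<in> W0_pairs \<Omega> p0 p)"

definition trunc :: "real \<Rightarrow> real \<Rightarrow> real" where
  "trunc k r = max (- k) (min k r)"

definition T0 ::
  "(real^'n) set \<Rightarrow> (real^'n \<Rightarrow> real) \<Rightarrow> ('n \<Rightarrow> real^'n \<Rightarrow> real) \<Rightarrow> (real^'n \<Rightarrow> real) set" where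
  "T0 \<Omega> p0 p = {u. u \<in> borel_measurable (lebesgue_on \<Omega>) \<and>
                    (\<forall>k>0. (\<lambda>x. trunc k (u x)) \<in> W0 \<Omega> p0 p)}"

text \<open>
  The gradient of \<open>u \<in> T0 \<Omega> p0 p\<close>; it is unique almost everywhere on \<open>\<Omega>\<close>, and so the choice made
  by \<open>SOME\<close> does not influence integrals over \<open>\<Omega>\<close>.
\<close>

definition tgrad ::
  "(real^'n) set \<Rightarrow> (real^'n \<Rightarrow> real) \<Rightarrow> ('n \<Rightarrow> real^'n \<Rightarrow> real) \<Rightarrow>
   (real^'n \<Rightarrow> real) \<Rightarrow> real^'n \<Rightarrow> real^'n" where
  "tgrad \<Omega> p0 p u = (SOME U. U \<in> borel_measurable (lebesgue_on \<Omega>) \<and>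
     (\<forall>k>0. AE x in lebesgue_on \<Omega>.
        wgrad \<Omega> p0 p (\<lambda>y. trunc k (u y)) x = indicator {y. \<bar>u y\<bar> < k} x *\<^sub>R U x))"

section \<open>Structural assumptions\<close>

definition Pfun :: "('n::finite \<Rightarrow> real^'n \<Rightarrow> real) \<Rightarrow> real^'n \<Rightarrow> real^'n \<Rightarrow> real" where
  "Pfun p x s = (\<Sum>i\<in>UNIV. \<bar>s $ i\<bar> powr p i x)"

definition caratheodory ::
  "(real^'n) set \<Rightarrow> (real^'n \<Rightarrow> real \<Rightarrow> real^'n \<Rightarrow> real) \<Rightarrow> bool" where
  "caratheodory \<Omega> c \<longleftrightarrow>
     (\<forall>s0 s. (\<lambda>x. c x s0 s) \<in> borel_measurable (lebesgue_on \<Omega>)) \<and>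
     (AE x in lebesgue_on \<Omega>. continuous_on UNIV (\<lambda>(s0, s). c x s0 s))"

definition structural_assumptions ::
  "(real^'n) set \<Rightarrow> (real^'n \<Rightarrow> real) \<Rightarrow> ('n \<Rightarrow> real^'n \<Rightarrow> real) \<Rightarrow>
   (real^'n \<Rightarrow> real \<Rightarrow> real^'n \<Rightarrow> real^'n) \<Rightarrow> (real^'n \<Rightarrow> real \<Rightarrow> real^'n \<Rightarrow> real) \<Rightarrow> bool" where
  "structural_assumptions \<Omega> p0 p a b \<longleftrightarrow>
     (\<forall>i. caratheodory \<Omega> (\<lambda>x s0 s. a x s0 s $ i)) \<and> caratheodory \<Omega> b \<and>
     (\<forall>x\<in>\<Omega>. \<forall>i. p i x \<le> p0 x) \<and>
     (\<exists>(\<Phi> :: 'n \<Rightarrow> real^'n \<Rightarrow> real) (\<phi> :: real^'n \<Rightarrow> real) (\<Phi>0 :: real^'n \<Rightarrow> real)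
        (ahat :: 'n \<Rightarrow> real \<Rightarrow> real) (bhat :: real \<Rightarrow> real) (abar :: real).
        (\<forall>i. \<Phi> i \<in> Lp_var \<Omega> (conj_exp (p i)) \<and> (\<forall>x\<in>\<Omega>. 0 \<le> \<Phi> i x)) \<and>
        \<phi> \<in> L1 \<Omega> \<and> (\<forall>x\<in>\<Omega>. 0 \<le> \<phi> x) \<and>
        \<Phi>0 \<in> L1 \<Omega> \<and> (\<forall>x\<in>\<Omega>. 0 \<le> \<Phi>0 x) \<and>
        (\<forall>i. continuous_on {0..} (ahat i) \<and> mono_on {0..} (ahat i) \<and> (\<forall>r\<ge>0. 0 < ahat i r)) \<and>
        continuous_on {0..} bhat \<and> mono_on {0..} bhat \<and> (\<forall>r\<ge>0. 0 \<le> bhat r) \<and>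
        0 < abar \<and>
        (AE x in lebesgue_on \<Omega>. \<forall>s0 s t.
           (\<forall>i. \<bar>a x s0 s $ i\<bar>
                 \<le> ahat i \<bar>s0\<bar> * (Pfun p x s powr (1 / conj_exp (p i) x) + \<Phi> i x)) \<and>
           (s \<noteq> t \<longrightarrow> (a x s0 s - a x s0 t) \<bullet> (s - t) > 0) \<and>
           a x s0 s \<bullet> s \<ge> abar * Pfun p x s - \<phi> x \<and>
           \<bar>b x s0 s\<bar> \<le> bhat \<bar>s0\<bar> * (Pfun p x s + \<Phi>0 x) \<and>
           b x s0 s * s0 \<ge> 0))"

section \<open>Solutions\<close>

text \<open>
  \<open>integral\<^sup>L\<close> is \<open>0\<close> for non-integrable functions, so the finiteness of the integrals occurring in
  the notions of solution is spelled out.  Under the structural assumptions it is automatic, except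
  for the zero-order integral of the entropy inequality: that one always exists in the extended
  sense with a value in \<open>(-\<infinity>, \<infinity>]\<close>, and the inequality forces it to be finite.
\<close>

definition entropy_solution ::
  "(real^'n) set \<Rightarrow> (real^'n \<Rightarrow> real) \<Rightarrow> ('n \<Rightarrow> real^'n \<Rightarrow> real) \<Rightarrow>
   (real^'n \<Rightarrow> real \<Rightarrow> real^'n \<Rightarrow> real^'n) \<Rightarrow> (real^'n \<Rightarrow> real \<Rightarrow> real^'n \<Rightarrow> real) \<Rightarrow>
   (real^'n \<Rightarrow> real) \<Rightarrow> (real^'n \<Rightarrow> real) \<Rightarrow> bool" where
  "entropy_solution \<Omega> p0 p a b f u \<longleftrightarrow>
     u \<in> T0 \<Omega> p0 p \<and>
     (\<lambda>x. b x (u x) (tgrad \<Omega> p0 p u x)) \<in> L1 \<Omega> \<and>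
     (\<forall>k>0. \<forall>\<xi>\<in>C0_1 \<Omega>.
        (let F = (\<lambda>x. (b x (u x) (tgrad \<Omega> p0 p u x) + \<bar>u x\<bar> powr (p0 x - 2) * u x + f x)
                        * trunc k (u x - \<xi> x));
             G = (\<lambda>x. a x (u x) (tgrad \<Omega> p0 p u x)
                        \<bullet> wgrad \<Omega> p0 p (\<lambda>y. trunc k (u y - \<xi> y)) x)
         in F \<in> L1 \<Omega> \<and> G \<in> L1 \<Omega> \<and>
            integral\<^sup>L (lebesgue_on \<Omega>) F + integral\<^sup>L (lebesgue_on \<Omega>) G \<le> 0))"

definition \<Omega>_cut :: "(real^'n) set \<Rightarrow> nat \<Rightarrow> (real^'n) set" where
  "\<Omega>_cut \<Omega> m = {x\<in>\<Omega>. norm x < real m}"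

definition f_approx :: "(real^'n) set \<Rightarrow> (real^'n \<Rightarrow> real) \<Rightarrow> nat \<Rightarrow> real^'n \<Rightarrow> real" where
  "f_approx \<Omega> f m x = f x / (1 + \<bar>f x\<bar> / real m) * indicator (\<Omega>_cut \<Omega> m) x"

definition b_approx ::
  "(real^'n) set \<Rightarrow> (real^'n \<Rightarrow> real \<Rightarrow> real^'n \<Rightarrow> real) \<Rightarrow> nat \<Rightarrow>
   real^'n \<Rightarrow> real \<Rightarrow> real^'n \<Rightarrow> real" where
  "b_approx \<Omega> b m x s0 s = b x s0 s / (1 + \<bar>b x s0 s\<bar> / real m) * indicator (\<Omega>_cut \<Omega> m) x"

definition approx_solution ::
  "(real^'n) set \<Rightarrow> (real^'n \<Rightarrow> real) \<Rightarrow> ('n \<Rightarrow> real^'n \<Rightarrow> real) \<Rightarrow>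
   (real^'n \<Rightarrow> real \<Rightarrow> real^'n \<Rightarrow> real^'n) \<Rightarrow> (real^'n \<Rightarrow> real \<Rightarrow> real^'n \<Rightarrow> real) \<Rightarrow>
   (real^'n \<Rightarrow> real) \<Rightarrow> nat \<Rightarrow> (real^'n \<Rightarrow> real) \<Rightarrow> bool" where
  "approx_solution \<Omega> p0 p a b f m w \<longleftrightarrow>
     w \<in> W0 \<Omega> p0 p \<and>
     (\<forall>v\<in>W0 \<Omega> p0 p.
        (let F = (\<lambda>x. a x (trunc (real m) (w x)) (wgrad \<Omega> p0 p w x) \<bullet> wgrad \<Omega> p0 p v x);
             G = (\<lambda>x. (b_approx \<Omega> b m x (w x) (wgrad \<Omega> p0 p w x)
                        + \<bar>w x\<bar> powr (p0 x - 2) * w x + f_approx \<Omega> f m x) * v x)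
         in F \<in> L1 \<Omega> \<and> G \<in> L1 \<Omega> \<and>
            integral\<^sup>L (lebesgue_on \<Omega>) F + integral\<^sup>L (lebesgue_on \<Omega>) G = 0))"

text \<open>\<open>m\<close> ranges over the positive integers.\<close>

definition obtained_by_approximation ::
  "(real^'n) set \<Rightarrow> (real^'n \<Rightarrow> real) \<Rightarrow> ('n \<Rightarrow> real^'n \<Rightarrow> real) \<Rightarrow>
   (real^'n \<Rightarrow> real \<Rightarrow> real^'n \<Rightarrow> real^'n) \<Rightarrow> (real^'n \<Rightarrow> real \<Rightarrow> real^'n \<Rightarrow> real) \<Rightarrow>
   (real^'n \<Rightarrow> real) \<Rightarrow> (real^'n \<Rightarrow> real) \<Rightarrow> bool" where
  "obtained_by_approximation \<Omega> p0 p a b f u \<longleftrightarrow>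
     (\<exists>(w :: nat \<Rightarrow> real^'n \<Rightarrow> real) (r :: nat \<Rightarrow> nat).
        (\<forall>m\<ge>1. approx_solution \<Omega> p0 p a b f m (w m)) \<and> strict_mono r \<and>
        (AE x in lebesgue_on \<Omega>. (\<lambda>j. w (r j) x) \<longlonglongrightarrow> u x))"

text \<open>
  For a smooth \<open>S\<close> membership in the Sobolev space \<open>W\<^sup>1\<^sub>\<infinity>\<close> of the real line means that \<open>S\<close> and
  its derivative are bounded.
\<close>

definition renormalized_solution ::
  "(real^'n) set \<Rightarrow> (real^'n \<Rightarrow> real) \<Rightarrow> ('n \<Rightarrow> real^'n \<Rightarrow> real) \<Rightarrow>
   (real^'n \<Rightarrow> real \<Rightarrow> real^'n \<Rightarrow> real^'n) \<Rightarrow> (real^'n \<Rightarrow> real \<Rightarrow> real^'n \<Rightarrow> real) \<Rightarrow>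
   (real^'n \<Rightarrow> real) \<Rightarrow> (real^'n \<Rightarrow> real) \<Rightarrow> bool" where
  "renormalized_solution \<Omega> p0 p a b f u \<longleftrightarrow>
     u \<in> T0 \<Omega> p0 p \<and>
     (\<lambda>x. b x (u x) (tgrad \<Omega> p0 p u x)) \<in> L1 \<Omega> \<and>
     ((\<lambda>h::real. \<integral>\<^sup>+ x. ennreal (Pfun p x (tgrad \<Omega> p0 p u x))
                      * indicator {y. h \<le> \<bar>u y\<bar> \<and> \<bar>u y\<bar> < h + 1} x \<partial>lebesgue_on \<Omega>)
        \<longlongrightarrow> 0) at_top \<and>
     (\<forall>(S :: real \<Rightarrow> real) \<xi>.
        smooth S \<and> bounded (range S) \<and> bounded (range (deriv S)) \<and> compact (supp S) \<and>
        \<xi> \<in> C0_1 \<Omega> \<longrightarrow>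
        (let F = (\<lambda>x. (b x (u x) (tgrad \<Omega> p0 p u x) + \<bar>u x\<bar> powr (p0 x - 2) * u x + f x)
                        * S (u x) * \<xi> x);
             G = (\<lambda>x. a x (u x) (tgrad \<Omega> p0 p u x)
                        \<bullet> ((deriv S (u x) * \<xi> x) *\<^sub>R tgrad \<Omega> p0 p u x + S (u x) *\<^sub>R grad \<xi> x))
         in F \<in> L1 \<Omega> \<and> G \<in> L1 \<Omega> \<and>
            integral\<^sup>L (lebesgue_on \<Omega>) F + integral\<^sup>L (lebesgue_on \<Omega>) G = 0))"

end

theory Submission
  imports Defs
begin

text \<open>
  Every function \<open>T\<^sub>h(u) + S(u) \<zeta>\<close> is a limit of uniformly bounded test functions and so is
  admissible in the entropy inequality.  With a truncation level above \<open>sup |S(u) \<zeta>|\<close> this yields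
  \<open>abar \<integral> P(x, \<nabla>u) \<le> X + o(1)\<close> as \<open>h \<rightarrow> \<infinity>\<close>, where the integral extends over \<open>{h \<le> |u| < h + 1}\<close> and \<open>X\<close>
  is the left-hand side of the renormalized equation for \<open>S\<close> and \<open>\<zeta>\<close>.  For \<open>S = 0\<close> this is the decay of the
  energy; in general it shows \<open>X \<ge> 0\<close>, and replacing \<open>S\<close> by \<open>-S\<close> gives \<open>X = 0\<close>.

  The limit passages need the gradients of the truncations of \<open>u\<close> and of their differences with test
  functions, hence the uniqueness of weak gradients (by the fundamental lemma), their vanishing on level
  sets, and the chain rule for truncations.
\<close>

text \<open>The entropy inequality is granted for C^1 functions with compact support, but T_h(u) +
  S(u) \<zeta> is in general neither smooth nor compactly supported, and norm convergence alone is
  awkward for nonlinear integrands. Convergence in the Sobolev space is therefore traded for almost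
  everywhere convergence of functions and gradients under one integrable majorant; composition,
  truncation and differences then become pointwise questions.

  The delicate term is \<open>z\<close>, the power |u|^(p0 - 1) with the sign of u. On a domain of
  infinite measure it need not be integrable, and for large |u| only its sign is used: u - \<xi> has
  the sign of u wherever |\<xi>| \<le> |u|. A common bound B of the approximating test functions
  splits the term into a part on {|u| < B}, controlled by the modular of a truncation of u, and a
  nonnegative part.

  The summand T_h(u) serves to isolate a bounded range of u: below the height h only - S(u) \<zeta>
  survives in u - \<xi>, and above it the integrable data contribute tails over {|u| \<ge> h}, which
  vanish in the limit. As X does not depend on h, the limit leaves an inequality for X
  alone.\<close>

lemma frechet_derivative_eqI:
  "(f has_derivative D) (at x) \<Longrightarrow> frechet_derivative f (at x) = D"
  by (rule frechet_derivative_at[symmetric])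

section \<open>Calculus of \<open>C_k\<close> and of smooth functions\<close>

lemma C_k_SucI:
  assumes "\<And>x. (f has_derivative D x) (at x)" "\<And>e. e \<in> Basis \<Longrightarrow> C_k k (\<lambda>x. D x e)"
  shows "C_k (Suc k) f"
  using assms by (auto simp: differentiable_def frechet_derivative_eqI[OF assms(1)])

lemma C_k_SucD:
  assumes "C_k (Suc k) f"
  shows "(f has_derivative frechet_derivative f (at x)) (at x)"
    and "e \<in> Basis \<Longrightarrow> C_k k (\<lambda>x. frechet_derivative f (at x) e)"
  using assms by (auto simp: frechet_derivative_works[symmetric])

lemma C_k_continuous: "C_k k f \<Longrightarrow> continuous_on UNIV f"
proof (cases k)
  case (Suc m)
  assume "C_k k f"
  then show ?thesis using Suc
    by (auto intro!: differentiable_imp_continuous_on simp: differentiable_on_def)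
qed auto

lemma C_k_Suc_imp: "C_k (Suc k) f \<Longrightarrow> C_k k f"
proof (induction k arbitrary: f)
  case 0
  then show ?case using C_k_continuous[OF 0] by simp
next
  case (Suc k)
  then show ?case by (metis C_k.simps(2))
qed

lemma C_k_antimono: "C_k m f \<Longrightarrow> k \<le> m \<Longrightarrow> C_k k f"
proof (induction m)
  case (Suc m)
  then show ?case by (metis C_k_Suc_imp le_Suc_eq)
qed simp

lemma C_k_const: "C_k k (\<lambda>x. c)"
proof (induction k arbitrary: c)
  case (Suc k)
  show ?case by (rule C_k_SucI[where D="\<lambda>_ _. 0"]) (auto intro: Suc)
qed auto

lemma C_k_add: "C_k k f \<Longrightarrow> C_k k g \<Longrightarrow> C_k k (\<lambda>x. f x + g x)"
proof (induction k arbitrary: f g)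
  case (Suc k)
  show ?case
    by (rule C_k_SucI[OF has_derivative_add[OF C_k_SucD(1)[OF Suc.prems(1)] C_k_SucD(1)[OF Suc.prems(2)]]])
      (intro Suc.IH C_k_SucD(2) Suc.prems)
qed (auto intro: continuous_intros)

lemma C_k_mult: "C_k k f \<Longrightarrow> C_k k g \<Longrightarrow> C_k k (\<lambda>x. f x * g x)"
proof (induction k arbitrary: f g)
  case (Suc k)
  show ?case
    by (rule C_k_SucI[OF has_derivative_mult[OF C_k_SucD(1)[OF Suc.prems(1)] C_k_SucD(1)[OF Suc.prems(2)]]])
      (auto intro!: Suc.IH C_k_add C_k_SucD(2) Suc.prems C_k_Suc_imp[OF Suc.prems(1)] C_k_Suc_imp[OF Suc.prems(2)]
        simp del: C_k.simps)
qed (auto intro: continuous_intros)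

lemma C_k_diff: "C_k k f \<Longrightarrow> C_k k g \<Longrightarrow> C_k k (\<lambda>x. f x - g x)"
  using C_k_add[of k f "\<lambda>x. -1 * g x"] C_k_mult[OF C_k_const, of k g "-1"] by simp

lemma C_k_inner: "C_k k (\<lambda>x. x \<bullet> c)"
proof (cases k)
  case (Suc m)
  show ?thesis
    unfolding Suc
    by (intro C_k_SucI[where D="\<lambda>_ h. h \<bullet> c"] C_k_const) (auto intro!: derivative_eq_intros)
qed (auto intro: continuous_intros)

lemma C_k_power2_norm: "C_k k (\<lambda>x. (norm x)\<^sup>2)"
proof (cases k)
  case (Suc m)
  have "((\<lambda>x. (norm x)\<^sup>2) has_derivative (\<lambda>h. 2 * (x \<bullet> h))) (at x)" for x :: 'a
    unfolding power2_norm_eq_inner by (auto intro!: derivative_eq_intros simp: inner_commute)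
  then show ?thesis unfolding Suc
    by (rule C_k_SucI) (auto intro!: C_k_mult C_k_const C_k_inner simp del: C_k.simps)
qed (auto intro: continuous_intros)

text \<open>On the line the Frechet derivative is multiplication by its value at 1, which identifies
  the partial derivative used in \<open>C_k\<close> with \<open>deriv\<close>.\<close>

lemma C_k_Suc_real:
  fixes F :: "real \<Rightarrow> real"
  assumes "C_k (Suc k) F"
  shows "(F has_field_derivative deriv F x) (at x)" "C_k k (deriv F)"
proof -
  have *: "(F has_field_derivative frechet_derivative F (at x) 1) (at x)" for x
  proof -
    have "(F has_derivative frechet_derivative F (at x)) (at x)" using C_k_SucD(1)[OF assms] .
    moreover have "frechet_derivative F (at x) = (*) (frechet_derivative F (at x) 1)"
    proof
      fix h :: real
      have "linear (frechet_derivative F (at x))" using calculation has_derivative_linear by blast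
      from linear_scale[OF this, of h 1]
      show "frechet_derivative F (at x) h = frechet_derivative F (at x) 1 * h" by simp
    qed
    ultimately show ?thesis by (simp add: has_field_derivative_def)
  qed
  then have "deriv F x = frechet_derivative F (at x) 1" for x by (simp add: DERIV_imp_deriv)
  then have "deriv F = (\<lambda>x. frechet_derivative F (at x) 1)" by blast
  then show "(F has_field_derivative deriv F x) (at x)" "C_k k (deriv F)"
    using * C_k_SucD(2)[OF assms, of 1] by simp_all
qed

lemma C_k_Suc_realI:
  fixes F :: "real \<Rightarrow> real"
  assumes "\<And>x. (F has_field_derivative G x) (at x)" "C_k k G"
  shows "C_k (Suc k) F"
  by (rule C_k_SucI[where D="\<lambda>x. (*) (G x)"]) (use assms in \<open>auto simp: has_field_derivative_def\<close>)

lemma has_derivative_compose_real: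
  assumes "(F has_field_derivative d) (at (g x))" "(g has_derivative D) (at x)"
  shows "((\<lambda>x. F (g x)) has_derivative (\<lambda>h. d * D h)) (at x)"
  using has_derivative_compose[OF assms(2) assms(1)[unfolded has_field_derivative_def]] by simp

lemma C_k_compose:
  fixes F :: "real \<Rightarrow> real"
  shows "C_k k F \<Longrightarrow> C_k k g \<Longrightarrow> C_k k (\<lambda>x. F (g x))"
proof (induction k arbitrary: F g)
  case 0
  then show ?case using continuous_on_compose2[of UNIV F UNIV g] by simp
next
  case (Suc k)
  show ?case
    by (rule C_k_SucI[OF has_derivative_compose_real[OF C_k_Suc_real(1)[OF Suc.prems(1)] C_k_SucD(1)[OF Suc.prems(2)]]])
      (rule C_k_mult[OF Suc.IH[OF C_k_Suc_real(2)[OF Suc.prems(1)] C_k_Suc_imp[OF Suc.prems(2)]] C_k_SucD(2)[OF Suc.prems(2)]])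
qed

lemma smooth_const: "smooth (\<lambda>x. c)"
  and smooth_add: "smooth f \<Longrightarrow> smooth g \<Longrightarrow> smooth (\<lambda>x. f x + g x)"
  and smooth_diff: "smooth f \<Longrightarrow> smooth g \<Longrightarrow> smooth (\<lambda>x. f x - g x)"
  and smooth_mult: "smooth f \<Longrightarrow> smooth g \<Longrightarrow> smooth (\<lambda>x. f x * g x)"
  by (simp_all add: smooth_def C_k_const C_k_add C_k_diff C_k_mult del: C_k.simps)

lemma smooth_compose: "smooth F \<Longrightarrow> smooth g \<Longrightarrow> smooth (\<lambda>x. F (g x))"
  for F :: "real \<Rightarrow> real"
  by (simp add: smooth_def C_k_compose del: C_k.simps)

lemma smooth_ident: "smooth (\<lambda>x::real. x)"
  using C_k_inner[where c="1::real"] by (simp add: smooth_def)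

lemma smooth_real_DERIV: "smooth F \<Longrightarrow> (F has_field_derivative deriv F x) (at x)"
  and smooth_deriv: "smooth F \<Longrightarrow> smooth (deriv F)"
  for F :: "real \<Rightarrow> real"
proof -
  assume "smooth F"
  then have *: "C_k (Suc k) F" for k by (simp add: smooth_def del: C_k.simps)
  show "(F has_field_derivative deriv F x) (at x)" by (rule C_k_Suc_real(1)[OF *])
  show "smooth (deriv F)" unfolding smooth_def by (intro allI C_k_Suc_real(2)[OF *])
qed

lemma smooth_continuous: "smooth f \<Longrightarrow> continuous_on A f"
  using C_k_continuous[of 0 f] continuous_on_subset[of UNIV f A] by (simp add: smooth_def)

lemma smooth_C_k: "smooth f \<Longrightarrow> C_k k f"
  by (simp add: smooth_def)

text \<open>The derivative 1 - tanh^2 is a polynomial in tanh, so regularity of order k already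
  yields order k + 1. Both the smooth truncations and the functions that detect level sets are built
  from tanh.\<close>

lemma smooth_tanh: "smooth (tanh :: real \<Rightarrow> real)"
proof -
  have "C_k k (tanh :: real \<Rightarrow> real)" for k
  proof (induction k)
    case 0
    then show ?case by (auto intro!: continuous_intros)
  next
    case (Suc k)
    have "C_k k (\<lambda>x::real. 1 - tanh x * tanh x)"
      by (intro C_k_diff C_k_const C_k_mult Suc)
    then show ?case
      by (intro C_k_Suc_realI) (auto intro!: derivative_eq_intros simp: power2_eq_square)
  qed
  then show ?thesis by (simp add: smooth_def)
qed

lemma smooth_antideriv:
  fixes F :: "real \<Rightarrow> real"
  assumes "\<And>x. (F has_field_derivative G x) (at x)" "smooth G"
  shows "smooth F"
proof -
  have "C_k k F" for k
    by (rule C_k_Suc_imp, rule C_k_Suc_realI[OF assms(1)]) (use assms(2) in \<open>simp add: smooth_def\<close>)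
  then show ?thesis by (simp add: smooth_def)
qed

text \<open>This antiderivative of tanh differs from the absolute value by at most ln 2, which makes
  it the building block of \<open>strunc\<close>.\<close>

lemma DERIV_ln_cosh: "((\<lambda>x. ln (cosh x)) has_field_derivative tanh x) (at x)" for x :: real
  by (auto intro!: derivative_eq_intros simp: tanh_def divide_inverse)

lemma smooth_ln_cosh: "smooth (\<lambda>x::real. ln (cosh x))"
  by (rule smooth_antideriv[OF DERIV_ln_cosh smooth_tanh])

subsection \<open>A smooth bump\<close>

text \<open>The exponent \<open>m\<close> makes the family closed under differentiation.\<close>

definition flat :: "nat \<Rightarrow> real \<Rightarrow> real" where
  "flat m t = (if t > 0 then exp (- 1 / t) / t ^ m else 0)"

lemma flat_tendsto_0: "(flat m \<longlongrightarrow> 0) (at 0)"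
proof -
  have "((\<lambda>t. flat m t) \<longlongrightarrow> 0) (at_right 0)"
  proof (rule Lim_transform_eventually)
    \<comment> \<open>After the substitution of \<open>inverse t\<close> this is the fact that the
      exponential outgrows every power.\<close>
    have "((\<lambda>t. (inverse t) ^ m / exp (inverse t)) \<longlongrightarrow> 0) (at_right (0::real))"
      by (rule filterlim_compose[OF tendsto_power_div_exp_0 filterlim_inverse_at_top_right])
    then show "((\<lambda>t::real. (inverse t) ^ m / exp (inverse t)) \<longlongrightarrow> 0) (at_right 0)" .
    show "\<forall>\<^sub>F t in at_right (0::real). (inverse t) ^ m / exp (inverse t) = flat m t"
      by (rule eventually_at_right_less[THEN eventually_mono])
        (auto simp: flat_def exp_minus divide_simps power_inverse)
  qed
  moreover have "((\<lambda>t. flat m t) \<longlongrightarrow> 0) (at_left 0)"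
    by (rule Lim_transform_eventually[OF tendsto_const])
      (auto simp: flat_def eventually_at_filter)
  ultimately show ?thesis by (simp add: filterlim_split_at)
qed

text \<open>For t > 0 this is the product rule, for t < 0 everything vanishes locally. At 0 the
  difference quotient of \<open>flat m\<close> is exactly \<open>flat (Suc m)\<close>, whose limit
  is known from \<open>flat_tendsto_0\<close>.\<close>

lemma flat_DERIV: "(flat m has_field_derivative (flat (m + 2) t - real m * flat (m + 1) t)) (at t)"
proof -
  consider "t > 0" | "t < 0" | "t = 0" by linarith
  then show ?thesis
  proof cases
    case 1
    have "((\<lambda>t. exp (- 1 / t) / t ^ m) has_field_derivative (flat (m + 2) t - real m * flat (m + 1) t)) (at t)"
    proof -
      have *: "((\<lambda>t. exp (- (1 / t))) has_field_derivative exp (- (1 / t)) * (1 / t\<^sup>2)) (at t)"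
        using 1 by (auto intro!: derivative_eq_intros simp: power2_eq_square)
      have **: "((\<lambda>t. inverse (t ^ m)) has_field_derivative - real m * inverse (t ^ Suc m)) (at t)"
      proof (cases m)
        case (Suc k)
        have "((\<lambda>t. inverse (t ^ m)) has_field_derivative
            - (inverse (t ^ m) * (real m * t ^ (m - Suc 0)) * inverse (t ^ m))) (at t)"
          using 1 by (intro DERIV_inverse_fun[OF DERIV_pow, unfolded power_Suc2] DERIV_cong[OF DERIV_inverse'[OF DERIV_pow]]) auto
        moreover have "- (inverse (t ^ m) * (real m * t ^ (m - Suc 0)) * inverse (t ^ m)) = - real m * inverse (t ^ Suc m)"
          using 1 by (simp add: Suc field_simps)
        ultimately show ?thesis by (simp only:)
      qed simp
      have "((\<lambda>t. exp (- (1 / t)) * inverse (t ^ m)) has_field_derivative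
          exp (- (1 / t)) * (- real m * inverse (t ^ Suc m)) + exp (- (1 / t)) * (1 / t\<^sup>2) * inverse (t ^ m)) (at t)"
        by (rule DERIV_mult'[OF * **])
      moreover have "exp (- (1 / t)) * (- real m * inverse (t ^ Suc m)) + exp (- (1 / t)) * (1 / t\<^sup>2) * inverse (t ^ m)
          = flat (m + 2) t - real m * flat (m + 1) t"
        using 1 by (simp add: flat_def divide_inverse power2_eq_square)
      ultimately show ?thesis by (simp add: divide_inverse)
    qed
    then show ?thesis
      by (rule has_field_derivative_transform_within_open[where S="{0<..}"]) (use 1 in \<open>auto simp: flat_def\<close>)
  next
    case 2
    have "((\<lambda>t. 0) has_field_derivative 0) (at t)" by simp
    then have "(flat m has_field_derivative 0) (at t)"
      by (rule has_field_derivative_transform_within_open[where S="{..<0}"]) (use 2 in \<open>auto simp: flat_def\<close>)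
    then show ?thesis using 2 by (simp add: flat_def)
  next
    case 3
    have "(\<lambda>h. (flat m (0 + h) - flat m 0) / h) = flat (Suc m)"
      by (auto simp: flat_def fun_eq_iff)
    then show ?thesis using flat_tendsto_0[of "Suc m"] 3
      by (simp add: DERIV_def flat_def)
  qed
qed

lemma smooth_flat: "smooth (flat m)"
proof -
  have "C_k k (flat m)" for k
  proof (induction k arbitrary: m)
    case 0
    then show ?case by (auto intro!: continuous_at_imp_continuous_on DERIV_isCont[OF flat_DERIV])
  next
    case (Suc k)
    show ?case
      by (intro C_k_Suc_realI[OF flat_DERIV] C_k_diff C_k_mult C_k_const Suc)
  qed
  then show ?thesis by (simp add: smooth_def)
qed

text \<open>The squares keep the argument of \<open>flat 0\<close> a polynomial in the coordinates;
  the norm itself is not differentiable at the origin.\<close>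

definition bump :: "real \<Rightarrow> 'a::euclidean_space \<Rightarrow> real" where
  "bump r x = flat 0 (r\<^sup>2 - (norm x)\<^sup>2)"

lemma smooth_bump: "smooth (bump r :: 'a::euclidean_space \<Rightarrow> real)"
proof -
  have "smooth (\<lambda>x::'a. r\<^sup>2 - (norm x)\<^sup>2)"
    by (intro smooth_diff smooth_const) (simp add: smooth_def C_k_power2_norm)
  from smooth_compose[OF smooth_flat this] show ?thesis unfolding bump_def .
qed

lemma bump_nonneg: "0 \<le> bump r x"
  by (simp add: bump_def flat_def)

lemma bump_pos_iff:
  assumes "r > 0" shows "bump r x > 0 \<longleftrightarrow> norm x < r"
proof -
  have "bump r x > 0 \<longleftrightarrow> (norm x)\<^sup>2 < r\<^sup>2" by (simp add: bump_def flat_def)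
  also have "\<dots> \<longleftrightarrow> norm x < r"
    using assms power2_less_imp_less[of "norm x" r] power_strict_mono[of "norm x" r 2] by auto
  finally show ?thesis .
qed

lemma bump_eq_0: "r > 0 \<Longrightarrow> r \<le> norm x \<Longrightarrow> bump r x = 0"
  using bump_pos_iff[of r x] bump_nonneg[of r x] by linarith

subsection \<open>Test functions\<close>

lemma supp_subsetI:
  assumes "\<And>x. g x \<noteq> 0 \<Longrightarrow> f x \<noteq> 0" shows "supp g \<subseteq> supp f"
  unfolding supp_def by (rule closure_mono) (use assms in auto)

lemma compact_supp_subset: "compact K \<Longrightarrow> supp g \<subseteq> K \<Longrightarrow> compact (supp g)"
  unfolding supp_def using compact_Int_closed[OF _ closed_closure, of K "{x. g x \<noteq> 0}"]
  by (simp add: Int_absorb1)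

lemma not_in_supp: "x \<notin> supp f \<Longrightarrow> f x = 0"
  unfolding supp_def using closure_subset[of "{x. f x \<noteq> 0}"] by blast

lemma C0_infty_imp_C0_1: "f \<in> C0_infty \<Omega> \<Longrightarrow> f \<in> C0_1 \<Omega>"
  by (simp add: C0_infty_def C0_1_def smooth_C_k del: C_k.simps)

lemma C0_infty_supportI:
  assumes "smooth g" "f \<in> C0_infty \<Omega>" "\<And>x. f x = 0 \<Longrightarrow> g x = 0"
  shows "g \<in> C0_infty \<Omega>"
  using assms supp_subsetI[of g f] compact_supp_subset[of "supp f" g] unfolding C0_infty_def by auto

lemma C0_infty_add:
  assumes "f \<in> C0_infty \<Omega>" "g \<in> C0_infty \<Omega>"
  shows "(\<lambda>x. f x + g x) \<in> C0_infty \<Omega>"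
proof -
  have "supp (\<lambda>x. f x + g x) \<subseteq> supp f \<union> supp g"
    unfolding supp_def closure_Un[symmetric] by (rule closure_mono) auto
  moreover have "compact (supp f \<union> supp g)" using assms by (auto simp: C0_infty_def)
  ultimately have "compact (supp (\<lambda>x. f x + g x))"
    by (rule compact_supp_subset[rotated])
  then show ?thesis using assms \<open>supp _ \<subseteq> _\<close>
    using smooth_add[of f g] by (simp add: C0_infty_def) blast
qed

lemma C0_infty_smooth: "f \<in> C0_infty \<Omega> \<Longrightarrow> smooth f"
  by (simp add: C0_infty_def)

lemma C0_infty_compose:
  fixes F :: "real \<Rightarrow> real"
  assumes "f \<in> C0_infty \<Omega>" "smooth F" "F 0 = 0"
  shows "(\<lambda>x. F (f x)) \<in> C0_infty \<Omega>"
  by (rule C0_infty_supportI[OF smooth_compose[OF assms(2) C0_infty_smooth[OF assms(1)]] assms(1)])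
    (simp add: assms(3))

lemma C0_infty_uminus: "f \<in> C0_infty \<Omega> \<Longrightarrow> (\<lambda>x. - f x) \<in> C0_infty \<Omega>"
  using C0_infty_compose[of f \<Omega> "\<lambda>x. 0 - x", OF _ smooth_diff[OF smooth_const smooth_ident]] by simp

lemma C0_infty_mult: "smooth f \<Longrightarrow> g \<in> C0_infty \<Omega> \<Longrightarrow> (\<lambda>x. f x * g x) \<in> C0_infty \<Omega>"
  by (rule C0_infty_supportI[of _ g]) (simp_all add: smooth_mult C0_infty_smooth)

lemma has_derivative_zero_outside_supp:
  assumes "x \<notin> supp f" shows "(f has_derivative (\<lambda>_. 0)) (at x)"
proof -
  have "open (- supp f)" unfolding supp_def by auto
  then show ?thesis
    by (rule has_derivative_transform_within_open[OF has_derivative_const]) (use assms not_in_supp[of _ f] in auto)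
qed

lemma frechet_derivative_outside_supp: "x \<notin> supp f \<Longrightarrow> frechet_derivative f (at x) = (\<lambda>_. 0)"
  by (rule frechet_derivative_eqI[OF has_derivative_zero_outside_supp])

subsection \<open>Convolution and integration by parts\<close>

text \<open>The Leibniz rule speaks of gauge integrals over boxes, whereas \<open>conv\<close> and
  everything later use Lebesgue integrals. This is the bridge between the two.\<close>

lemma integral_cbox_eq_lborel:
  fixes f :: "'a::euclidean_space \<Rightarrow> real"
  assumes "continuous_on UNIV f" "\<And>x. x \<notin> cbox a b \<Longrightarrow> f x = 0"
  shows "integrable lborel f" "integral (cbox a b) f = integral\<^sup>L lborel f"
proof -
  have "set_integrable lborel (cbox a b) f"
    unfolding set_integrable_def
    by (rule borel_integrable_compact[unfolded set_integrable_def])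
      (use continuous_on_subset[OF assms(1)] in auto)
  moreover have *: "(\<lambda>x. indicator (cbox a b) x *\<^sub>R f x) = f"
    using assms(2) by (auto simp: indicator_def fun_eq_iff)
  ultimately show "integrable lborel f" by (simp add: set_integrable_def)
  show "integral (cbox a b) f = integral\<^sup>L lborel f"
    using set_borel_integral_eq_integral(2)[OF \<open>set_integrable lborel (cbox a b) f\<close>]
    unfolding set_lebesgue_integral_def * by simp
qed

text \<open>An affine substitution with factor -1, whose Jacobian has absolute value 1.\<close>

lemma lborel_reflect: "distr lborel borel (\<lambda>y. x - y) = (lborel :: 'a::euclidean_space measure)"
proof -
  have "lborel = density (distr lborel borel (\<lambda>y::'a. x + (-1) *\<^sub>R y)) (\<lambda>_. ennreal (\<bar>-1\<bar>^DIM('a)))"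
    by (rule lborel_affine) simp
  then show ?thesis by (simp add: density_1)
qed

lemma lborel_integral_reflect:
  fixes f :: "'a::euclidean_space \<Rightarrow> real"
  assumes [measurable]: "f \<in> borel_measurable borel"
  shows "(\<integral>y. f (x - y) \<partial>lborel) = integral\<^sup>L lborel f"
  using integral_distr[of "\<lambda>y. x - y" lborel borel f] by (simp add: lborel_reflect)

definition conv :: "('a::euclidean_space \<Rightarrow> real) \<Rightarrow> ('a \<Rightarrow> real) \<Rightarrow> 'a \<Rightarrow> real" where
  "conv f g x = (\<integral>y. f y * g (x - y) \<partial>lborel)"

lemma conv_commute:
  assumes "continuous_on UNIV f" "continuous_on UNIV g"
  shows "conv f g = conv g f"
proof
  fix x
  have [measurable]: "f \<in> borel_measurable borel" "g \<in> borel_measurable borel"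
    using assms by (auto intro: borel_measurable_continuous_onI)
  have "(\<lambda>y. f y * g (x - y)) \<in> borel_measurable borel" by measurable
  from lborel_integral_reflect[OF this, of x] show "conv f g x = conv g f x"
    by (simp add: conv_def mult.commute)
qed

text \<open>Since x enters only through the kernel, differentiation under the integral sign asks
  nothing of \<open>f\<close> beyond continuity.\<close>

lemma has_derivative_integral_translate:
  fixes K :: "'a::euclidean_space \<Rightarrow> real"
  assumes K: "C_k 1 K" and f: "continuous_on UNIV f"
  shows "((\<lambda>x. integral (cbox a b) (\<lambda>y. f y * K (x - y))) has_derivative
           (\<lambda>e. integral (cbox a b) (\<lambda>y. f y * frechet_derivative K (at (x - y)) e))) (at x)"
proof -
  \<comment> \<open>\<open>leibniz_rule\<close> expects the derivative as a continuous family of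
    bounded linear maps; its continuity is checked on basis vectors, where it is part of
    \<open>C_k 1\<close>.\<close>
  define DK where "DK z = Blinfun (frechet_derivative K (at z))" for z
  have K': "(K has_derivative frechet_derivative K (at z)) (at z)" for z
    using C_k_SucD(1)[of 0 K] K by simp
  then have DK: "blinfun_apply (DK z) = frechet_derivative K (at z)" for z
    using has_derivative_bounded_linear[OF K', of z] by (simp add: DK_def bounded_linear_Blinfun_apply)
  have contDK: "continuous_on UNIV DK"
    by (rule continuous_on_blinfun_componentwise) (use K in \<open>simp add: DK\<close>)
  have contK: "continuous_on UNIV K" by (rule C_k_continuous[OF K])
  define fx where "fx x y = f y *\<^sub>R DK (x - y)" for x y
  have contfx: "continuous_on A (\<lambda>(x, y). fx x y)" for A
    unfolding fx_def split_def
    by (intro continuous_intros continuous_on_compose2[OF f] continuous_on_compose2[OF contDK]) auto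
  have intfx: "fx x integrable_on cbox a b" for x
    unfolding fx_def
    by (intro integrable_continuous continuous_intros continuous_on_subset[OF f] continuous_on_compose2[OF contDK]) auto
  have "((\<lambda>x. integral (cbox a b) (\<lambda>y. f y * K (x - y))) has_derivative integral (cbox a b) (fx x)) (at x within UNIV)"
  proof (rule leibniz_rule[OF _ _ contfx])
    fix x y
    have "((\<lambda>x. K (x - y)) has_derivative (\<lambda>h. frechet_derivative K (at (x - y)) h)) (at x)"
      by (rule has_derivative_compose[OF _ K', of "\<lambda>x. x - y" "\<lambda>h. h"]) (auto intro!: derivative_eq_intros)
    then show "((\<lambda>x. f y * K (x - y)) has_derivative blinfun_apply (fx x y)) (at x within UNIV)"
      unfolding fx_def by (auto intro!: derivative_eq_intros simp: DK blinfun.scaleR_left)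
    show "(\<lambda>y. f y * K (x - y)) integrable_on cbox a b"
      by (intro integrable_continuous continuous_intros continuous_on_subset[OF f] continuous_on_compose2[OF contK]) auto
  qed auto
  moreover have "blinfun_apply (integral (cbox a b) (fx x)) e
      = integral (cbox a b) (\<lambda>y. f y * frechet_derivative K (at (x - y)) e)" for e
    unfolding blinfun_apply_integral[OF intfx] fx_def by (simp add: blinfun.scaleR_left DK)
  then have "blinfun_apply (integral (cbox a b) (fx x))
      = (\<lambda>e. integral (cbox a b) (\<lambda>y. f y * frechet_derivative K (at (x - y)) e))" by blast
  ultimately show ?thesis by simp
qed

lemma conv_eq_integral_cbox:
  fixes K :: "'a::euclidean_space \<Rightarrow> real"
  assumes "continuous_on UNIV f" "\<And>x. x \<notin> cbox a b \<Longrightarrow> f x = 0" "continuous_on UNIV K"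
  shows "conv f K x = integral (cbox a b) (\<lambda>y. f y * K (x - y))"
  unfolding conv_def
  by (rule integral_cbox_eq_lborel(2)[symmetric])
    (auto intro!: continuous_on_mult assms continuous_on_compose2[OF assms(3)] continuous_on_diff continuous_on_const continuous_on_id)

lemma has_derivative_conv:
  fixes K :: "'a::euclidean_space \<Rightarrow> real"
  assumes f: "continuous_on UNIV f" "\<And>x. x \<notin> cbox a b \<Longrightarrow> f x = 0" and K: "C_k 1 K"
  shows "frechet_derivative (conv f K) (at x) e = integral (cbox a b) (\<lambda>y. f y * frechet_derivative K (at (x - y)) e)"
    and "conv f K differentiable at x"
    and "e \<in> Basis \<Longrightarrow> frechet_derivative (conv f K) (at x) e = conv f (\<lambda>z. frechet_derivative K (at z) e) x"
proof -
  have eq: "conv f K = (\<lambda>x. integral (cbox a b) (\<lambda>y. f y * K (x - y)))"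
    by (rule ext, rule conv_eq_integral_cbox[OF f C_k_continuous[OF K]])
  have *: "(conv f K has_derivative
           (\<lambda>e. integral (cbox a b) (\<lambda>y. f y * frechet_derivative K (at (x - y)) e))) (at x)"
    unfolding eq by (rule has_derivative_integral_translate[OF K f(1)])
  then show 1: "frechet_derivative (conv f K) (at x) e = integral (cbox a b) (\<lambda>y. f y * frechet_derivative K (at (x - y)) e)"
    by (simp add: frechet_derivative_eqI)
  show "conv f K differentiable at x" using * by (rule differentiableI)
  assume "e \<in> Basis"
  then have "continuous_on UNIV (\<lambda>z. frechet_derivative K (at z) e)" using K by simp
  then show "frechet_derivative (conv f K) (at x) e = conv f (\<lambda>z. frechet_derivative K (at z) e) x"
    unfolding 1 by (subst conv_eq_integral_cbox[OF f]) auto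
qed

text \<open>All derivatives fall on the kernel, so the convolution inherits the regularity of
  \<open>K\<close> while \<open>f\<close> is merely continuous and vanishes off a box.\<close>

lemma C_k_conv:
  fixes K :: "'a::euclidean_space \<Rightarrow> real"
  assumes f: "continuous_on UNIV f" "\<And>x. x \<notin> cbox a b \<Longrightarrow> f x = 0"
  shows "C_k k K \<Longrightarrow> C_k k (conv f K)"
proof (induction k arbitrary: K)
  case 0
  have "continuous_on UNIV (\<lambda>x. integral (cbox a b) (\<lambda>y. f y * K (x - y)))"
  proof (rule integral_continuous_on_param)
    have K: "continuous_on UNIV K" using 0 by simp
    show "continuous_on (UNIV \<times> cbox a b) (\<lambda>(x, y). f y * K (x - y))"
      unfolding split_def
      by (intro continuous_intros continuous_on_compose2[OF f(1)] continuous_on_compose2[OF K]) auto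
  qed
  moreover have "conv f K = (\<lambda>x. integral (cbox a b) (\<lambda>y. f y * K (x - y)))"
    by (rule ext, rule conv_eq_integral_cbox[OF f]) (use 0 in simp_all)
  ultimately show ?case by simp
next
  case (Suc k)
  have K1: "C_k 1 K" by (rule C_k_antimono[OF Suc.prems]) simp
  have "C_k k (\<lambda>x. frechet_derivative (conv f K) (at x) e)" if e: "e \<in> Basis" for e
  proof -
    have "(\<lambda>x. frechet_derivative (conv f K) (at x) e) = conv f (\<lambda>z. frechet_derivative K (at z) e)"
      by (rule ext, rule has_derivative_conv(3)[OF f K1 e])
    then show ?thesis by (simp only: Suc.IH[OF C_k_SucD(2)[OF Suc.prems e]])
  qed
  then show ?case using has_derivative_conv(2)[OF f K1] by simp
qed

lemma compact_support_cbox: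
  fixes S :: "'a::euclidean_space set"
  assumes "compact S"
  obtains R where "R > 0" "S \<subseteq> cball 0 R" "S \<subseteq> cbox (- R *\<^sub>R One) (R *\<^sub>R One)"
proof -
  obtain a where a: "a > 0" "S \<subseteq> cball 0 a"
    using compact_imp_bounded[OF assms] unfolding bounded_pos by force
  moreover have "cball 0 a \<subseteq> cbox (- a *\<^sub>R One) (a *\<^sub>R One :: 'a)"
  proof
    fix x :: 'a assume "x \<in> cball 0 a"
    then have "\<bar>x \<bullet> i\<bar> \<le> a" if "i \<in> Basis" for i using Basis_le_norm[OF that, of x] by simp
    then show "x \<in> cbox (- a *\<^sub>R One) (a *\<^sub>R One)" by (simp add: mem_box abs_le_iff minus_le_iff)
  qed
  ultimately show ?thesis using that[of a] by auto
qed

lemma integrable_lborel_compact_supp: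
  fixes f :: "'a::euclidean_space \<Rightarrow> real"
  assumes "continuous_on UNIV f" "compact (supp f)"
  shows "integrable lborel f"
proof -
  obtain R where R: "supp f \<subseteq> cbox (- R *\<^sub>R One) (R *\<^sub>R One)"
    using compact_support_cbox[OF assms(2)] by metis
  then show ?thesis
    by (intro integral_cbox_eq_lborel(1)[OF assms(1), of "- R *\<^sub>R One" "R *\<^sub>R One"] not_in_supp) auto
qed

text \<open>The integral of F(x - y) over y is independent of x by translation invariance. Its
  derivative in x is therefore 0, and by the Leibniz rule it is also the integral of the derivative
  of F.\<close>

lemma integral_partial_deriv_eq_0:
  fixes F :: "'a::euclidean_space \<Rightarrow> real"
  assumes F: "C_k 1 F" "compact (supp F)" and e: "e \<in> Basis"
  shows "(\<integral>x. frechet_derivative F (at x) e \<partial>lborel) = 0"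
proof -
  have contF: "continuous_on UNIV F" by (rule C_k_continuous[OF F(1)])
  have contF': "continuous_on UNIV (\<lambda>x. frechet_derivative F (at x) e)" using F(1) e by simp
  \<comment> \<open>A single box has to contain the support of y \<mapsto> F(x - y) for all x near
    0, because the Leibniz rule works over a fixed box.\<close>
  have "compact ((\<lambda>(x, z). x - z) ` (cball 0 1 \<times> supp F))"
    by (intro compact_continuous_image compact_Times F compact_cball) (auto simp: split_def intro!: continuous_intros)
  then obtain R where R: "(\<lambda>(x, z). x - z) ` (cball 0 1 \<times> supp F) \<subseteq> cbox (- R *\<^sub>R One) (R *\<^sub>R One)"
    using compact_support_cbox by metis
  let ?Q = "cbox (- R *\<^sub>R One) (R *\<^sub>R One) :: 'a set"
  have Q: "x - y \<notin> supp F" if "norm x \<le> 1" "y \<notin> ?Q" for x y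
  proof
    assume "x - y \<in> supp F"
    then have "x - (x - y) \<in> ?Q" using that(1) by (intro subsetD[OF R]) (auto intro!: image_eqI[of _ _ "(x, x - y)"])
    then show False using that(2) by simp
  qed
  have "integral ?Q (\<lambda>y. 1 * F (x - y)) = integral\<^sup>L lborel F" if "norm x \<le> 1" for x
  proof -
    have "integral ?Q (\<lambda>y. 1 * F (x - y)) = (\<integral>y. F (x - y) \<partial>lborel)"
    proof (simp, rule integral_cbox_eq_lborel(2))
      show "continuous_on UNIV (\<lambda>y. F (x - y))"
        by (auto intro!: continuous_on_compose2[OF contF] continuous_on_diff continuous_on_const continuous_on_id)
      show "F (x - y) = 0" if "y \<notin> cbox (- (R *\<^sub>R One)) (R *\<^sub>R One)" for y
        by (rule not_in_supp, rule Q) (use that \<open>norm x \<le> 1\<close> in auto)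
    qed
    also have "\<dots> = integral\<^sup>L lborel F"
      by (rule lborel_integral_reflect) (rule borel_measurable_continuous_onI[OF contF])
    finally show ?thesis .
  qed
  then have "((\<lambda>x. integral ?Q (\<lambda>y. 1 * F (x - y))) has_derivative (\<lambda>_. 0)) (at 0)"
    by (intro has_derivative_transform_within_open[OF has_derivative_const, of "ball 0 1"]) auto
  from has_derivative_unique[OF this has_derivative_integral_translate[OF F(1) continuous_on_const]]
  have "integral ?Q (\<lambda>y. frechet_derivative F (at (0 - y)) e) = 0"
    by (simp add: fun_eq_iff)
  moreover have "integral ?Q (\<lambda>y. frechet_derivative F (at (0 - y)) e) = (\<integral>y. frechet_derivative F (at (0 - y)) e \<partial>lborel)"
    by (rule integral_cbox_eq_lborel(2))
      (use Q[of 0] in \<open>auto intro!: continuous_on_compose2[OF contF'] continuous_on_minus continuous_on_id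
        simp: frechet_derivative_outside_supp\<close>)
  moreover have "\<dots> = (\<integral>x. frechet_derivative F (at x) e \<partial>lborel)"
    by (rule lborel_integral_reflect) (rule borel_measurable_continuous_onI[OF contF'])
  ultimately show ?thesis by simp
qed

lemma frechet_derivative_mult_real:
  assumes "f differentiable at x" "g differentiable at x"
  shows "frechet_derivative (\<lambda>x. f x * g x :: real) (at x) e
     = f x * frechet_derivative g (at x) e + frechet_derivative f (at x) e * g x"
  using frechet_derivative_eqI[OF has_derivative_mult[of f "frechet_derivative f (at x)" x UNIV g]] assms
  by (simp add: frechet_derivative_works)

text \<open>The product has compact support as soon as one factor does, so its partial derivative
  integrates to 0.\<close>

lemma integration_by_parts:
  fixes f g :: "'a::euclidean_space \<Rightarrow> real"
  assumes f: "C_k 1 f" and g: "C_k 1 g" "compact (supp g)" and e: "e \<in> Basis"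
  shows "(\<integral>x. frechet_derivative f (at x) e * g x \<partial>lborel) = - (\<integral>x. f x * frechet_derivative g (at x) e \<partial>lborel)"
proof -
  have fg: "C_k 1 (\<lambda>x. f x * g x)" by (rule C_k_mult[OF f g(1)])
  have s: "supp (\<lambda>x. f x * g x) \<subseteq> supp g" "supp (\<lambda>x. frechet_derivative f (at x) e * g x) \<subseteq> supp g"
    by (rule supp_subsetI; simp)+
  have "supp (\<lambda>x. f x * frechet_derivative g (at x) e) \<subseteq> closure (supp g)"
    unfolding supp_def[of "\<lambda>x. f x * _ x"]
    by (rule closure_mono) (auto intro: ccontr simp: frechet_derivative_outside_supp)
  then have s3: "supp (\<lambda>x. f x * frechet_derivative g (at x) e) \<subseteq> supp g"
    by (simp add: supp_def)
  have "(\<integral>x. f x * frechet_derivative g (at x) e + frechet_derivative f (at x) e * g x \<partial>lborel) = 0"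
    using integral_partial_deriv_eq_0[OF fg compact_supp_subset[OF g(2) s(1)] e] f g
    by (subst (asm) frechet_derivative_mult_real) auto
  moreover have "integrable lborel (\<lambda>x. f x * frechet_derivative g (at x) e)"
    by (rule integrable_lborel_compact_supp[OF _ compact_supp_subset[OF g(2) s3]])
      (use f g e C_k_continuous[OF f] in \<open>auto intro!: continuous_intros\<close>)
  moreover have "integrable lborel (\<lambda>x. frechet_derivative f (at x) e * g x)"
    by (rule integrable_lborel_compact_supp[OF _ compact_supp_subset[OF g(2) s(2)]])
      (use f g e C_k_continuous[OF g(1)] in \<open>auto intro!: continuous_intros\<close>)
  ultimately show ?thesis by (simp add: algebra_simps)
qed

subsection \<open>Mollification\<close>

definition moll :: "real \<Rightarrow> 'a::euclidean_space \<Rightarrow> real" where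
  "moll r x = bump r x / integral\<^sup>L lborel (bump r :: 'a \<Rightarrow> real)"

lemma compact_supp_bump:
  assumes "r > 0" shows "compact (supp (bump r :: 'a::euclidean_space \<Rightarrow> real))"
proof (rule compact_supp_subset)
  have "norm x \<le> r" if "bump r x \<noteq> 0" for x :: 'a
    using that bump_eq_0[OF assms, of x] by linarith
  then show "supp (bump r) \<subseteq> cball (0::'a) r"
    unfolding supp_def by (intro closure_minimal) auto
qed simp

text \<open>A nonnegative function with integral 0 vanishes almost everywhere, but the bump is
  positive on a ball of positive volume. This is what allows the normalization in
  \<open>moll\<close>.\<close>

lemma integral_bump_pos:
  assumes "r > 0" shows "integral\<^sup>L lborel (bump r :: 'a::euclidean_space \<Rightarrow> real) > 0"
proof -
  have int: "integrable lborel (bump r :: 'a \<Rightarrow> real)"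
    by (rule integrable_lborel_compact_supp[OF smooth_continuous[OF smooth_bump] compact_supp_bump[OF assms]])
  have "integral\<^sup>L lborel (bump r :: 'a \<Rightarrow> real) \<noteq> 0"
  proof
    assume "integral\<^sup>L lborel (bump r :: 'a \<Rightarrow> real) = 0"
    then have "AE x in lborel. bump r (x::'a) = 0"
      using integral_nonneg_eq_0_iff_AE[OF int] by (simp add: bump_nonneg)
    then have "AE x in lborel. (x::'a) \<notin> ball 0 r"
    proof eventually_elim
      case (elim x)
      then show ?case using bump_pos_iff[OF assms, of x] by auto
    qed
    then have "emeasure lborel (ball (0::'a) r) = 0"
      by (subst (asm) AE_iff_measurable[of "ball 0 r"]) auto
    then show False
      using content_ball_pos[OF assms, of "0::'a"] by (simp add: measure_def)
  qed
  moreover have "integral\<^sup>L lborel (bump r :: 'a \<Rightarrow> real) \<ge> 0" by (simp add: bump_nonneg)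
  ultimately show ?thesis by linarith
qed

lemma moll_nonneg: "r > 0 \<Longrightarrow> moll r x \<ge> 0" for x :: "'a::euclidean_space"
  using integral_bump_pos[where 'a='a, of r] bump_nonneg[of r x] by (simp add: moll_def)

lemma moll_eq_0: "r > 0 \<Longrightarrow> r \<le> norm x \<Longrightarrow> moll r x = 0"
  by (simp add: moll_def bump_eq_0)

lemma smooth_moll: "smooth (moll r)"
  using smooth_mult[OF smooth_bump smooth_const, of r "inverse (integral\<^sup>L lborel (bump r :: 'a \<Rightarrow> real))"]
  by (simp add: moll_def[abs_def] divide_inverse)

lemma integrable_moll: "r > 0 \<Longrightarrow> integrable lborel (moll r)"
  unfolding moll_def
  by (intro integrable_divide_zero integrable_lborel_compact_supp[OF smooth_continuous[OF smooth_bump] compact_supp_bump])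

lemma integral_moll: "r > 0 \<Longrightarrow> integral\<^sup>L lborel (moll r :: 'a::euclidean_space \<Rightarrow> real) = 1"
  unfolding moll_def using integral_bump_pos[where 'a='a, of r] by simp

text \<open>\<open>moll r\<close> is a probability density on the ball of radius r, so the
  convolution is a weighted mean of nearby values of \<open>g\<close>. With c = 0 this gives the
  uniform bound, with c = g x the convergence.\<close>

lemma conv_moll_approx:
  fixes g :: "'a::euclidean_space \<Rightarrow> real"
  assumes g: "continuous_on UNIV g" and r: "r > 0" and d: "\<And>y. norm y < r \<Longrightarrow> \<bar>g (x - y) - c\<bar> \<le> d"
  shows "\<bar>conv (moll r) g x - c\<bar> \<le> d"
proof -
  have eq: "moll r y * (g (x - y) - c) = moll r y * g (x - y) - moll r y * c" for y
    by (simp add: algebra_simps)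
  have int1: "integrable lborel (\<lambda>y. moll r y * g (x - y))"
  proof (rule integrable_lborel_compact_supp)
    show "continuous_on UNIV (\<lambda>y. moll r y * g (x - y))"
      by (intro continuous_intros smooth_continuous[OF smooth_moll] continuous_on_compose2[OF g]) auto
    show "compact (supp (\<lambda>y. moll r y * g (x - y)))"
      by (rule compact_supp_subset[OF compact_supp_bump[OF r]], rule supp_subsetI) (simp add: moll_def)
  qed
  have "conv (moll r) g x - c = (\<integral>y. moll r y * (g (x - y) - c) \<partial>lborel)"
    unfolding eq
    by (subst Bochner_Integration.integral_diff[OF int1 integrable_mult_left[OF integrable_moll[OF r]]])
      (simp add: conv_def integral_moll[OF r])
  also have "\<bar>\<dots>\<bar> \<le> (\<integral>y. \<bar>moll r y * (g (x - y) - c)\<bar> \<partial>lborel)"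
    by (rule integral_abs_bound)
  also have "\<dots> \<le> (\<integral>y. moll r (y::'a) * d \<partial>lborel)"
  proof (rule Bochner_Integration.integral_mono)
    show "\<bar>moll r y * (g (x - y) - c)\<bar> \<le> moll r y * d" for y
      using d[of y] moll_nonneg[OF r, of y] moll_eq_0[OF r, of y]
      by (cases "norm y < r") (auto simp: abs_mult intro: mult_left_mono)
  qed (auto simp: eq intro!: integrable_abs Bochner_Integration.integrable_diff integrable_mult_left int1
      integrable_moll[OF r])
  also have "\<dots> = d" using integral_moll[OF r, where 'a='a] by simp
  finally show ?thesis .
qed

lemma conv_moll_bound:
  fixes g :: "'a::euclidean_space \<Rightarrow> real"
  assumes "continuous_on UNIV g" "r > 0" "\<And>y. \<bar>g y\<bar> \<le> C"
  shows "\<bar>conv (moll r) g x\<bar> \<le> C"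
  using conv_moll_approx[OF assms(1,2), of x 0 C] assms(3) by simp

lemma conv_moll_tendsto:
  fixes g :: "'a::euclidean_space \<Rightarrow> real"
  assumes g: "continuous_on UNIV g" and r: "\<And>n. r n > 0" "r \<longlonglongrightarrow> 0"
  shows "(\<lambda>n. conv (moll (r n)) g x) \<longlonglongrightarrow> g x"
proof (rule LIMSEQ_I)
  fix e :: real assume "e > 0"
  then have "e / 2 > 0" by simp
  moreover have "isCont g x" using g by (simp add: continuous_on_eq_continuous_at)
  ultimately obtain d where d: "d > 0" "\<And>y. dist y x < d \<Longrightarrow> dist (g y) (g x) < e / 2"
    unfolding continuous_at_eps_delta by blast
  obtain N where "\<forall>n\<ge>N. norm (r n - 0) < d" using LIMSEQ_D[OF r(2) d(1)] by blast
  then have N: "r n < d" if "n \<ge> N" for n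
    using \<open>\<forall>n\<ge>N. norm (r n - 0) < d\<close>[rule_format, OF that] by simp
  show "\<exists>no. \<forall>n\<ge>no. norm (conv (moll (r n)) g x - g x) < e"
  proof (intro exI allI impI)
    fix n assume n: "n \<ge> N"
    have "\<bar>conv (moll (r n)) g x - g x\<bar> \<le> e / 2"
    proof (rule conv_moll_approx[OF g r(1)])
      fix y :: 'a assume "norm y < r n"
      then show "\<bar>g (x - y) - g x\<bar> \<le> e / 2"
        using d(2)[of "x - y"] N[OF n] by (simp add: dist_norm)
    qed
    then show "norm (conv (moll (r n)) g x - g x) < e" using \<open>e > 0\<close> by simp
  qed
qed

lemma continuous_compact_supp_bounded:
  fixes g :: "'a::euclidean_space \<Rightarrow> real"
  assumes "continuous_on UNIV g" "compact (supp g)"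
  obtains C where "C \<ge> 0" "\<And>x. \<bar>g x\<bar> \<le> C"
proof -
  have "bounded (g ` supp g)"
    by (intro compact_imp_bounded compact_continuous_image continuous_on_subset[OF assms(1)] assms(2)) simp
  then obtain B where "\<And>x. x \<in> supp g \<Longrightarrow> \<bar>g x\<bar> \<le> B" unfolding bounded_iff by auto
  then have "\<bar>g x\<bar> \<le> max B 0" for x
    using not_in_supp[of x g] by (cases "x \<in> supp g") (auto simp: le_max_iff_disj)
  then show ?thesis using that[of "max B 0"] by auto
qed

text \<open>The radii d / (n + 1) never exceed the distance d by which the support may be enlarged
  inside \<Omega>; hence one compact set carries all mollifications. The clauses on derivatives are
  conditional so that the same result also serves functions that are only continuous.\<close>

lemma mollify:
  fixes g :: "'a::euclidean_space \<Rightarrow> real"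
  assumes \<Omega>: "open \<Omega>" and g: "continuous_on UNIV g" "compact (supp g)" "supp g \<subseteq> \<Omega>"
  obtains \<psi> :: "nat \<Rightarrow> 'a \<Rightarrow> real" and K C where
    "\<And>n. \<psi> n \<in> C0_infty \<Omega>" "compact K" "K \<subseteq> \<Omega>" "\<And>n. supp (\<psi> n) \<subseteq> K"
    "\<And>n x. \<bar>\<psi> n x\<bar> \<le> C" "\<And>x. (\<lambda>n. \<psi> n x) \<longlonglongrightarrow> g x"
    "C_k 1 g \<Longrightarrow> \<forall>n x. \<forall>e\<in>Basis. \<bar>frechet_derivative (\<psi> n) (at x) e\<bar> \<le> C"
    "C_k 1 g \<Longrightarrow> \<forall>x. \<forall>e\<in>Basis.
      (\<lambda>n. frechet_derivative (\<psi> n) (at x) e) \<longlonglongrightarrow> frechet_derivative g (at x) e"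
proof -
  obtain d where d: "d > 0" "(\<Union>x\<in>supp g. cball x d) \<subseteq> \<Omega>"
    by (rule compact_subset_open_imp_cball_epsilon_subset[OF g(2) \<Omega> g(3)])
  define K where "K = (\<lambda>(x, y). x + y) ` (supp g \<times> cball 0 d)"
  have K: "compact K" unfolding K_def
    by (intro compact_continuous_image compact_Times g compact_cball)
      (auto simp: split_def intro!: continuous_intros)
  have KI: "x \<in> K" if "y \<in> supp g" "norm (x - y) \<le> d" for x y
    unfolding K_def using that by (intro image_eqI[of _ _ "(y, x - y)"]) auto
  have "K \<subseteq> (\<Union>x\<in>supp g. cball x d)"
    unfolding K_def by (force simp: dist_norm)
  then have K\<Omega>: "K \<subseteq> \<Omega>" using d(2) by blast
  define r where "r n = d / (real n + 1)" for n
  have r: "r n > 0" "r n \<le> d" for n using d(1) by (auto simp: r_def field_simps)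
  have r0: "r \<longlonglongrightarrow> 0" unfolding r_def[abs_def] using tendsto_mult_right_zero[OF LIMSEQ_inverse_real_of_nat, of d] by (simp add: divide_inverse add.commute)
  define \<psi> where "\<psi> n = conv (moll (r n)) g" for n
  \<comment> \<open>Both orders of the convolution are used: differentiating the mollifier gives
    smoothness, differentiating \<open>g\<close> gives bounds and limits of the derivatives.\<close>
  have \<psi>': "\<psi> n = conv g (moll (r n))" for n
    unfolding \<psi>_def by (rule conv_commute[OF smooth_continuous[OF smooth_moll] g(1)])
  have supp: "supp (\<psi> n) \<subseteq> K" for n
    unfolding supp_def
  proof (rule closure_minimal)
    show "closed K" using K by (rule compact_imp_closed)
    show "{x. \<psi> n x \<noteq> 0} \<subseteq> K"
    proof safe
      fix x assume "\<psi> n x \<noteq> 0"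
      have "\<exists>y. g y * moll (r n) (x - y) \<noteq> 0"
      proof (rule ccontr)
        assume "\<not> ?thesis"
        then have "(\<lambda>y. g y * moll (r n) (x - y)) = (\<lambda>_. 0)" by auto
        then show False using \<open>\<psi> n x \<noteq> 0\<close> unfolding \<psi>' conv_def by simp
      qed
      then obtain y where y: "g y \<noteq> 0" "moll (r n) (x - y) \<noteq> 0" by auto
      have "y \<in> supp g" using y(1) not_in_supp[of y g] by blast
      moreover have "norm (x - y) \<le> d" using y(2) moll_eq_0[OF r(1), of n "x - y"] r(2)[of n] by linarith
      ultimately show "x \<in> K" by (rule KI)
    qed
  qed
  obtain R where R: "supp g \<subseteq> cbox (- R *\<^sub>R One) (R *\<^sub>R One)" using compact_support_cbox[OF g(2)] by metis
  have sm: "smooth (\<psi> n)" for n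
    unfolding smooth_def \<psi>'
    by (intro allI C_k_conv[OF g(1), of "- R *\<^sub>R One" "R *\<^sub>R One"] smooth_C_k[OF smooth_moll])
      (auto intro!: not_in_supp[of _ g] dest: subsetD[OF R])
  have 1: "\<psi> n \<in> C0_infty \<Omega>" for n
    using sm supp[of n] compact_supp_subset[OF K supp[of n]] K\<Omega> by (auto simp: C0_infty_def)
  obtain C0 where C0: "\<And>x. \<bar>g x\<bar> \<le> C0" "C0 \<ge> 0" using continuous_compact_supp_bounded[OF g(1,2)] by metis
  \<comment> \<open>Here the mollifier is the factor that vanishes off a box, and the derivative
    falls on \<open>g\<close>. The derivative of the mollification is thus a mollified
    derivative.\<close>
  have D: "frechet_derivative (\<psi> n) (at x) e = conv (moll (r n)) (\<lambda>z. frechet_derivative g (at z) e) x"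
    if "C_k 1 g" "e \<in> Basis" for n x e
  proof -
    have "supp (moll (r n) :: 'a \<Rightarrow> real) \<subseteq> supp (bump (r n))"
      by (rule supp_subsetI) (simp add: moll_def)
    then obtain R where R: "supp (moll (r n) :: 'a \<Rightarrow> real) \<subseteq> cbox (- R *\<^sub>R One) (R *\<^sub>R One)"
      using compact_support_cbox[OF compact_supp_subset[OF compact_supp_bump[OF r(1)]]] by metis
    show ?thesis unfolding \<psi>_def
      by (rule has_derivative_conv(3)[OF smooth_continuous[OF smooth_moll] _ that, of "- R *\<^sub>R One" "R *\<^sub>R One"])
        (auto intro!: not_in_supp[of _ "moll (r n)"] dest: subsetD[OF R])
  qed
  have contD: "continuous_on UNIV (\<lambda>z. frechet_derivative g (at z) e)" if "C_k 1 g" "e \<in> Basis" for e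
    using that by simp
  have suppD: "compact (supp (\<lambda>z. frechet_derivative g (at z) e))" for e
  proof (rule compact_supp_subset[OF g(2)])
    have "supp (\<lambda>z. frechet_derivative g (at z) e) \<subseteq> closure (supp g)"
      unfolding supp_def[of "\<lambda>z. frechet_derivative g (at z) e"]
      by (rule closure_mono) (auto intro: ccontr simp: frechet_derivative_outside_supp)
    then show "supp (\<lambda>z. frechet_derivative g (at z) e) \<subseteq> supp g" by (simp add: supp_def)
  qed
  have "\<exists>C. \<forall>z. \<bar>frechet_derivative g (at z) e\<bar> \<le> C" if "C_k 1 g" "e \<in> Basis" for e
    by (rule continuous_compact_supp_bounded[OF contD[OF that] suppD]) blast
  then obtain C1 where C1: "\<And>z e. C_k 1 g \<Longrightarrow> e \<in> Basis \<Longrightarrow> \<bar>frechet_derivative g (at z) e\<bar> \<le> C1 e"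
    by metis
  define C where "C = C0 + (\<Sum>e\<in>(Basis::'a set). \<bar>C1 e\<bar>)"
  have C: "C0 \<le> C" "e \<in> Basis \<Longrightarrow> C1 e \<le> C" for e
  proof -
    show "C0 \<le> C" unfolding C_def by (simp add: sum_nonneg)
    assume "e \<in> Basis"
    then have "\<bar>C1 e\<bar> \<le> (\<Sum>e\<in>(Basis::'a set). \<bar>C1 e\<bar>)" by (intro member_le_sum) auto
    then show "C1 e \<le> C" using C0(2) by (simp add: C_def)
  qed
  show ?thesis
  proof (rule that[OF 1 K K\<Omega> supp])
    show "\<bar>\<psi> n x\<bar> \<le> C" for n x
      unfolding \<psi>_def by (rule conv_moll_bound[OF g(1) r(1)]) (rule order_trans[OF C0(1) C(1)])
    show "(\<lambda>n. \<psi> n x) \<longlonglongrightarrow> g x" for x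
      unfolding \<psi>_def by (rule conv_moll_tendsto[OF g(1) r(1) r0])
    assume gC: "C_k 1 g"
    show "\<forall>n x. \<forall>e\<in>Basis. \<bar>frechet_derivative (\<psi> n) (at x) e\<bar> \<le> C"
    proof (intro allI ballI)
      fix n x and e :: 'a assume e: "e \<in> Basis"
      show "\<bar>frechet_derivative (\<psi> n) (at x) e\<bar> \<le> C"
        unfolding D[OF gC e] by (rule conv_moll_bound[OF contD[OF gC e] r(1)]) (rule order_trans[OF C1[OF gC e] C(2)[OF e]])
    qed
    show "\<forall>x. \<forall>e\<in>Basis. (\<lambda>n. frechet_derivative (\<psi> n) (at x) e) \<longlonglongrightarrow> frechet_derivative g (at x) e"
    proof (intro allI ballI)
      fix x and e :: 'a assume e: "e \<in> Basis"
      show "(\<lambda>n. frechet_derivative (\<psi> n) (at x) e) \<longlonglongrightarrow> frechet_derivative g (at x) e"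
        unfolding D[OF gC e] by (rule conv_moll_tendsto[OF contD[OF gC e] r(1) r0])
    qed
  qed
qed

subsection \<open>The fundamental lemma of the calculus of variations\<close>

lemma AE_lebesgue_on_iff:
  "open \<Omega> \<Longrightarrow> (AE x in lebesgue_on \<Omega>. P x) \<longleftrightarrow> (AE x in lebesgue. x \<in> \<Omega> \<longrightarrow> P x)"
  by (rule AE_restrict_space_iff) simp

text \<open>Rests on the completeness of Lebesgue measure; extension by zero reduces the claim to
  the whole space.\<close>

lemma measurable_lebesgue_on_AE:
  fixes f g :: "'a::euclidean_space \<Rightarrow> 'b::euclidean_space"
  assumes "open \<Omega>" "f \<in> borel_measurable (lebesgue_on \<Omega>)" "AE x in lebesgue_on \<Omega>. f x = g x"
  shows "g \<in> borel_measurable (lebesgue_on \<Omega>)"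
proof (rule borel_measurable_if_D)
  show "(\<lambda>x. if x \<in> \<Omega> then g x else 0) \<in> borel_measurable lebesgue"
  proof (rule borel_measurable_AE)
    show "(\<lambda>x. if x \<in> \<Omega> then f x else 0) \<in> borel_measurable lebesgue"
      using assms(1,2) by (intro borel_measurable_if_I) auto
    show "AE x in lebesgue. (if x \<in> \<Omega> then f x else 0) = (if x \<in> \<Omega> then g x else 0)"
      using assms(3) unfolding AE_lebesgue_on_iff[OF assms(1)] by eventually_elim simp
  qed
qed

lemma measurable_lebesgue_on_continuous:
  fixes f :: "'a::euclidean_space \<Rightarrow> 'b::euclidean_space"
  shows "open \<Omega> \<Longrightarrow> continuous_on \<Omega> f \<Longrightarrow> f \<in> borel_measurable (lebesgue_on \<Omega>)"
  by (rule continuous_imp_measurable_on_sets_lebesgue) auto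

lemma measurable_lebesgue_on_UNIV_continuous:
  fixes f :: "'a::euclidean_space \<Rightarrow> real"
  shows "open \<Omega> \<Longrightarrow> continuous_on UNIV f \<Longrightarrow> f \<in> borel_measurable (lebesgue_on \<Omega>)"
  by (rule measurable_lebesgue_on_continuous) (auto intro: continuous_on_subset)

lemma indicator_compact_measurable:
  fixes K :: "'a::euclidean_space set"
  assumes "open \<Omega>" "compact K"
  shows "(indicator K :: _ \<Rightarrow> real) \<in> borel_measurable (lebesgue_on \<Omega>)"
proof -
  have "K \<in> sets lebesgue" using compact_imp_closed[OF assms(2)] by simp
  then have "\<Omega> \<inter> K \<in> sets (lebesgue_on \<Omega>)" using assms(1) by (auto simp: sets_restrict_space)
  then show ?thesis by (subst borel_measurable_indicator_iff) (simp add: Int_commute)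
qed

lemma integrable_indicator_compact:
  fixes K :: "'a::euclidean_space set"
  assumes "open \<Omega>" "compact K"
  shows "integrable (lebesgue_on \<Omega>) (indicator K :: _ \<Rightarrow> real)"
proof -
  have "\<Omega> \<inter> K \<in> lmeasurable"
    using lmeasurable_compact[OF assms(2)] assms(1) fmeasurable_Int_fmeasurable[of K lebesgue \<Omega>]
    by (simp add: Int_commute)
  then have "integrable lebesgue (indicator (\<Omega> \<inter> K) :: 'a \<Rightarrow> real)"
    by (simp add: lmeasurable_iff_integrable)
  then show ?thesis
    using assms(1) by (subst integrable_restrict_space) (simp_all add: indicator_inter_arith[abs_def])
qed

lemma integral_lebesgue_on_eq_lborel:
  fixes f :: "'a::euclidean_space \<Rightarrow> real"
  assumes "open \<Omega>" "f \<in> borel_measurable borel" "\<And>x. x \<notin> \<Omega> \<Longrightarrow> f x = 0"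
  shows "integral\<^sup>L (lebesgue_on \<Omega>) f = integral\<^sup>L lborel f"
proof -
  have "integral\<^sup>L (lebesgue_on \<Omega>) f = integral\<^sup>L lebesgue (\<lambda>x. indicator \<Omega> x *\<^sub>R f x)"
    using assms(1) by (intro integral_restrict_space) simp
  also have "(\<lambda>x. indicator \<Omega> x *\<^sub>R f x) = f" using assms(3) by (auto simp: indicator_def fun_eq_iff)
  also have "integral\<^sup>L lebesgue f = integral\<^sup>L lborel f"
    using assms(2) by (intro integral_completion) simp
  finally show ?thesis .
qed

context
  fixes \<Omega> :: "'a::euclidean_space set" and h :: "'a \<Rightarrow> real"
  assumes \<Omega>: "open \<Omega>" and h: "h \<in> borel_measurable (lebesgue_on \<Omega>)"
    and loc: "\<And>K. compact K \<Longrightarrow> K \<subseteq> \<Omega> \<Longrightarrow> integrable (lebesgue_on \<Omega>) (\<lambda>x. indicator K x * h x)"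
    and zero: "\<And>\<psi>. \<psi> \<in> C0_infty \<Omega> \<Longrightarrow> (\<integral>x. h x * \<psi> x \<partial>lebesgue_on \<Omega>) = 0"
begin

text \<open>The mollifications of \<open>g\<close> live on one compact set, on which
  \<open>h\<close> is integrable; this supplies the majorant for dominated convergence.\<close>

lemma zero_continuous:
  assumes g: "continuous_on UNIV g" "compact (supp g)" "supp g \<subseteq> \<Omega>"
  shows "(\<integral>x. h x * g x \<partial>lebesgue_on \<Omega>) = 0"
proof -
  obtain \<psi> K C where \<psi>: "\<And>n. \<psi> n \<in> C0_infty \<Omega>" "compact K" "K \<subseteq> \<Omega>" "\<And>n. supp (\<psi> n) \<subseteq> K"
    "\<And>n x. \<bar>\<psi> n x\<bar> \<le> C" "\<And>x. (\<lambda>n. \<psi> n x) \<longlonglongrightarrow> g x"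
    using mollify[OF \<Omega> g] by metis
  have [measurable]: "\<psi> n \<in> borel_measurable (lebesgue_on \<Omega>)" "g \<in> borel_measurable (lebesgue_on \<Omega>)" for n
    by (intro measurable_lebesgue_on_UNIV_continuous \<Omega> g smooth_continuous C0_infty_smooth[OF \<psi>(1)])+
  note h[measurable]
  have "(\<lambda>n. \<integral>x. h x * \<psi> n x \<partial>lebesgue_on \<Omega>) \<longlonglongrightarrow> (\<integral>x. h x * g x \<partial>lebesgue_on \<Omega>)"
  proof (rule integral_dominated_convergence[where w="\<lambda>x. C * \<bar>indicator K x * h x\<bar>"])
    show "integrable (lebesgue_on \<Omega>) (\<lambda>x. C * \<bar>indicator K x * h x\<bar>)"
      by (intro integrable_mult_right integrable_abs loc \<psi>)
    show "AE x in lebesgue_on \<Omega>. (\<lambda>n. h x * \<psi> n x) \<longlonglongrightarrow> h x * g x"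
      by (intro AE_I2 tendsto_mult tendsto_const \<psi>)
    show "AE x in lebesgue_on \<Omega>. norm (h x * \<psi> n x) \<le> C * \<bar>indicator K x * h x\<bar>" for n
    proof (rule AE_I2)
      fix x
      show "norm (h x * \<psi> n x) \<le> C * \<bar>indicator K x * h x\<bar>"
      proof (cases "x \<in> K")
        case True
        then show ?thesis using mult_left_mono[OF \<psi>(5)[of n x], of "\<bar>h x\<bar>"] by (simp add: abs_mult mult.commute)
      next
        case False
        then have "\<psi> n x = 0" using \<psi>(4)[of n] not_in_supp[of x "\<psi> n"] by blast
        then show ?thesis using False by simp
      qed
    qed
  qed measurable
  moreover have "(\<lambda>n. \<integral>x. h x * \<psi> n x \<partial>lebesgue_on \<Omega>) = (\<lambda>_. 0)" using zero[OF \<psi>(1)] by simp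
  ultimately show ?thesis by (simp add: LIMSEQ_const_iff)
qed

text \<open>The indicator of a compact set is the decreasing limit of tent functions of the distance
  to it, with slopes (n + 1) / d. All tents are supported in the compact neighbourhood
  \<open>L\<close> of radius d, which lies in \<Omega>.\<close>

lemma zero_compact:
  assumes K: "compact K" "K \<subseteq> \<Omega>"
  shows "(\<integral>x. indicator K x * h x \<partial>lebesgue_on \<Omega>) = 0"
proof (cases "K = {}")
  \<comment> \<open>\<open>infdist\<close> to the empty set is 0 by convention, so the tents would
    be constant 1 there; the empty set is treated apart.\<close>
  case False
  obtain d where d: "d > 0" "(\<Union>x\<in>K. cball x d) \<subseteq> \<Omega>"
    by (rule compact_subset_open_imp_cball_epsilon_subset[OF K(1) \<Omega> K(2)])
  define g where "g n x = max 0 (1 - (real n + 1) / d * infdist x K)" for n x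
  define L where "L = {x. infdist x K \<le> d}"
  have cont: "continuous_on UNIV (g n)" for n
    unfolding g_def by (intro continuous_intros)
  have L: "compact L" "L \<subseteq> \<Omega>"
  proof -
    show "compact L" unfolding L_def by (rule compact_infdist_le[OF False K(1) d(1)])
    show "L \<subseteq> \<Omega>"
    proof
      fix x assume "x \<in> L"
      moreover obtain y where "y \<in> K" "infdist x K = dist x y"
        using infdist_attains_inf[OF compact_imp_closed[OF K(1)] False, of x] by metis
      ultimately have "x \<in> cball y d" by (simp add: L_def dist_commute)
      then show "x \<in> \<Omega>" using d(2) \<open>y \<in> K\<close> by blast
    qed
  qed
  have gL: "x \<in> L" if "g n x \<noteq> 0" for n x
  proof -
    have "(real n + 1) / d * infdist x K < 1"
    proof (rule ccontr)
      assume "\<not> ?thesis"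
      then have "1 - (real n + 1) / d * infdist x K \<le> 0" by linarith
      then show False using that unfolding g_def by (simp only: max_absorb1)
    qed
    then have "(real n + 1) * infdist x K < d" using d(1) by (simp add: field_simps)
    moreover have "infdist x K \<le> (real n + 1) * infdist x K"
      using infdist_nonneg[of x K] by (simp add: algebra_simps)
    ultimately show ?thesis by (simp add: L_def)
  qed
  have s: "supp (g n) \<subseteq> L" for n
    unfolding supp_def by (rule closure_minimal) (use gL compact_imp_closed[OF L(1)] in auto)
  have g01: "0 \<le> g n x" "g n x \<le> 1" for n x
    using d(1) infdist_nonneg[of x K] by (auto simp: g_def)
  have lim: "(\<lambda>n. g n x) \<longlonglongrightarrow> indicator K x" for x
  proof (cases "x \<in> K")
    case True
    then show ?thesis by (simp add: g_def)
  next
    case False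
    then have pos: "infdist x K > 0"
      using in_closed_iff_infdist_zero[OF compact_imp_closed[OF K(1)] \<open>K \<noteq> {}\<close>, of x] infdist_nonneg[of x K] by linarith
    obtain N where N: "d / infdist x K < real N" using reals_Archimedean2 by blast
    have "g n x = 0" if "n \<ge> N" for n
    proof -
      have "d / infdist x K < real n + 1" using that N by linarith
      then have "1 \<le> (real n + 1) / d * infdist x K" using d(1) pos by (simp add: field_simps)
      then show ?thesis by (simp add: g_def)
    qed
    then have "\<forall>\<^sub>F n in sequentially. g n x = indicator K x"
      using False unfolding eventually_sequentially by auto
    then show ?thesis by (rule tendsto_eventually)
  qed
  have [measurable]: "g n \<in> borel_measurable (lebesgue_on \<Omega>)"
    "(indicator K :: 'a \<Rightarrow> real) \<in> borel_measurable (lebesgue_on \<Omega>)" for n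
    by (intro measurable_lebesgue_on_UNIV_continuous \<Omega> cont indicator_compact_measurable K)+
  note h[measurable]
  have "(\<lambda>n. \<integral>x. h x * g n x \<partial>lebesgue_on \<Omega>) \<longlonglongrightarrow> (\<integral>x. indicator K x * h x \<partial>lebesgue_on \<Omega>)"
  proof (rule integral_dominated_convergence[where w="\<lambda>x. \<bar>indicator L x * h x\<bar>"])
    show "integrable (lebesgue_on \<Omega>) (\<lambda>x. \<bar>indicator L x * h x\<bar>)"
      by (intro integrable_abs loc L)
    show "AE x in lebesgue_on \<Omega>. (\<lambda>n. h x * g n x) \<longlonglongrightarrow> indicator K x * h x"
      by (rule AE_I2) (use tendsto_mult[OF tendsto_const lim] in \<open>simp add: mult.commute\<close>)
    show "AE x in lebesgue_on \<Omega>. norm (h x * g n x) \<le> \<bar>indicator L x * h x\<bar>" for n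
    proof (rule AE_I2)
      fix x
      show "norm (h x * g n x) \<le> \<bar>indicator L x * h x\<bar>"
      proof (cases "x \<in> L")
        case True
        then show ?thesis using mult_left_mono[OF g01(2)[of n x], of "\<bar>h x\<bar>"] g01(1)[of n x] by (simp add: abs_mult)
      next
        case False
        then have "g n x = 0" using gL by blast
        then show ?thesis by simp
      qed
    qed
  qed measurable
  moreover have "(\<lambda>n. \<integral>x. h x * g n x \<partial>lebesgue_on \<Omega>) = (\<lambda>_. 0)"
    using zero_continuous[OF cont compact_supp_subset[OF L(1) s] order_trans[OF s L(2)]] by simp
  ultimately show ?thesis by (simp add: LIMSEQ_const_iff)
qed simp

text \<open>By inner regularity {h > 0} is, up to a null set, a countable union of closed sets, and
  of compact ones after intersecting with balls. On each of these a positive function has integral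
  0, so each is a null set.\<close>

lemma nonpos_AE: "AE x in lebesgue_on \<Omega>. h x \<le> 0"
proof -
  define S where "S = {x \<in> \<Omega>. h x > 0}"
  have "{x \<in> space (lebesgue_on \<Omega>). h x > 0} \<in> sets (lebesgue_on \<Omega>)" using h by measurable
  then have S: "S \<in> sets lebesgue" using \<Omega> by (simp add: S_def sets_restrict_space_iff)
  have "\<exists>T. closed T \<and> T \<subseteq> S \<and> emeasure lebesgue (S - T) < ennreal (1 / (real n + 1))" for n
    by (rule sets_lebesgue_inner_closed[OF S, of "1 / (real n + 1)"]) auto
  then obtain T where T: "\<And>n. closed (T n)" "\<And>n. T n \<subseteq> S"
    "\<And>n. emeasure lebesgue (S - T n) < ennreal (1 / (real n + 1))" by metis
  have null: "AE x in lebesgue_on \<Omega>. x \<notin> T n \<inter> cball 0 (real m)" for n m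
  proof -
    let ?K = "T n \<inter> cball 0 (real m)"
    have K: "compact ?K" "?K \<subseteq> \<Omega>"
      using T(1,2)[of n] by (auto simp: S_def intro: closed_Int_compact)
    have pos: "h x > 0" if "x \<in> ?K" for x using that T(2)[of n] by (auto simp: S_def)
    have "AE x in lebesgue_on \<Omega>. indicator ?K x * h x = 0"
      using integral_nonneg_eq_0_iff_AE[OF loc[OF K]] zero_compact[OF K] pos
      by (auto simp: indicator_def less_imp_le)
    then show ?thesis
    proof eventually_elim
      case (elim x)
      show ?case
      proof
        assume "x \<in> ?K"
        then show False using elim pos[of x] by simp
      qed
    qed
  qed
  have 1: "AE x in lebesgue_on \<Omega>. \<forall>n m. x \<notin> T n \<inter> cball 0 (real m)"
    by (intro AE_all_countable[THEN iffD2] allI null)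
  have "AE x in lebesgue. x \<notin> S - (\<Union>n. T n)"
  proof -
    have Sm: "S - (\<Union>n. T n) \<in> sets lebesgue" using S T(1) by auto
    have "emeasure lebesgue (S - (\<Union>n. T n)) \<le> ennreal (1 / (real n + 1))" for n
    proof -
      have "emeasure lebesgue (S - (\<Union>n. T n)) \<le> emeasure lebesgue (S - T n)"
        using S T(1)[of n] by (intro emeasure_mono) auto
      then show ?thesis using T(3)[of n] by simp
    qed
    moreover have "(\<lambda>n. ennreal (1 / (real n + 1))) \<longlonglongrightarrow> ennreal 0"
      using LIMSEQ_inverse_real_of_nat by (intro tendsto_ennrealI) (simp add: inverse_eq_divide add.commute)
    ultimately have "emeasure lebesgue (S - (\<Union>n. T n)) \<le> ennreal 0"
      by (intro LIMSEQ_le_const) auto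
    then have "S - (\<Union>n. T n) \<in> null_sets lebesgue" using Sm by (simp add: null_sets_def)
    then show ?thesis by (rule AE_not_in)
  qed
  then have 2: "AE x in lebesgue_on \<Omega>. x \<notin> S - (\<Union>n. T n)"
    unfolding AE_lebesgue_on_iff[OF \<Omega>] by eventually_elim simp
  have "AE x in lebesgue_on \<Omega>. x \<in> \<Omega>" by (rule AE_I2) simp
  with 1 2 show ?thesis
  proof eventually_elim
    case (elim x)
    show ?case
    proof (rule ccontr)
      assume "\<not> h x \<le> 0"
      then have "x \<in> S" using elim by (simp add: S_def)
      then obtain n where "x \<in> T n" using elim by auto
      moreover obtain m where "norm x \<le> real m" using real_arch_simple by blast
      ultimately have "x \<in> T n \<inter> cball 0 (real m)" by simp
      then show False using elim(1) by blast
    qed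
  qed
qed

end

lemma fundamental_lemma_variations:
  fixes \<Omega> :: "'a::euclidean_space set" and h :: "'a \<Rightarrow> real"
  assumes \<Omega>: "open \<Omega>" and h: "h \<in> borel_measurable (lebesgue_on \<Omega>)"
    and loc: "\<And>K. compact K \<Longrightarrow> K \<subseteq> \<Omega> \<Longrightarrow> integrable (lebesgue_on \<Omega>) (\<lambda>x. indicator K x * h x)"
    and zero: "\<And>\<psi>. \<psi> \<in> C0_infty \<Omega> \<Longrightarrow> (\<integral>x. h x * \<psi> x \<partial>lebesgue_on \<Omega>) = 0"
  shows "AE x in lebesgue_on \<Omega>. h x = 0"
proof -
  have "AE x in lebesgue_on \<Omega>. h x \<le> 0" by (rule nonpos_AE[OF assms])
  moreover have "AE x in lebesgue_on \<Omega>. - h x \<le> 0"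
  proof (rule nonpos_AE[OF \<Omega>])
    show "(\<lambda>x. - h x) \<in> borel_measurable (lebesgue_on \<Omega>)" using h by simp
    show "integrable (lebesgue_on \<Omega>) (\<lambda>x. indicator K x * - h x)" if "compact K" "K \<subseteq> \<Omega>" for K
      using loc[OF that] by simp
    show "(\<integral>x. - h x * \<psi> x \<partial>lebesgue_on \<Omega>) = 0" if "\<psi> \<in> C0_infty \<Omega>" for \<psi>
      using zero[OF that] by simp
  qed
  ultimately show ?thesis by eventually_elim simp
qed

section \<open>Power estimates with constants uniform in the exponent\<close>

lemma powr_abs_add_le:
  fixes a b q Q :: real
  assumes "0 \<le> q" "q \<le> Q"
  shows "\<bar>a + b\<bar> powr q \<le> 2 powr Q * (\<bar>a\<bar> powr q + \<bar>b\<bar> powr q)"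
proof -
  have "\<bar>a + b\<bar> powr q \<le> (2 * max \<bar>a\<bar> \<bar>b\<bar>) powr q"
    by (rule powr_mono2) (use assms in auto)
  also have "\<dots> = 2 powr q * max \<bar>a\<bar> \<bar>b\<bar> powr q" by (simp add: powr_mult)
  also have "\<dots> \<le> 2 powr Q * (\<bar>a\<bar> powr q + \<bar>b\<bar> powr q)"
    by (rule mult_mono) (use assms in \<open>auto simp: max_def\<close>)
  finally show ?thesis .
qed

lemma powr_abs_diff_le:
  fixes a b q Q :: real
  assumes "0 \<le> q" "q \<le> Q"
  shows "\<bar>a - b\<bar> powr q \<le> 2 powr Q * (\<bar>a\<bar> powr q + \<bar>b\<bar> powr q)"
  using powr_abs_add_le[OF assms, of a "-b"] by simp

text \<open>As L is at least 1, its powers increase with the exponent, and the bound Q gives one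
  constant for all points of a variable exponent.\<close>

lemma powr_abs_le:
  fixes a b L q Q :: real
  assumes "0 \<le> q" "q \<le> Q" "\<bar>b\<bar> \<le> L * \<bar>a\<bar>" "1 \<le> L"
  shows "\<bar>b\<bar> powr q \<le> L powr Q * \<bar>a\<bar> powr q"
proof -
  have "\<bar>b\<bar> powr q \<le> (L * \<bar>a\<bar>) powr q" by (rule powr_mono2) (use assms in auto)
  also have "\<dots> = L powr q * \<bar>a\<bar> powr q" using assms by (simp add: powr_mult)
  also have "\<dots> \<le> L powr Q * \<bar>a\<bar> powr q" by (rule mult_right_mono) (use assms powr_mono in auto)
  finally show ?thesis .
qed

lemma tendsto_powr_abs_0D:
  fixes f :: "nat \<Rightarrow> real"
  assumes "(\<lambda>n. \<bar>f n\<bar> powr q) \<longlonglongrightarrow> 0" "q > 0"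
  shows "f \<longlonglongrightarrow> 0"
proof -
  have "(\<lambda>n. (\<bar>f n\<bar> powr q) powr (1 / q)) \<longlonglongrightarrow> 0 powr (1 / q)"
    by (rule tendsto_powr'[OF assms(1) tendsto_const]) (use assms(2) in auto)
  then have "(\<lambda>n. \<bar>f n\<bar>) \<longlonglongrightarrow> 0" using assms(2) by (simp add: powr_powr)
  then show ?thesis by (simp add: tendsto_rabs_zero_iff)
qed

lemma tendsto_powr_abs_0:
  fixes f :: "nat \<Rightarrow> real"
  assumes "f \<longlonglongrightarrow> 0" "q > 0"
  shows "(\<lambda>n. \<bar>f n\<bar> powr q) \<longlonglongrightarrow> 0"
  using tendsto_powr'[OF tendsto_rabs_zero[OF assms(1)] tendsto_const, of q] assms(2) by auto

lemma integrable_powr_compact_supp: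
  fixes f :: "'a::euclidean_space \<Rightarrow> real"
  assumes \<Omega>: "open \<Omega>" and q: "q \<in> borel_measurable (lebesgue_on \<Omega>)" "\<And>x. x \<in> \<Omega> \<Longrightarrow> 0 < q x \<and> q x \<le> Q"
    and f: "continuous_on UNIV f" "compact (supp f)"
  shows "integrable (lebesgue_on \<Omega>) (\<lambda>x. \<bar>f x\<bar> powr q x)"
proof -
  obtain C where C: "C \<ge> 0" "\<And>x. \<bar>f x\<bar> \<le> C" using continuous_compact_supp_bounded[OF f] by metis
  have [measurable]: "f \<in> borel_measurable (lebesgue_on \<Omega>)" by (rule measurable_lebesgue_on_UNIV_continuous[OF \<Omega> f(1)])
  note q(1)[measurable]
  show ?thesis
  proof (rule Bochner_Integration.integrable_bound[OF integrable_mult_right[OF integrable_indicator_compact[OF \<Omega> f(2)]]])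
    show "AE x in lebesgue_on \<Omega>. norm (\<bar>f x\<bar> powr q x) \<le> norm ((max 1 C powr Q) * indicator (supp f) x)"
    proof (rule AE_I2)
      fix x assume "x \<in> space (lebesgue_on \<Omega>)"
      then have qx: "0 < q x" "q x \<le> Q" using q(2) by auto
      show "norm (\<bar>f x\<bar> powr q x) \<le> norm ((max 1 C powr Q) * indicator (supp f) x)"
      proof (cases "x \<in> supp f")
        case True
        have "\<bar>f x\<bar> powr q x \<le> max 1 C powr Q * \<bar>1::real\<bar> powr q x"
          by (rule powr_abs_le) (use qx C(2)[of x] in auto)
        then show ?thesis using True by simp
      next
        case False
        then show ?thesis using not_in_supp[of x f] by simp
      qed
    qed
  qed measurable
qed

subsection \<open>Luxemburg norm and modular\<close>

text \<open>\<open>Inf\<close> of an empty set of reals has no useful value, so a competitor must be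
  exhibited. With k = max 1 I and exponents at least 1 one has k powr q \<ge> k, and the modular of
  v / k is at most I / k \<le> 1.\<close>

lemma lux_norm_set_nonempty:
  fixes q :: "'a::euclidean_space \<Rightarrow> real"
  assumes q: "\<And>x. x \<in> \<Omega> \<Longrightarrow> 1 \<le> q x"
    and v: "integrable (lebesgue_on \<Omega>) (\<lambda>x. \<bar>v x\<bar> powr q x)"
  shows "{k. k > 0 \<and> (\<integral>\<^sup>+ x. ennreal (\<bar>v x / k\<bar> powr q x) \<partial>lebesgue_on \<Omega>) \<le> 1} \<noteq> {}"
proof -
  define I where "I = (\<integral>x. \<bar>v x\<bar> powr q x \<partial>lebesgue_on \<Omega>)"
  define k where "k = max 1 I"
  have k: "k \<ge> 1" "I \<le> k" by (auto simp: k_def)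
  have "(\<integral>\<^sup>+ x. ennreal (\<bar>v x / k\<bar> powr q x) \<partial>lebesgue_on \<Omega>)
      \<le> (\<integral>\<^sup>+ x. ennreal (\<bar>v x\<bar> powr q x / k) \<partial>lebesgue_on \<Omega>)"
  proof (intro nn_integral_mono ennreal_leI)
    fix x assume "x \<in> space (lebesgue_on \<Omega>)"
    then have "k powr 1 \<le> k powr q x" using q k by (intro powr_mono) auto
    then have "\<bar>v x\<bar> powr q x / k powr q x \<le> \<bar>v x\<bar> powr q x / k"
      using k by (intro divide_left_mono) auto
    then show "\<bar>v x / k\<bar> powr q x \<le> \<bar>v x\<bar> powr q x / k"
      using k by (simp add: abs_div powr_divide)
  qed
  also have "\<dots> = ennreal (I / k)"
    using v k unfolding I_def by (subst nn_integral_eq_integral) auto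
  also have "\<dots> \<le> 1" using k by (simp add: ennreal_le_1)
  finally show ?thesis using k by (auto intro!: exI[of _ k])
qed

lemma lux_norm_nonneg:
  fixes q :: "'a::euclidean_space \<Rightarrow> real"
  assumes "\<And>x. x \<in> \<Omega> \<Longrightarrow> 1 \<le> q x" "integrable (lebesgue_on \<Omega>) (\<lambda>x. \<bar>v x\<bar> powr q x)"
  shows "0 \<le> lux_norm \<Omega> q v"
  unfolding lux_norm_def by (rule cInf_greatest[OF lux_norm_set_nonempty[OF assms]]) auto

text \<open>For k \<le> 1 and q \<ge> 1 one has k powr q \<le> k, hence the modular of v is at most
  k times that of v / k. Small norm thus forces small modular.\<close>

lemma modular_le_lux_norm:
  fixes q :: "'a::euclidean_space \<Rightarrow> real"
  assumes q: "\<And>x. x \<in> \<Omega> \<Longrightarrow> 1 \<le> q x" and v: "integrable (lebesgue_on \<Omega>) (\<lambda>x. \<bar>v x\<bar> powr q x)"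
    and meas: "v \<in> borel_measurable (lebesgue_on \<Omega>)" "q \<in> borel_measurable (lebesgue_on \<Omega>)"
    and \<epsilon>: "lux_norm \<Omega> q v < \<epsilon>" "\<epsilon> \<le> 1"
  shows "(\<integral>x. \<bar>v x\<bar> powr q x \<partial>lebesgue_on \<Omega>) \<le> \<epsilon>"
proof -
  note meas[measurable]
  obtain k where k: "k > 0" "(\<integral>\<^sup>+ x. ennreal (\<bar>v x / k\<bar> powr q x) \<partial>lebesgue_on \<Omega>) \<le> 1" "k < \<epsilon>"
    using cInf_lessD[OF lux_norm_set_nonempty[OF q v] \<epsilon>(1)[unfolded lux_norm_def]] by auto
  have "ennreal (\<integral>x. \<bar>v x\<bar> powr q x \<partial>lebesgue_on \<Omega>) = (\<integral>\<^sup>+ x. ennreal (\<bar>v x\<bar> powr q x) \<partial>lebesgue_on \<Omega>)"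
    using v by (subst nn_integral_eq_integral) auto
  also have "\<dots> \<le> (\<integral>\<^sup>+ x. ennreal k * ennreal (\<bar>v x / k\<bar> powr q x) \<partial>lebesgue_on \<Omega>)"
  proof (intro nn_integral_mono)
    fix x assume "x \<in> space (lebesgue_on \<Omega>)"
    then have "1 \<le> q x" using q by simp
    then have "k powr q x \<le> k powr 1" using k(1,3) \<epsilon>(2) by (intro powr_mono') auto
    then have "\<bar>v x\<bar> powr q x \<le> k * \<bar>v x / k\<bar> powr q x"
      using k(1) mult_right_mono[of "k powr q x" k "\<bar>v x\<bar> powr q x"]
      by (simp add: abs_div powr_divide divide_simps mult.commute)
    then show "ennreal (\<bar>v x\<bar> powr q x) \<le> ennreal k * ennreal (\<bar>v x / k\<bar> powr q x)"
      using k(1) by (simp add: ennreal_mult'[symmetric] ennreal_leI)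
  qed
  also have "\<dots> = ennreal k * (\<integral>\<^sup>+ x. ennreal (\<bar>v x / k\<bar> powr q x) \<partial>lebesgue_on \<Omega>)"
    by (rule nn_integral_cmult) measurable
  also have "\<dots> \<le> ennreal k * 1" by (intro mult_left_mono k(2)) simp
  finally show ?thesis using k(1,3) by (simp add: ennreal_le_iff)
qed

text \<open>The converse direction: for \<epsilon> \<le> 1 the smallest power \<epsilon> powr q that
  can occur is at least \<epsilon> powr Q. Together the two estimates show that convergence in norm
  and in modular coincide.\<close>

lemma lux_norm_le_modular:
  fixes q :: "'a::euclidean_space \<Rightarrow> real"
  assumes q: "\<And>x. x \<in> \<Omega> \<Longrightarrow> 1 \<le> q x \<and> q x \<le> Q" and v: "integrable (lebesgue_on \<Omega>) (\<lambda>x. \<bar>v x\<bar> powr q x)"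
    and \<epsilon>: "0 < \<epsilon>" "\<epsilon> \<le> 1" "(\<integral>x. \<bar>v x\<bar> powr q x \<partial>lebesgue_on \<Omega>) \<le> \<epsilon> powr Q"
  shows "lux_norm \<Omega> q v \<le> \<epsilon>"
  unfolding lux_norm_def
proof (rule cInf_lower)
  have "(\<integral>\<^sup>+ x. ennreal (\<bar>v x / \<epsilon>\<bar> powr q x) \<partial>lebesgue_on \<Omega>)
      \<le> (\<integral>\<^sup>+ x. ennreal (\<bar>v x\<bar> powr q x / \<epsilon> powr Q) \<partial>lebesgue_on \<Omega>)"
  proof (intro nn_integral_mono ennreal_leI)
    fix x assume "x \<in> space (lebesgue_on \<Omega>)"
    then have "\<epsilon> powr Q \<le> \<epsilon> powr q x" using q \<epsilon> by (intro powr_mono') auto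
    then have "\<bar>v x\<bar> powr q x / \<epsilon> powr q x \<le> \<bar>v x\<bar> powr q x / \<epsilon> powr Q"
      using \<epsilon>(1) by (intro divide_left_mono) auto
    then show "\<bar>v x / \<epsilon>\<bar> powr q x \<le> \<bar>v x\<bar> powr q x / \<epsilon> powr Q"
      using \<epsilon>(1) by (simp add: abs_div powr_divide)
  qed
  also have "\<dots> = ennreal ((\<integral>x. \<bar>v x\<bar> powr q x \<partial>lebesgue_on \<Omega>) / \<epsilon> powr Q)"
    using v \<epsilon> by (subst nn_integral_eq_integral) auto
  also have "\<dots> \<le> 1" using \<epsilon> by (simp add: ennreal_le_1)
  finally show "\<epsilon> \<in> {k. k > 0 \<and> (\<integral>\<^sup>+ x. ennreal (\<bar>v x / k\<bar> powr q x) \<partial>lebesgue_on \<Omega>) \<le> 1}"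
    using \<epsilon>(1) by simp
qed (auto intro!: bdd_belowI[of _ 0])

subsection \<open>Dominated approximation by test functions\<close>

locale exponents =
  fixes \<Omega> :: "(real^'n) set" and p0 :: "real^'n \<Rightarrow> real" and p :: "'n \<Rightarrow> real^'n \<Rightarrow> real"
  assumes \<Omega>: "open \<Omega>" "\<Omega> \<noteq> {}" and p0: "p0 \<in> C_plus \<Omega>" and p: "\<And>i. p i \<in> C_plus \<Omega>"
begin

text \<open>A function and its gradient are handled together: \<open>None\<close> is the index of the function,
  \<open>Some i\<close> that of the \<open>i\<close>-th component of the gradient.\<close>

definition ex :: "'n option \<Rightarrow> real^'n \<Rightarrow> real" where
  "ex c = (case c of None \<Rightarrow> p0 | Some i \<Rightarrow> p i)"

definition jet :: "(real^'n \<Rightarrow> real) \<Rightarrow> (real^'n \<Rightarrow> real^'n) \<Rightarrow> 'n option \<Rightarrow> real^'n \<Rightarrow> real" where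
  "jet v g c x = (case c of None \<Rightarrow> v x | Some i \<Rightarrow> g x $ i)"

lemma ex_simps [simp]: "ex None = p0" "ex (Some i) = p i"
  and jet_simps [simp]: "jet v g None = v" "jet v g (Some i) = (\<lambda>x. g x $ i)"
  by (auto simp: ex_def jet_def fun_eq_iff)

definition pmax :: real where "pmax = Max (range (\<lambda>c. SUP x\<in>\<Omega>. ex c x))"

lemma ex_C_plus: "ex c \<in> C_plus \<Omega>"
  using p0 p by (cases c) auto

lemma ex_bounds: "x \<in> \<Omega> \<Longrightarrow> 1 < ex c x" "x \<in> \<Omega> \<Longrightarrow> ex c x \<le> pmax"
proof -
  assume x: "x \<in> \<Omega>"
  have "bdd_below (ex c ` \<Omega>)" "bdd_above (ex c ` \<Omega>)" "1 < (INF x\<in>\<Omega>. ex c x)"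
    using ex_C_plus[of c] by (auto simp: C_plus_def)
  then have "(INF x\<in>\<Omega>. ex c x) \<le> ex c x" "ex c x \<le> (SUP x\<in>\<Omega>. ex c x)"
    using x by (auto intro: cINF_lower cSUP_upper)
  moreover have "(SUP x\<in>\<Omega>. ex c x) \<le> pmax" unfolding pmax_def by (intro Max_ge) auto
  ultimately show "1 < ex c x" "ex c x \<le> pmax" using \<open>1 < (INF x\<in>\<Omega>. ex c x)\<close> by auto
qed

lemma ex_measurable [measurable]: "ex c \<in> borel_measurable (lebesgue_on \<Omega>)"
proof (rule measurable_lebesgue_on_continuous[OF \<Omega>(1)])
  show "continuous_on \<Omega> (ex c)"
    using ex_C_plus[of c] closure_subset[of \<Omega>] unfolding C_plus_def by (auto intro: continuous_on_subset)
qed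

abbreviation tjet :: "(real^'n \<Rightarrow> real) \<Rightarrow> 'n option \<Rightarrow> real^'n \<Rightarrow> real" where
  "tjet \<phi> \<equiv> jet \<phi> (grad \<phi>)"

lemma tjet_continuous:
  assumes "C_k 1 \<phi>" shows "continuous_on UNIV (tjet \<phi> c)"
proof (cases c)
  case None
  then show ?thesis using C_k_continuous[OF assms] by simp
next
  case (Some i)
  have "axis i (1::real) \<in> Basis" by simp
  then show ?thesis using assms Some by (simp add: grad_def)
qed

lemma tjet_outside_supp: "x \<notin> supp \<phi> \<Longrightarrow> tjet \<phi> c x = 0"
  by (cases c) (auto simp: not_in_supp grad_def frechet_derivative_outside_supp)

lemma supp_tjet: "supp (tjet \<phi> c) \<subseteq> supp \<phi>"
proof -
  have "supp (tjet \<phi> c) \<subseteq> closure (supp \<phi>)"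
    unfolding supp_def[of "tjet \<phi> c"]
    by (rule closure_mono) (auto intro: ccontr simp: tjet_outside_supp)
  then show ?thesis by (simp add: supp_def)
qed

lemma tjet_measurable: "C_k 1 \<phi> \<Longrightarrow> tjet \<phi> c \<in> borel_measurable (lebesgue_on \<Omega>)"
  by (rule measurable_lebesgue_on_UNIV_continuous[OF \<Omega>(1) tjet_continuous])

lemma C0_infty_C1: "\<phi> \<in> C0_infty \<Omega> \<Longrightarrow> C_k 1 \<phi>"
  by (rule smooth_C_k[OF C0_infty_smooth])

lemma tjet_integrable: "\<phi> \<in> C0_infty \<Omega> \<Longrightarrow> integrable (lebesgue_on \<Omega>) (\<lambda>x. \<bar>tjet \<phi> c x\<bar> powr ex c x)"
proof -
  assume \<phi>: "\<phi> \<in> C0_infty \<Omega>"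
  have "compact (supp (tjet \<phi> c))"
    by (rule compact_supp_subset[OF _ supp_tjet]) (use \<phi> in \<open>simp add: C0_infty_def\<close>)
  moreover have "0 < ex c x \<and> ex c x \<le> pmax" if "x \<in> \<Omega>" for x using ex_bounds[OF that, of c] by linarith
  ultimately show ?thesis
    by (intro integrable_powr_compact_supp[OF \<Omega>(1) ex_measurable] tjet_continuous C0_infty_C1 \<phi>) auto
qed

lemma W0_pairs_iff_jet:
  "(v, g) \<in> W0_pairs \<Omega> p0 p \<longleftrightarrow> (\<forall>c. jet v g c \<in> Lp_var \<Omega> (ex c)) \<and>
    (\<exists>\<phi>. (\<forall>j. \<phi> j \<in> C0_infty \<Omega>) \<and>
      (\<lambda>j. \<Sum>c\<in>UNIV. lux_norm \<Omega> (ex c) (\<lambda>x. tjet (\<phi> j) c x - jet v g c x)) \<longlonglongrightarrow> 0)"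
proof -
  have "(\<Sum>c\<in>UNIV. F c) = F None + (\<Sum>i\<in>UNIV. F (Some i))" for F :: "'n option \<Rightarrow> real"
    by (simp add: UNIV_option_conv sum.reindex)
  then show ?thesis
    unfolding W0_pairs_def by (auto simp: split_option_all)
qed

text \<open>Norm convergence is traded for almost everywhere convergence with an integrable bound of the
  modulars: then all limits can be taken by dominated convergence.\<close>

abbreviation (input) dominated ::
  "(nat \<Rightarrow> real^'n \<Rightarrow> real) \<Rightarrow> (real^'n \<Rightarrow> real) \<Rightarrow> (real^'n \<Rightarrow> real^'n) \<Rightarrow> (real^'n \<Rightarrow> real) \<Rightarrow> real^'n \<Rightarrow> bool" where
  "dominated \<phi> v g E x \<equiv> \<forall>c. (\<lambda>j. tjet (\<phi> j) c x) \<longlonglongrightarrow> jet v g c x \<and>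
     (\<forall>j. \<bar>tjet (\<phi> j) c x\<bar> powr ex c x \<le> E x)"

definition dom_approx :: "(nat \<Rightarrow> real^'n \<Rightarrow> real) \<Rightarrow> (real^'n \<Rightarrow> real) \<Rightarrow> (real^'n \<Rightarrow> real^'n) \<Rightarrow> bool" where
  "dom_approx \<phi> v g \<longleftrightarrow> (\<forall>j. \<phi> j \<in> C0_infty \<Omega>) \<and>
     (\<exists>E. integrable (lebesgue_on \<Omega>) E \<and>
       (AE x in lebesgue_on \<Omega>. dominated \<phi> v g E x))"

text \<open>The argument of Riesz and Fischer, carried out with modulars: along a subsequence with
  modular errors at most 2^(-n) the errors are summable almost everywhere, and their sum is
  integrable. Summability gives pointwise convergence, the sum gives the majorant.\<close>

lemma W0_pairs_imp_dom_approx: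
  assumes "(v, g) \<in> W0_pairs \<Omega> p0 p"
  shows "\<exists>\<phi>. dom_approx \<phi> v g"
proof -
  let ?M = "lebesgue_on \<Omega>"
  obtain \<phi> where L: "\<And>c. jet v g c \<in> Lp_var \<Omega> (ex c)" and \<phi>: "\<And>j. \<phi> j \<in> C0_infty \<Omega>" and
    lim: "(\<lambda>j. \<Sum>c\<in>UNIV. lux_norm \<Omega> (ex c) (\<lambda>x. tjet (\<phi> j) c x - jet v g c x)) \<longlonglongrightarrow> 0"
    using assms unfolding W0_pairs_iff_jet by blast
  define D where "D j c x = \<bar>tjet (\<phi> j) c x - jet v g c x\<bar> powr ex c x" for j c x
  have jm [measurable]: "jet v g c \<in> borel_measurable ?M"
    and ji: "integrable ?M (\<lambda>x. \<bar>jet v g c x\<bar> powr ex c x)" for c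
    using L[of c] by (auto simp: Lp_var_def)
  have tm [measurable]: "tjet (\<phi> j) c \<in> borel_measurable ?M" for j c
    by (rule tjet_measurable[OF C0_infty_C1[OF \<phi>]])
  have Dm: "D j c \<in> borel_measurable ?M" for j c unfolding D_def by measurable
  have Dint: "integrable ?M (D j c)" for j c
  proof (rule Bochner_Integration.integrable_bound[OF integrable_mult_right[OF Bochner_Integration.integrable_add[OF tjet_integrable[OF \<phi>, of j c] ji[of c]]] Dm])
    show "AE x in ?M. norm (D j c x) \<le> norm (2 powr pmax * (\<bar>tjet (\<phi> j) c x\<bar> powr ex c x + \<bar>jet v g c x\<bar> powr ex c x))"
    proof (rule AE_I2)
      fix x assume "x \<in> space ?M"
      then have "0 \<le> ex c x" "ex c x \<le> pmax" using ex_bounds[of x c] by auto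
      from powr_abs_diff_le[OF this, of "tjet (\<phi> j) c x" "jet v g c x"]
      show "norm (D j c x) \<le> norm (2 powr pmax * (\<bar>tjet (\<phi> j) c x\<bar> powr ex c x + \<bar>jet v g c x\<bar> powr ex c x))"
        by (simp add: D_def)
    qed
  qed
  have ex1: "1 \<le> ex c x" if "x \<in> \<Omega>" for c x using ex_bounds[OF that, of c] by simp
  define l where "l j c = lux_norm \<Omega> (ex c) (\<lambda>x. tjet (\<phi> j) c x - jet v g c x)" for j c
  have l0: "0 \<le> l j c" for j c
    unfolding l_def using ex1 Dint[of j c] by (intro lux_norm_nonneg) (auto simp: D_def[abs_def])
  \<comment> \<open>The error is summed over all components, so that a single subsequence serves the
    function and every partial derivative.\<close>
  define R where "R j x = (\<Sum>c\<in>UNIV. D j c x)" for j x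
  have R0: "0 \<le> R j x" "D j c x \<le> R j x" for j c x
    unfolding R_def by (auto intro!: sum_nonneg member_le_sum simp: D_def)
  have D0: "\<bar>D j c x\<bar> = D j c x" for j c x by (simp add: D_def)
  have Rint: "integrable ?M (R j)" for j unfolding R_def by (intro Bochner_Integration.integrable_sum Dint)
  have small: "\<exists>N. \<forall>j\<ge>N. integral\<^sup>L ?M (R j) \<le> e" if "e > 0" for e :: real
  proof -
    define m where "m = real (card (UNIV :: 'n option set))"
    have m: "m > 0" using finite_UNIV_card_ge_0[where 'a="'n option"] by (simp add: m_def)
    \<comment> \<open>The cap 1 is required for passing from norm to modular; the division by m
      distributes the error e over the m components.\<close>
    define \<epsilon> where "\<epsilon> = min 1 (e / m)"
    have \<epsilon>: "\<epsilon> > 0" "\<epsilon> \<le> 1" using that m by (auto simp: \<epsilon>_def)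
    have "m * \<epsilon> \<le> m * (e / m)" using m by (intro mult_left_mono) (auto simp: \<epsilon>_def)
    then have \<epsilon>m: "real (card (UNIV :: 'n option set)) * \<epsilon> \<le> e" using m by (simp add: m_def)
    obtain N where N: "\<And>j. j \<ge> N \<Longrightarrow> norm ((\<Sum>c\<in>UNIV. l j c) - 0) < \<epsilon>"
      using LIMSEQ_D[OF lim \<epsilon>(1)] unfolding l_def by blast
    have "integral\<^sup>L ?M (R j) \<le> e" if j: "j \<ge> N" for j
    proof -
      have "integral\<^sup>L ?M (D j c) \<le> \<epsilon>" for c
        unfolding D_def
      proof (rule modular_le_lux_norm[OF ex1])
        have "l j c \<le> (\<Sum>c\<in>UNIV. l j c)" by (rule member_le_sum) (auto simp: l0)
        also have "\<dots> < \<epsilon>" using N[OF j] by simp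
        finally show "lux_norm \<Omega> (ex c) (\<lambda>x. tjet (\<phi> j) c x - jet v g c x) < \<epsilon>" by (simp add: l_def)
      qed (use Dint[of j c] \<epsilon>(2) in \<open>simp_all add: D_def[abs_def]\<close>)
      then have "(\<Sum>c\<in>UNIV. integral\<^sup>L ?M (D j c)) \<le> (\<Sum>c\<in>(UNIV :: 'n option set). \<epsilon>)"
        by (intro sum_mono)
      moreover have "integral\<^sup>L ?M (R j) = (\<Sum>c\<in>UNIV. integral\<^sup>L ?M (D j c))"
        unfolding R_def by (rule Bochner_Integration.integral_sum) (rule Dint)
      ultimately have "integral\<^sup>L ?M (R j) \<le> (\<Sum>c\<in>(UNIV :: 'n option set). \<epsilon>)" by simp
      then show ?thesis using \<epsilon>m by simp
    qed
    then show ?thesis by blast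
  qed
  have "\<exists>r. strict_mono r \<and> (\<forall>n::nat. integral\<^sup>L ?M (R (r n)) \<le> (1/2) ^ n)"
  proof -
    have "\<exists>j. j > m \<and> integral\<^sup>L ?M (R j) \<le> (1/2) ^ n" for m n :: nat
    proof -
      obtain N where "\<forall>j\<ge>N. integral\<^sup>L ?M (R j) \<le> (1/2) ^ n" using small[of "(1/2)^n"] by auto
      then show ?thesis by (intro exI[of _ "max N (Suc m)"]) auto
    qed
    then obtain J where J: "\<And>m n. J m n > m" "\<And>m n. integral\<^sup>L ?M (R (J m n)) \<le> (1/2) ^ n" by metis
    define r where "r = rec_nat (J 0 0) (\<lambda>n s. J s (Suc n))"
    have rS: "r (Suc n) = J (r n) (Suc n)" and r0: "r 0 = J 0 0" for n by (auto simp: r_def)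
    have "r n < r (Suc n)" for n unfolding rS by (rule J(1))
    moreover have "integral\<^sup>L ?M (R (r n)) \<le> (1/2) ^ n" for n
      by (cases n) (simp_all only: rS r0 J(2))
    ultimately show ?thesis by (auto simp: strict_mono_Suc_iff)
  qed
  then obtain r where r: "\<And>n::nat. integral\<^sup>L ?M (R (r n)) \<le> (1/2) ^ n" by blast
  have sumR: "AE x in ?M. summable (\<lambda>n. R (r n) x)" and Eint: "integrable ?M (\<lambda>x. \<Sum>n. R (r n) x)"
  proof -
    have s: "summable (\<lambda>n. integral\<^sup>L ?M (R (r n)))"
      by (rule summable_comparison_test'[of "\<lambda>n. (1/2::real) ^ n" 0]) (use r R0 in \<open>auto intro!: integral_nonneg\<close>)
    have "(\<integral>\<^sup>+ x. (\<Sum>n. ennreal (R (r n) x)) \<partial>?M) = (\<Sum>n. \<integral>\<^sup>+ x. ennreal (R (r n) x) \<partial>?M)"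
      using Rint by (intro nn_integral_suminf) auto
    also have "\<dots> = (\<Sum>n. ennreal (integral\<^sup>L ?M (R (r n))))"
      using Rint R0 by (subst nn_integral_eq_integral) auto
    also have "\<dots> = ennreal (\<Sum>n. integral\<^sup>L ?M (R (r n)))"
      using s R0 by (intro suminf_ennreal2) (auto intro!: integral_nonneg)
    also have "\<dots> < \<infinity>" by simp
    finally have "AE x in ?M. (\<Sum>n. ennreal (R (r n) x)) \<noteq> \<infinity>"
      using Rint by (intro nn_integral_noteq_infinite) auto
    then show *: "AE x in ?M. summable (\<lambda>n. R (r n) x)"
      by eventually_elim (rule summable_suminf_not_top, auto simp: R0)
    show "integrable ?M (\<lambda>x. \<Sum>n. R (r n) x)"
      by (rule integrable_suminf) (use * s R0 Rint in auto)
  qed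
  \<comment> \<open>Each approximant is the limit plus an error, and the power of a sum costs the
    factor 2 powr \<open>pmax\<close>.\<close>
  define E where "E x = 2 powr pmax * ((\<Sum>n. R (r n) x) + (\<Sum>c\<in>UNIV. \<bar>jet v g c x\<bar> powr ex c x))" for x
  have "dom_approx (\<lambda>n. \<phi> (r n)) v g"
    unfolding dom_approx_def
  proof (intro conjI allI \<phi> exI[of _ E])
    show "integrable ?M E" unfolding E_def
      by (intro integrable_mult_right Bochner_Integration.integrable_add Eint Bochner_Integration.integrable_sum ji)
    have "AE x in ?M. x \<in> \<Omega>" by (rule AE_I2) simp
    with sumR show "AE x in ?M. \<forall>c. (\<lambda>n. tjet (\<phi> (r n)) c x) \<longlonglongrightarrow> jet v g c x \<and>
          (\<forall>n. \<bar>tjet (\<phi> (r n)) c x\<bar> powr ex c x \<le> E x)"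
    proof eventually_elim
      case (elim x)
      show ?case
      proof (intro allI conjI)
        fix c
        have q: "0 < ex c x" "ex c x \<le> pmax" using ex_bounds[OF elim(2), of c] by auto
        have "(\<lambda>n. R (r n) x) \<longlonglongrightarrow> 0" by (rule summable_LIMSEQ_zero[OF elim(1)])
        then have "(\<lambda>n. D (r n) c x) \<longlonglongrightarrow> 0"
          by (rule Lim_null_comparison[rotated]) (intro always_eventually allI, simp add: R0 D0)
        then have "(\<lambda>n. tjet (\<phi> (r n)) c x - jet v g c x) \<longlonglongrightarrow> 0"
          unfolding D_def by (rule tendsto_powr_abs_0D) (rule q)
        then show "(\<lambda>n. tjet (\<phi> (r n)) c x) \<longlonglongrightarrow> jet v g c x" by (simp add: LIM_zero_iff)
        fix n
        have "R (r n) x \<le> (\<Sum>n. R (r n) x)"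
          using sum_le_suminf[OF elim(1), of "{n}"] R0 by auto
        moreover have "\<bar>jet v g c x\<bar> powr ex c x \<le> (\<Sum>c\<in>UNIV. \<bar>jet v g c x\<bar> powr ex c x)"
          by (rule member_le_sum) auto
        moreover have "\<bar>tjet (\<phi> (r n)) c x\<bar> powr ex c x
            \<le> 2 powr pmax * (D (r n) c x + \<bar>jet v g c x\<bar> powr ex c x)"
          using powr_abs_add_le[of "ex c x" pmax "tjet (\<phi> (r n)) c x - jet v g c x" "jet v g c x"] q
          by (simp add: D_def)
        moreover have "D (r n) c x \<le> R (r n) x" by (rule R0)
        ultimately have "D (r n) c x + \<bar>jet v g c x\<bar> powr ex c x
            \<le> (\<Sum>n. R (r n) x) + (\<Sum>c\<in>UNIV. \<bar>jet v g c x\<bar> powr ex c x)" by linarith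
        then have "2 powr pmax * (D (r n) c x + \<bar>jet v g c x\<bar> powr ex c x) \<le> E x"
          unfolding E_def by (intro mult_left_mono) auto
        then show "\<bar>tjet (\<phi> (r n)) c x\<bar> powr ex c x \<le> E x"
          using \<open>\<bar>tjet (\<phi> (r n)) c x\<bar> powr ex c x \<le> 2 powr pmax * _\<close> by linarith
      qed
    qed
  qed
  then show ?thesis by (rule exI[of _ "\<lambda>n. \<phi> (r n)"])
qed

text \<open>Dominated convergence makes the modulars of the errors tend to 0, hence also the norms.
  With the previous result, membership in the completion means being a dominated limit of test
  functions, and closure properties can be checked pointwise.\<close>

lemma dom_approx_imp_W0_pairs:
  assumes "dom_approx \<phi> v g"
  shows "(v, g) \<in> W0_pairs \<Omega> p0 p"
proof -
  let ?M = "lebesgue_on \<Omega>"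
  obtain E where \<phi>: "\<And>j. \<phi> j \<in> C0_infty \<Omega>" and E: "integrable ?M E"
    and AE: "AE x in ?M. dominated \<phi> v g E x"
    using assms unfolding dom_approx_def by blast
  have tm [measurable]: "tjet (\<phi> j) c \<in> borel_measurable ?M" for j c
    by (rule tjet_measurable[OF C0_infty_C1[OF \<phi>]])
  have jm [measurable]: "jet v g c \<in> borel_measurable ?M" for c
  proof (rule measurable_lebesgue_on_AE[OF \<Omega>(1)])
    \<comment> \<open>Measurability of the limit is not part of \<open>dom_approx\<close>; it comes
      from the approximants and survives a change on a null set.\<close>
    show "(\<lambda>x. lim (\<lambda>j. tjet (\<phi> j) c x)) \<in> borel_measurable ?M" by measurable
    show "AE x in ?M. lim (\<lambda>j. tjet (\<phi> j) c x) = jet v g c x"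
      using AE by eventually_elim (auto intro: limI)
  qed
  have x\<Omega>: "AE x in ?M. x \<in> \<Omega>" by (rule AE_I2) simp
  have bound: "AE x in ?M. \<bar>jet v g c x\<bar> powr ex c x \<le> E x" for c
    using AE x\<Omega>
  proof eventually_elim
    case (elim x)
    have "(\<lambda>j. \<bar>tjet (\<phi> j) c x\<bar> powr ex c x) \<longlonglongrightarrow> \<bar>jet v g c x\<bar> powr ex c x"
      by (rule tendsto_powr'[OF tendsto_rabs tendsto_const]) (use elim ex_bounds[of x c] in auto)
    then show ?case by (rule LIMSEQ_le_const2) (use elim in auto)
  qed
  have ji: "integrable ?M (\<lambda>x. \<bar>jet v g c x\<bar> powr ex c x)" for c
    by (rule Bochner_Integration.integrable_bound[OF E]) (use bound[of c] in \<open>auto elim: eventually_mono\<close>)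
  define D where "D j c x = \<bar>tjet (\<phi> j) c x - jet v g c x\<bar> powr ex c x" for j c x
  have Dm [measurable]: "D j c \<in> borel_measurable ?M" for j c unfolding D_def by measurable
  have Dbound: "AE x in ?M. norm (D j c x) \<le> 2 powr pmax * (E x + E x)" for j c
    using AE x\<Omega> bound[of c]
  proof eventually_elim
    case (elim x)
    have "D j c x \<le> 2 powr pmax * (\<bar>tjet (\<phi> j) c x\<bar> powr ex c x + \<bar>jet v g c x\<bar> powr ex c x)"
      unfolding D_def by (rule powr_abs_diff_le) (use ex_bounds[OF elim(2), of c] in auto)
    also have "\<dots> \<le> 2 powr pmax * (E x + E x)" using elim by (intro mult_left_mono add_mono) auto
    finally show ?case by (simp add: D_def)
  qed
  have Eint: "integrable ?M (\<lambda>x. 2 powr pmax * (E x + E x))"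
    by (intro integrable_mult_right Bochner_Integration.integrable_add E)
  have Dlim0: "AE x in ?M. (\<lambda>j. D j c x) \<longlonglongrightarrow> 0" for c
    using AE x\<Omega>
  proof eventually_elim
    case (elim x)
    have "(\<lambda>j. tjet (\<phi> j) c x - jet v g c x) \<longlonglongrightarrow> 0" using elim(1) by (simp add: LIM_zero)
    then show ?case unfolding D_def by (rule tendsto_powr_abs_0) (use ex_bounds[OF elim(2), of c] in simp)
  qed
  have Dint: "integrable ?M (D j c)" for j c
    by (rule Bochner_Integration.integrable_bound[OF Eint Dm]) (use Dbound[of j c] in \<open>auto elim: eventually_mono\<close>)
  have "(\<lambda>j. integral\<^sup>L ?M (D j c)) \<longlonglongrightarrow> integral\<^sup>L ?M (\<lambda>_. 0)" for c
    by (rule integral_dominated_convergence[OF _ Dm Eint Dlim0 Dbound]) simp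
  then have lim: "(\<lambda>j. integral\<^sup>L ?M (D j c)) \<longlonglongrightarrow> 0" for c by simp
  have ex1: "1 \<le> ex c x" "1 \<le> ex c x \<and> ex c x \<le> pmax" if "x \<in> \<Omega>" for c x
    using ex_bounds[OF that, of c] by simp_all
  have "(\<lambda>j. lux_norm \<Omega> (ex c) (\<lambda>x. tjet (\<phi> j) c x - jet v g c x)) \<longlonglongrightarrow> 0" for c
  proof (rule LIMSEQ_I)
    fix e :: real assume "e > 0"
    \<comment> \<open>The half turns the weak inequality for the norm into a strict one; the cap 1
      is a hypothesis of \<open>lux_norm_le_modular\<close>.\<close>
    define \<epsilon> where "\<epsilon> = min 1 (e / 2)"
    have \<epsilon>: "0 < \<epsilon>" "\<epsilon> \<le> 1" "\<epsilon> < e" using \<open>e > 0\<close> by (auto simp: \<epsilon>_def)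
    then have "\<epsilon> powr pmax > 0" by simp
    from LIMSEQ_D[OF lim this] obtain N where N: "\<And>j. j \<ge> N \<Longrightarrow> norm (integral\<^sup>L ?M (D j c) - 0) < \<epsilon> powr pmax"
      by blast
    show "\<exists>N. \<forall>j\<ge>N. norm (lux_norm \<Omega> (ex c) (\<lambda>x. tjet (\<phi> j) c x - jet v g c x) - 0) < e"
    proof (intro exI allI impI)
      fix j assume j: "N \<le> j"
      have "lux_norm \<Omega> (ex c) (\<lambda>x. tjet (\<phi> j) c x - jet v g c x) \<le> \<epsilon>"
        by (rule lux_norm_le_modular[OF ex1(2) _ \<epsilon>(1,2)])
          (use Dint[of j c] N[OF j] in \<open>auto simp: D_def[abs_def]\<close>)
      moreover have "0 \<le> lux_norm \<Omega> (ex c) (\<lambda>x. tjet (\<phi> j) c x - jet v g c x)"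
        by (rule lux_norm_nonneg[OF ex1(1)]) (use Dint[of j c] in \<open>auto simp: D_def[abs_def]\<close>)
      ultimately show "norm (lux_norm \<Omega> (ex c) (\<lambda>x. tjet (\<phi> j) c x - jet v g c x) - 0) < e"
        using \<epsilon>(3) by simp
    qed
  qed
  then have "(\<lambda>j. \<Sum>c\<in>UNIV. lux_norm \<Omega> (ex c) (\<lambda>x. tjet (\<phi> j) c x - jet v g c x)) \<longlonglongrightarrow> 0"
    by (intro tendsto_null_sum) auto
  then show ?thesis unfolding W0_pairs_iff_jet using \<phi> jm ji by (auto simp: Lp_var_def)
qed

end

lemma le_1_plus_powr:
  fixes t q :: real assumes "1 \<le> q" shows "\<bar>t\<bar> \<le> 1 + \<bar>t\<bar> powr q"
proof (cases "\<bar>t\<bar> \<le> 1")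
  case False
  then have "\<bar>t\<bar> powr 1 \<le> \<bar>t\<bar> powr q" by (intro powr_mono assms) auto
  then show ?thesis using False by simp
qed (use powr_ge_zero[of "\<bar>t\<bar>" q] in linarith)

lemma DERIV_lipschitz:
  fixes F :: "real \<Rightarrow> real"
  assumes "\<And>x. (F has_field_derivative F' x) (at x)" "\<And>x. \<bar>F' x\<bar> \<le> L"
  shows "\<bar>F x - F y\<bar> \<le> L * \<bar>x - y\<bar>"
  using field_differentiable_bound[of UNIV F F' L x y] assms by simp

subsection \<open>Smooth truncations\<close>

text \<open>Since \<open>2 trunc k s = |s + k| - |s - k|\<close>, replacing \<open>|\<cdot>|\<close> by \<open>\<epsilon> ln cosh (\<cdot> / \<epsilon>)\<close>
  gives a smooth truncation.\<close>

definition strunc :: "real \<Rightarrow> real \<Rightarrow> real \<Rightarrow> real" where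
  "strunc \<epsilon> k s = \<epsilon> / 2 * (ln (cosh ((s + k) / \<epsilon>)) - ln (cosh ((s - k) / \<epsilon>)))"

definition dtrunc :: "real \<Rightarrow> real \<Rightarrow> real \<Rightarrow> real" where
  "dtrunc \<epsilon> k s = (tanh ((s + k) / \<epsilon>) - tanh ((s - k) / \<epsilon>)) / 2"

lemma strunc_DERIV:
  assumes "\<epsilon> > 0"
  shows "(strunc \<epsilon> k has_field_derivative dtrunc \<epsilon> k s) (at s)"
proof -
  have 1: "((\<lambda>s. ln (cosh ((s + c) / \<epsilon>))) has_field_derivative tanh ((s + c) / \<epsilon>) * (1 / \<epsilon>)) (at s)" for c
    by (rule DERIV_chain2[OF DERIV_ln_cosh]) (use assms in \<open>auto intro!: derivative_eq_intros\<close>)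
  have "((\<lambda>s. \<epsilon> / 2 * (ln (cosh ((s + k) / \<epsilon>)) - ln (cosh ((s + - k) / \<epsilon>)))) has_field_derivative
     \<epsilon> / 2 * (tanh ((s + k) / \<epsilon>) * (1 / \<epsilon>) - tanh ((s + - k) / \<epsilon>) * (1 / \<epsilon>))) (at s)"
    by (intro DERIV_cmult DERIV_diff 1)
  moreover have "\<epsilon> / 2 * (tanh ((s + k) / \<epsilon>) * (1 / \<epsilon>) - tanh ((s + - k) / \<epsilon>) * (1 / \<epsilon>)) = dtrunc \<epsilon> k s"
    using assms by (simp add: dtrunc_def field_simps)
  ultimately show ?thesis by (simp add: strunc_def[abs_def])
qed

lemma smooth_affine: "smooth (\<lambda>s::real. (s + c) / d)"
  using smooth_mult[OF smooth_add[OF smooth_ident smooth_const] smooth_const, of c "inverse d"]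
  by (simp add: divide_inverse)

lemma smooth_strunc: "smooth (strunc \<epsilon> k)"
proof -
  have 1: "smooth (\<lambda>s. ln (cosh ((s + c) / \<epsilon>)))" for c
    by (rule smooth_compose[OF smooth_ln_cosh smooth_affine])
  have "smooth (\<lambda>s. \<epsilon> / 2 * (ln (cosh ((s + k) / \<epsilon>)) - ln (cosh ((s + - k) / \<epsilon>))))"
    by (rule smooth_mult[OF smooth_const smooth_diff[OF 1 1]])
  then show ?thesis by (simp add: strunc_def[abs_def])
qed

lemma strunc_0: "strunc \<epsilon> k 0 = 0"
proof -
  have "cosh (- (k / \<epsilon>)) = cosh (k / \<epsilon>)" by (rule cosh_minus)
  then show ?thesis by (simp add: strunc_def)
qed

lemma dtrunc_bounds:
  assumes "\<epsilon> > 0" "k \<ge> 0" shows "0 \<le> dtrunc \<epsilon> k s" "dtrunc \<epsilon> k s \<le> 1" "\<bar>dtrunc \<epsilon> k s\<bar> \<le> 1"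
proof -
  have "tanh ((s - k) / \<epsilon>) \<le> tanh ((s + k) / \<epsilon>)"
    using assms by (simp add: divide_right_mono)
  then show *: "0 \<le> dtrunc \<epsilon> k s" by (simp add: dtrunc_def)
  show "dtrunc \<epsilon> k s \<le> 1"
    using tanh_real_lt_1[of "(s + k) / \<epsilon>"] tanh_real_gt_neg1[of "(s - k) / \<epsilon>"] by (simp add: dtrunc_def)
  with * show "\<bar>dtrunc \<epsilon> k s\<bar> \<le> 1" by simp
qed

lemma strunc_le_ident:
  assumes "\<epsilon> > 0" "k \<ge> 0" shows "\<bar>strunc \<epsilon> k s\<bar> \<le> \<bar>s\<bar>"
  using DERIV_lipschitz[OF strunc_DERIV[OF assms(1)] dtrunc_bounds(3)[OF assms], of s 0] by (simp add: strunc_0)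

text \<open>ln cosh is 1-Lipschitz, and its two arguments differ by 2 k / \<epsilon>. The smooth
  truncation thus respects the same bound k as the sharp one.\<close>

lemma strunc_le:
  assumes "\<epsilon> > 0" "k \<ge> 0" shows "\<bar>strunc \<epsilon> k s\<bar> \<le> k"
proof -
  have "\<bar>ln (cosh ((s + k) / \<epsilon>)) - ln (cosh ((s - k) / \<epsilon>))\<bar> \<le> 1 * \<bar>(s + k) / \<epsilon> - (s - k) / \<epsilon>\<bar>"
  proof (rule DERIV_lipschitz[OF DERIV_ln_cosh])
    show "\<bar>tanh x\<bar> \<le> 1" for x :: real using tanh_real_lt_1[of x] tanh_real_gt_neg1[of x] by linarith
  qed
  also have "\<dots> = 2 * k / \<epsilon>"
  proof -
    have "(s + k) / \<epsilon> - (s - k) / \<epsilon> = 2 * k / \<epsilon>" using assms(1) by (simp add: field_simps)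
    then show ?thesis using assms by simp
  qed
  finally have "\<epsilon> / 2 * \<bar>ln (cosh ((s + k) / \<epsilon>)) - ln (cosh ((s - k) / \<epsilon>))\<bar> \<le> \<epsilon> / 2 * (2 * k / \<epsilon>)"
    using assms(1) by (intro mult_left_mono) auto
  then show ?thesis using assms(1) by (simp add: strunc_def abs_mult)
qed

text \<open>cosh x lies between half of exp |x| and exp |x|.\<close>

lemma ln_cosh_approx: "\<bar>x\<bar> - ln 2 \<le> ln (cosh x)" "ln (cosh x) \<le> \<bar>x\<bar>" for x :: real
proof -
  have c: "cosh x = (exp \<bar>x\<bar> + exp (- \<bar>x\<bar>)) / 2" by (auto simp: cosh_def abs_if)
  have "exp (- \<bar>x\<bar>) \<le> exp \<bar>x\<bar>" by simp
  moreover have "(a + b) / 2 \<le> a" if "b \<le> a" for a b :: real using that by simp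
  ultimately have "cosh x \<le> exp \<bar>x\<bar>" unfolding c by blast
  then have "ln (cosh x) \<le> ln (exp \<bar>x\<bar>)" by (subst ln_le_cancel_iff) auto
  then show "ln (cosh x) \<le> \<bar>x\<bar>" by simp
  have "a / 2 \<le> (a + exp b) / 2" for a b :: real by simp
  then have "exp \<bar>x\<bar> / 2 \<le> cosh x" unfolding c by blast
  then have "ln (exp \<bar>x\<bar> / 2) \<le> ln (cosh x)" by (subst ln_le_cancel_iff) auto
  then show "\<bar>x\<bar> - ln 2 \<le> ln (cosh x)" by (simp add: ln_div)
qed

text \<open>Each of the two scaled functions is within \<epsilon> ln 2 \<le> \<epsilon> of an
  absolute value, and the truncation is half their difference. The error is uniform in s, so the
  point s may vary together with \<epsilon>.\<close>

lemma strunc_approx: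
  assumes "\<epsilon> > 0" "k \<ge> 0" shows "\<bar>strunc \<epsilon> k s - trunc k s\<bar> \<le> \<epsilon>"
proof -
  have l2: "ln 2 \<le> (1::real)" using ln_le_minus_one[of "2::real"] by simp
  have e: "\<epsilon> * \<bar>x / \<epsilon>\<bar> = \<bar>x\<bar>" for x using assms(1) by (simp add: abs_div)
  have b: "\<bar>\<epsilon> * ln (cosh (x / \<epsilon>)) - \<bar>x\<bar>\<bar> \<le> \<epsilon>" for x
  proof -
    have "\<bar>ln (cosh (x / \<epsilon>)) - \<bar>x / \<epsilon>\<bar>\<bar> \<le> 1" using ln_cosh_approx[of "x / \<epsilon>"] l2 by linarith
    then have "\<epsilon> * \<bar>ln (cosh (x / \<epsilon>)) - \<bar>x / \<epsilon>\<bar>\<bar> \<le> \<epsilon> * 1" using assms(1) by (intro mult_left_mono) auto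
    then have "\<bar>\<epsilon> * (ln (cosh (x / \<epsilon>)) - \<bar>x / \<epsilon>\<bar>)\<bar> \<le> \<epsilon>" using assms(1) by (simp add: abs_mult)
    then show ?thesis unfolding right_diff_distrib e .
  qed
  have "trunc k s = (\<bar>s + k\<bar> - \<bar>s - k\<bar>) / 2" using assms(2) by (auto simp: trunc_def min_def max_def abs_if)
  moreover have "strunc \<epsilon> k s = (\<epsilon> * ln (cosh ((s + k) / \<epsilon>)) - \<epsilon> * ln (cosh ((s - k) / \<epsilon>))) / 2"
    by (simp add: strunc_def algebra_simps)
  ultimately show ?thesis using b[of "s + k"] b[of "s - k"] by (simp add: abs_le_iff)
qed

lemma continuous_trunc: "continuous_on A (trunc k)"
  unfolding trunc_def[abs_def] by (intro continuous_intros)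

lemma strunc_tendsto:
  assumes "s \<longlonglongrightarrow> l" "k \<ge> 0"
  shows "(\<lambda>j. strunc (1 / (real j + 1)) k (s j)) \<longlonglongrightarrow> trunc k l"
proof -
  have "isCont (trunc k) l" using continuous_trunc[of UNIV k] by (simp add: continuous_on_eq_continuous_at)
  then have 1: "(\<lambda>j. trunc k (s j)) \<longlonglongrightarrow> trunc k l" using assms(1) by (rule isCont_tendsto_compose)
  have "(\<lambda>j. 1 / (real j + 1)) \<longlonglongrightarrow> 0"
    using LIMSEQ_inverse_real_of_nat by (simp add: inverse_eq_divide add.commute)
  then have "(\<lambda>j. strunc (1 / (real j + 1)) k (s j) - trunc k (s j)) \<longlonglongrightarrow> 0"
    by (rule Lim_null_comparison[rotated]) (auto intro!: always_eventually strunc_approx assms)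
  from tendsto_add[OF this 1] show ?thesis by simp
qed

lemma filterlim_mult_real_Suc:
  assumes "s \<longlonglongrightarrow> l" "l > (0::real)"
  shows "filterlim (\<lambda>j. s j / (1 / (real j + 1))) at_top sequentially"
proof -
  have "filterlim (\<lambda>j. real j + 1) at_top sequentially"
    by (rule filterlim_at_top_mono[OF filterlim_real_sequentially]) simp
  from filterlim_tendsto_pos_mult_at_top[OF assms this] show ?thesis by simp
qed

lemma tanh_scaled_tendsto:
  assumes "s \<longlonglongrightarrow> l" "l \<noteq> (0::real)"
  shows "(\<lambda>j. tanh (s j / (1 / (real j + 1)))) \<longlonglongrightarrow> sgn l"
proof (cases "l > 0")
  case True
  then show ?thesis
    using filterlim_compose[OF tanh_real_at_top filterlim_mult_real_Suc[OF assms(1) True]] by simp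
next
  case False
  then have "(\<lambda>j. - s j) \<longlonglongrightarrow> - l" "- l > 0" using assms by (auto intro: tendsto_minus)
  from filterlim_compose[OF tanh_real_at_top filterlim_mult_real_Suc[OF this]]
  have "(\<lambda>j. - tanh (s j / (1 / (real j + 1)))) \<longlonglongrightarrow> 1" by simp
  from tendsto_minus[OF this] show ?thesis using False assms(2) by simp
qed

text \<open>The levels |l| = k are excluded because there the behaviour depends on how fast s
  approaches l. They do no harm later: gradients vanish almost everywhere on level sets.\<close>

lemma dtrunc_tendsto:
  assumes "s \<longlonglongrightarrow> l" "k > 0" "\<bar>l\<bar> \<noteq> k"
  shows "(\<lambda>j. dtrunc (1 / (real j + 1)) k (s j)) \<longlonglongrightarrow> (if \<bar>l\<bar> < k then 1 else 0)"
proof -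
  have "(\<lambda>j. dtrunc (1 / (real j + 1)) k (s j)) \<longlonglongrightarrow> (sgn (l + k) - sgn (l - k)) / 2"
    unfolding dtrunc_def
    by (intro tendsto_divide tendsto_diff tanh_scaled_tendsto tendsto_add assms(1) tendsto_const) (use assms in auto)
  moreover have "(sgn (l + k) - sgn (l - k)) / 2 = (if \<bar>l\<bar> < k then 1 else 0 :: real)"
    using assms(2,3) by (auto simp: sgn_if)
  ultimately show ?thesis by simp
qed

section \<open>Weak gradients, level sets and truncation for dominated limits\<close>

context exponents
begin

abbreviation "M \<equiv> lebesgue_on \<Omega>"

lemma AE_in_\<Omega>: "AE x in M. x \<in> \<Omega>"
  by (rule AE_I2) simp

lemma dom_approxD:
  assumes "dom_approx \<phi> v g"
  shows "\<exists>E. (\<forall>j. \<phi> j \<in> C0_infty \<Omega>) \<and> integrable M E \<and>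
    (AE x in M. x \<in> \<Omega> \<and> dominated \<phi> v g E x)"
proof -
  obtain E where *: "\<forall>j. \<phi> j \<in> C0_infty \<Omega>" "integrable M E"
    "AE x in M. dominated \<phi> v g E x"
    using assms unfolding dom_approx_def by blast
  have "AE x in M. x \<in> \<Omega> \<and> dominated \<phi> v g E x"
    using AE_in_\<Omega> *(3) by eventually_elim (rule conjI)
  with *(1,2) show ?thesis by (intro exI[of _ E] conjI)
qed

lemma dom_approx_cong:
  assumes "dom_approx \<phi> v g" "AE x in M. v x = v' x \<and> g x = g' x"
  shows "dom_approx \<phi> v' g'"
proof -
  obtain E where E: "\<And>j. \<phi> j \<in> C0_infty \<Omega>" "integrable M E"
    "AE x in M. x \<in> \<Omega> \<and> dominated \<phi> v g E x"
    using dom_approxD[OF assms(1)] by blast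
  show ?thesis unfolding dom_approx_def
  proof (intro conjI allI E(1) exI[of _ E] E(2))
    show "AE x in M. dominated \<phi> v' g' E x"
      using E(3) assms(2)
    proof eventually_elim
      case (elim x)
      have "jet v' g' c x = jet v g c x" for c using elim(2) by (cases c) auto
      then show ?case using elim(1) by simp
    qed
  qed
qed

lemma dom_approx_Lp:
  assumes "dom_approx \<phi> v g"
  shows "jet v g c \<in> borel_measurable M" "integrable M (\<lambda>x. \<bar>jet v g c x\<bar> powr ex c x)"
  using dom_approx_imp_W0_pairs[OF assms] unfolding W0_pairs_iff_jet by (auto simp: Lp_var_def)

lemma tjet_compose:
  assumes "\<And>s. (\<eta> has_field_derivative \<eta>' s) (at s)" "C_k 1 \<phi>"
  shows "tjet (\<lambda>x. \<eta> (\<phi> x)) (Some i) x = \<eta>' (\<phi> x) * tjet \<phi> (Some i) x"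
proof -
  have "(\<phi> has_derivative frechet_derivative \<phi> (at x)) (at x)" using C_k_SucD(1)[of 0 \<phi>] assms(2) by simp
  from frechet_derivative_eqI[OF has_derivative_compose_real[OF assms(1) this]]
  show ?thesis by (simp add: grad_def)
qed

lemma powr_abs_mono: "x \<in> \<Omega> \<Longrightarrow> \<bar>a\<bar> \<le> \<bar>b\<bar> \<Longrightarrow> \<bar>a\<bar> powr ex c x \<le> \<bar>b\<bar> powr ex c x"
  using ex_bounds(1)[of x c] by (intro powr_mono2) auto

text \<open>A function that fixes 0 and has slope at most 1 enlarges neither values nor gradients,
  so the old majorant still serves.\<close>

lemma dom_approx_compose:
  assumes da: "dom_approx \<phi> v g" and \<eta>: "smooth \<eta>" "\<eta> 0 = 0" "\<And>s. (\<eta> has_field_derivative \<eta>' s) (at s)"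
    "\<And>s. \<bar>\<eta>' s\<bar> \<le> 1" "continuous_on UNIV \<eta>'"
  shows "dom_approx (\<lambda>j x. \<eta> (\<phi> j x)) (\<lambda>x. \<eta> (v x)) (\<lambda>x. \<eta>' (v x) *\<^sub>R g x)"
proof -
  obtain E where E: "\<And>j. \<phi> j \<in> C0_infty \<Omega>" "integrable M E"
    "AE x in M. x \<in> \<Omega> \<and> dominated \<phi> v g E x"
    using dom_approxD[OF da] by blast
  have cont: "isCont \<eta> s" "isCont \<eta>' s" for s
    using DERIV_isCont[OF \<eta>(3)] \<eta>(5) by (auto simp: continuous_on_eq_continuous_at)
  have lip: "\<bar>\<eta> s\<bar> \<le> \<bar>s\<bar>" for s using DERIV_lipschitz[OF \<eta>(3,4), of s 0] \<eta>(2) by simp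
  note tj = tjet_compose[OF \<eta>(3) C0_infty_C1[OF E(1)]]
  show ?thesis unfolding dom_approx_def
  proof (intro conjI allI exI[of _ E] E(2))
    show "(\<lambda>x. \<eta> (\<phi> j x)) \<in> C0_infty \<Omega>" for j by (rule C0_infty_compose[OF E(1) \<eta>(1,2)])
    show "AE x in M. \<forall>c. (\<lambda>j. tjet (\<lambda>x. \<eta> (\<phi> j x)) c x) \<longlonglongrightarrow> jet (\<lambda>x. \<eta> (v x)) (\<lambda>x. \<eta>' (v x) *\<^sub>R g x) c x \<and>
        (\<forall>j. \<bar>tjet (\<lambda>x. \<eta> (\<phi> j x)) c x\<bar> powr ex c x \<le> E x)"
      using E(3)
    proof eventually_elim
      case (elim x)
      have lim: "(\<lambda>j. tjet (\<phi> j) c x) \<longlonglongrightarrow> jet v g c x" and bd: "\<bar>tjet (\<phi> j) c x\<bar> powr ex c x \<le> E x" for c j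
        using elim by auto
      have lim0: "(\<lambda>j. \<phi> j x) \<longlonglongrightarrow> v x" using lim[of None] by simp
      show ?case
      proof (intro allI conjI)
        fix c
        show "(\<lambda>j. tjet (\<lambda>x. \<eta> (\<phi> j x)) c x) \<longlonglongrightarrow> jet (\<lambda>x. \<eta> (v x)) (\<lambda>x. \<eta>' (v x) *\<^sub>R g x) c x"
        proof (cases c)
          case None
          then show ?thesis using isCont_tendsto_compose[OF cont(1) lim0] by simp
        next
          case (Some i)
          have "(\<lambda>j. \<eta>' (\<phi> j x) * tjet (\<phi> j) (Some i) x) \<longlonglongrightarrow> \<eta>' (v x) * jet v g (Some i) x"
            by (rule tendsto_mult[OF isCont_tendsto_compose[OF cont(2) lim0] lim])
          then show ?thesis unfolding Some tj by simp
        qed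
        fix j
        have "\<bar>tjet (\<lambda>x. \<eta> (\<phi> j x)) c x\<bar> \<le> \<bar>tjet (\<phi> j) c x\<bar>"
        proof (cases c)
          case (Some i)
          show ?thesis unfolding Some tj abs_mult using \<eta>(4)[of "\<phi> j x"] by (simp add: mult_left_le_one_le)
        qed (simp add: lip)
        then show "\<bar>tjet (\<lambda>x. \<eta> (\<phi> j x)) c x\<bar> powr ex c x \<le> E x"
          using elim by (intro order_trans[OF powr_abs_mono bd]) auto
      qed
    qed
  qed
qed

lemma integrable_continuous_compact_supp:
  assumes "continuous_on UNIV f" "compact (supp f)"
  shows "integrable M f"
proof -
  have "integrable M (\<lambda>x. \<bar>f x\<bar> powr 1)"
    by (rule integrable_powr_compact_supp[where Q=1]) (use \<Omega> assms in auto)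
  then show ?thesis using measurable_lebesgue_on_UNIV_continuous[OF \<Omega>(1) assms(1)]
    by (simp add: integrable_abs_iff)
qed

text \<open>By |t| \<le> 1 + |t|^q the approximants are bounded by 1 + E. The domain may have
  infinite measure, so the constant 1 is integrable only against \<theta>, and the summand E needs
  \<theta> bounded; hence both conditions on \<theta>.\<close>

lemma dom_approx_integral_tendsto:
  assumes da: "dom_approx \<phi> v g" and \<theta>: "integrable M \<theta>" "\<And>x. \<bar>\<theta> x\<bar> \<le> C"
  shows "integrable M (\<lambda>x. jet v g c x * \<theta> x)"
    and "(\<lambda>j. \<integral>x. tjet (\<phi> j) c x * \<theta> x \<partial>M) \<longlonglongrightarrow> (\<integral>x. jet v g c x * \<theta> x \<partial>M)"
proof -
  obtain E where E: "\<And>j. \<phi> j \<in> C0_infty \<Omega>" "integrable M E"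
    "AE x in M. x \<in> \<Omega> \<and> dominated \<phi> v g E x"
    using dom_approxD[OF da] by blast
  have C: "C \<ge> 0" using \<theta>(2)[of undefined] by linarith
  have [measurable]: "\<theta> \<in> borel_measurable M" "tjet (\<phi> j) c \<in> borel_measurable M" "jet v g c \<in> borel_measurable M" for j
    using \<theta>(1) tjet_measurable[OF C0_infty_C1[OF E(1)]] dom_approx_Lp(1)[OF da] by auto
  have 1: "integrable M (\<lambda>x. \<bar>\<theta> x\<bar> + C * E x)"
    by (intro Bochner_Integration.integrable_add integrable_abs integrable_mult_right \<theta> E)
  have 2: "AE x in M. (\<lambda>j. tjet (\<phi> j) c x * \<theta> x) \<longlonglongrightarrow> jet v g c x * \<theta> x"
    using E(3) by eventually_elim (auto intro!: tendsto_mult)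
  have 3: "AE x in M. norm (tjet (\<phi> j) c x * \<theta> x) \<le> \<bar>\<theta> x\<bar> + C * E x" for j
    using E(3)
  proof eventually_elim
    case (elim x)
    then have E0: "\<bar>tjet (\<phi> j) c x\<bar> powr ex c x \<le> E x" "1 \<le> ex c x" using ex_bounds[of x c] by auto
    have "\<bar>tjet (\<phi> j) c x\<bar> \<le> 1 + \<bar>tjet (\<phi> j) c x\<bar> powr ex c x" by (rule le_1_plus_powr[OF E0(2)])
    then have "\<bar>tjet (\<phi> j) c x\<bar> \<le> 1 + E x" using E0(1) by linarith
    then have "\<bar>tjet (\<phi> j) c x\<bar> * \<bar>\<theta> x\<bar> \<le> (1 + E x) * \<bar>\<theta> x\<bar>" by (rule mult_right_mono) simp
    moreover have "0 \<le> E x" by (rule order_trans[OF powr_ge_zero E0(1)])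
    then have "E x * \<bar>\<theta> x\<bar> \<le> E x * C" using \<theta>(2)[of x] by (intro mult_left_mono)
    ultimately show ?case by (simp add: abs_mult algebra_simps)
  qed
  show "integrable M (\<lambda>x. jet v g c x * \<theta> x)"
    by (rule integrable_dominated_convergence[OF _ _ 1 2 3]) measurable
  show "(\<lambda>j. \<integral>x. tjet (\<phi> j) c x * \<theta> x \<partial>M) \<longlonglongrightarrow> (\<integral>x. jet v g c x * \<theta> x \<partial>M)"
    by (rule integral_dominated_convergence[OF _ _ 1 2 3]) measurable
qed

lemma tjet_compact_supp: "\<psi> \<in> C0_infty \<Omega> \<Longrightarrow> compact (supp (tjet \<psi> c))"
  by (rule compact_supp_subset[OF _ supp_tjet]) (simp add: C0_infty_def)

lemma tjet_test:
  assumes "\<psi> \<in> C0_infty \<Omega>"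
  shows "integrable M (tjet \<psi> c)" "\<exists>C. \<forall>x. \<bar>tjet \<psi> c x\<bar> \<le> C"
proof -
  note * = tjet_continuous[OF C0_infty_C1[OF assms], of c] tjet_compact_supp[OF assms, of c]
  show "integrable M (tjet \<psi> c)" by (rule integrable_continuous_compact_supp[OF *])
  show "\<exists>C. \<forall>x. \<bar>tjet \<psi> c x\<bar> \<le> C" using continuous_compact_supp_bounded[OF *] by metis
qed

text \<open>Integration by parts holds for the approximants, and both sides converge because a test
  function and its derivatives are bounded and integrable.\<close>

lemma dom_approx_weak_derivative:
  assumes da: "dom_approx \<phi> v g" and \<psi>: "\<psi> \<in> C0_infty \<Omega>"
  shows "(\<integral>x. g x $ i * \<psi> x \<partial>M) = - (\<integral>x. v x * tjet \<psi> (Some i) x \<partial>M)"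
proof -
  have \<phi>: "\<phi> j \<in> C0_infty \<Omega>" for j using da unfolding dom_approx_def by blast
  have \<psi>0: "x \<notin> \<Omega> \<Longrightarrow> x \<notin> supp \<psi>" for x using \<psi> by (auto simp: C0_infty_def)
  have tm: "tjet (\<phi> j) c \<in> borel_measurable borel" "tjet \<psi> c \<in> borel_measurable borel" for c j
    by (intro borel_measurable_continuous_onI tjet_continuous C0_infty_C1 \<phi> \<psi>)+
  have m: "(\<lambda>x. tjet (\<phi> j) c x * tjet \<psi> c' x) \<in> borel_measurable borel" for j c c'
    by (rule borel_measurable_times[OF tm(1) tm(2)])
  have z: "tjet (\<phi> j) c x * tjet \<psi> c' x = 0" if "x \<notin> \<Omega>" for j c c' x
    by (simp add: tjet_outside_supp[OF \<psi>0[OF that]])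
  have ibp: "(\<integral>x. tjet (\<phi> j) (Some i) x * tjet \<psi> None x \<partial>M) = - (\<integral>x. tjet (\<phi> j) None x * tjet \<psi> (Some i) x \<partial>M)" for j
  proof -
    have "(\<integral>x. tjet (\<phi> j) (Some i) x * tjet \<psi> None x \<partial>M) = (\<integral>x. tjet (\<phi> j) (Some i) x * tjet \<psi> None x \<partial>lborel)"
      by (rule integral_lebesgue_on_eq_lborel[OF \<Omega>(1) m z])
    also have "\<dots> = - (\<integral>x. tjet (\<phi> j) None x * tjet \<psi> (Some i) x \<partial>lborel)"
      using integration_by_parts[OF C0_infty_C1[OF \<phi>] C0_infty_C1[OF \<psi>], of "axis i 1" j] \<psi>
      by (simp add: grad_def C0_infty_def)
    also have "(\<integral>x. tjet (\<phi> j) None x * tjet \<psi> (Some i) x \<partial>lborel) = (\<integral>x. tjet (\<phi> j) None x * tjet \<psi> (Some i) x \<partial>M)"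
      by (rule integral_lebesgue_on_eq_lborel[OF \<Omega>(1) m z, symmetric])
    finally show ?thesis .
  qed
  obtain C1 C2 where C: "\<And>x. \<bar>tjet \<psi> None x\<bar> \<le> C1" "\<And>x. \<bar>tjet \<psi> (Some i) x\<bar> \<le> C2"
    using tjet_test(2)[OF \<psi>] by metis
  have "(\<lambda>j. \<integral>x. tjet (\<phi> j) (Some i) x * tjet \<psi> None x \<partial>M) \<longlonglongrightarrow> (\<integral>x. jet v g (Some i) x * tjet \<psi> None x \<partial>M)"
    by (rule dom_approx_integral_tendsto(2)[OF da tjet_test(1)[OF \<psi>] C(1)])
  from LIMSEQ_unique[OF this] have "(\<lambda>j. \<integral>x. tjet (\<phi> j) (Some i) x * tjet \<psi> None x \<partial>M) \<longlonglongrightarrow> l \<Longrightarrow>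
      (\<integral>x. g x $ i * \<psi> x \<partial>M) = l" for l by simp
  moreover have "(\<lambda>j. \<integral>x. tjet (\<phi> j) (Some i) x * tjet \<psi> None x \<partial>M) \<longlonglongrightarrow> - (\<integral>x. jet v g None x * tjet \<psi> (Some i) x \<partial>M)"
    unfolding ibp by (rule tendsto_minus[OF dom_approx_integral_tendsto(2)[OF da tjet_test(1)[OF \<psi>] C(2)]])
  ultimately show ?thesis by simp
qed

lemma dom_approx_local_integrable:
  assumes "dom_approx \<phi> v g" "compact K"
  shows "integrable M (\<lambda>x. indicator K x * jet v g c x)"
  using dom_approx_integral_tendsto(1)[OF assms(1) integrable_indicator_compact[OF \<Omega>(1) assms(2)], of 1 c]
  by (simp add: mult.commute indicator_def)

text \<open>Two candidates have the same pairing with every test function. This makes the choice in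
  \<open>wgrad\<close> harmless almost everywhere.\<close>

lemma dom_approx_gradient_unique:
  assumes 1: "dom_approx \<phi> v g" and 2: "dom_approx \<phi>' v g'"
  shows "AE x in M. g x = g' x"
proof -
  have "AE x in M. g x $ i - g' x $ i = 0" for i
  proof (rule fundamental_lemma_variations[OF \<Omega>(1)])
    note m = dom_approx_Lp(1)[OF 1, of "Some i", simplified] dom_approx_Lp(1)[OF 2, of "Some i", simplified]
    show "(\<lambda>x. g x $ i - g' x $ i) \<in> borel_measurable M" by (intro borel_measurable_diff m)
    show "integrable M (\<lambda>x. indicator K x * (g x $ i - g' x $ i))" if "compact K" "K \<subseteq> \<Omega>" for K
      unfolding right_diff_distrib
      using dom_approx_local_integrable[OF 1 that(1), of "Some i"] dom_approx_local_integrable[OF 2 that(1), of "Some i"]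
      by (intro Bochner_Integration.integrable_diff) simp_all
    show "(\<integral>x. (g x $ i - g' x $ i) * \<psi> x \<partial>M) = 0" if \<psi>: "\<psi> \<in> C0_infty \<Omega>" for \<psi>
    proof -
      obtain C where C: "\<And>x. \<bar>tjet \<psi> None x\<bar> \<le> C" using tjet_test(2)[OF \<psi>] by metis
      have "(\<integral>x. g x $ i * \<psi> x - g' x $ i * \<psi> x \<partial>M) = (\<integral>x. g x $ i * \<psi> x \<partial>M) - (\<integral>x. g' x $ i * \<psi> x \<partial>M)"
        using dom_approx_integral_tendsto(1)[OF 1 tjet_test(1)[OF \<psi>] C, of "Some i"]
          dom_approx_integral_tendsto(1)[OF 2 tjet_test(1)[OF \<psi>] C, of "Some i"]
        by (intro Bochner_Integration.integral_diff) simp_all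
      then show ?thesis
        using dom_approx_weak_derivative[OF 1 \<psi>, of i] dom_approx_weak_derivative[OF 2 \<psi>, of i]
        by (simp add: left_diff_distrib)
    qed
  qed
  then have "AE x in M. \<forall>i\<in>UNIV. g x $ i - g' x $ i = 0"
    by (intro AE_finite_allI) auto
  then show ?thesis by eventually_elim (simp add: vec_eq_iff)
qed

text \<open>The functions \<open>(tanh (n (s - c)) + tanh (n c)) / n\<close> tend to \<open>0\<close> uniformly, their derivatives
  boundedly to the indicator of \<open>{c}\<close>.\<close>

lemma dom_approx_gradient_level_set:
  assumes da: "dom_approx \<phi> v g"
  shows "AE x in M. v x = c \<longrightarrow> g x = 0"
proof -
  have vm [measurable]: "v \<in> borel_measurable M" using dom_approx_Lp(1)[OF da, of None] by simp
  have "AE x in M. indicator {x. v x = c} x * g x $ i = 0" for i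
  proof (rule fundamental_lemma_variations[OF \<Omega>(1)])
    have gm [measurable]: "(\<lambda>x. g x $ i) \<in> borel_measurable M" using dom_approx_Lp(1)[OF da, of "Some i"] by simp
    have ind: "(\<lambda>x. indicator {x. v x = c} x :: real) = (\<lambda>x. if v x = c then 1 else 0)" by (auto simp: indicator_def)
    have im [measurable]: "(\<lambda>x. indicator {x. v x = c} x :: real) \<in> borel_measurable M" unfolding ind by measurable
    show hm: "(\<lambda>x. indicator {x. v x = c} x * g x $ i) \<in> borel_measurable M" by measurable
    show "integrable M (\<lambda>x. indicator K x * (indicator {x. v x = c} x * g x $ i))" if "compact K" "K \<subseteq> \<Omega>" for K
    proof (rule Bochner_Integration.integrable_bound[OF dom_approx_local_integrable[OF da that(1), of "Some i"]])
      show "(\<lambda>x. indicator K x * (indicator {x. v x = c} x * g x $ i)) \<in> borel_measurable M"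
        by (intro borel_measurable_times hm indicator_compact_measurable \<Omega>(1) that(1))
    qed (auto simp: indicator_def)
    show "(\<integral>x. indicator {x. v x = c} x * g x $ i * \<psi> x \<partial>M) = 0" if \<psi>: "\<psi> \<in> C0_infty \<Omega>" for \<psi>
    proof -
      obtain C where C: "\<And>x. \<bar>tjet \<psi> None x\<bar> \<le> C" using tjet_test(2)[OF \<psi>] by metis
      have gi: "integrable M (\<lambda>x. g x $ i * \<psi> x)"
        using dom_approx_integral_tendsto(1)[OF da tjet_test(1)[OF \<psi>] C, of "Some i"] by simp
      have [measurable]: "\<psi> \<in> borel_measurable M" "tjet \<psi> (Some i) \<in> borel_measurable M"
        using tjet_measurable[OF C0_infty_C1[OF \<psi>], of None] tjet_measurable[OF C0_infty_C1[OF \<psi>], of "Some i"] by simp_all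
      define N where "N n = real n + 1" for n
      have N: "N n > 0" for n by (simp add: N_def)
      \<comment> \<open>The constant \<open>tanh (N n * c)\<close> enforces value 0 at 0, so that
        compact supports survive the composition; the factor \<open>inverse (N n)\<close> brings the
        slope down to at most 1.\<close>
      define \<eta> where "\<eta> n s = (tanh ((s + - c) / (1 / N n)) + tanh (N n * c)) * inverse (N n)" for n s
      define \<eta>' where "\<eta>' n s = 1 - (tanh ((s + - c) / (1 / N n)))\<^sup>2" for n s
      have sm: "smooth (\<eta> n)" for n unfolding \<eta>_def
        by (rule smooth_mult[OF smooth_add[OF smooth_compose[OF smooth_tanh smooth_affine] smooth_const] smooth_const])
      have \<eta>0: "\<eta> n 0 = 0" for n
      proof -
        have "(0 + - c) / (1 / N n) = - (N n * c)" by simp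
        then show ?thesis by (simp only: \<eta>_def tanh_minus) simp
      qed
      have D: "(\<eta> n has_field_derivative \<eta>' n s) (at s)" for n s
        unfolding \<eta>_def \<eta>'_def using N[of n] by (auto intro!: derivative_eq_intros)
      have t1: "(tanh x)\<^sup>2 \<le> 1" for x :: real
        using tanh_real_lt_1[of x] tanh_real_gt_neg1[of x] by (simp add: abs_square_le_1)
      have b1: "\<bar>\<eta>' n s\<bar> \<le> 1" for n s unfolding \<eta>'_def using t1 by (simp add: abs_le_iff)
      have cont: "continuous_on UNIV (\<eta>' n)" for n
        unfolding \<eta>'_def using N[of n] by (intro continuous_intros) auto
      have b2: "\<bar>\<eta> n s\<bar> \<le> 2 / N n" for n s
      proof -
        have "\<bar>tanh ((s + - c) / (1 / N n)) + tanh (N n * c)\<bar> \<le> 2"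
          using tanh_real_lt_1[of "(s + - c) / (1 / N n)"] tanh_real_gt_neg1[of "(s + - c) / (1 / N n)"]
            tanh_real_lt_1[of "N n * c"] tanh_real_gt_neg1[of "N n * c"] by linarith
        then show ?thesis using N[of n] unfolding \<eta>_def abs_mult
          by (simp add: divide_inverse mult_right_mono)
      qed
      \<comment> \<open>The derivative is moved to the test function. The right side is of order 1 /
        N, while the left side tends to the integral over the level set.\<close>
      have eq: "(\<integral>x. \<eta>' n (v x) * g x $ i * \<psi> x \<partial>M) = - (\<integral>x. \<eta> n (v x) * tjet \<psi> (Some i) x \<partial>M)" for n
        using dom_approx_weak_derivative[OF dom_approx_compose[OF da sm[of n] \<eta>0 D b1 cont] \<psi>, of i] by simp
      define B where "B = (\<integral>x. \<bar>tjet \<psi> (Some i) x\<bar> \<partial>M)"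
      have bd: "\<bar>\<integral>x. \<eta>' n (v x) * g x $ i * \<psi> x \<partial>M\<bar> \<le> 2 / N n * B" for n
      proof -
        have "\<bar>\<integral>x. \<eta> n (v x) * tjet \<psi> (Some i) x \<partial>M\<bar> \<le> (\<integral>x. \<bar>\<eta> n (v x) * tjet \<psi> (Some i) x\<bar> \<partial>M)"
          by (rule integral_abs_bound)
        also have "\<dots> \<le> (\<integral>x. 2 / N n * \<bar>tjet \<psi> (Some i) x\<bar> \<partial>M)"
        proof (rule integral_mono')
          show "integrable M (\<lambda>x. 2 / N n * \<bar>tjet \<psi> (Some i) x\<bar>)"
            by (intro integrable_mult_right integrable_abs tjet_test \<psi>)
          show "\<bar>\<eta> n (v x) * tjet \<psi> (Some i) x\<bar> \<le> 2 / N n * \<bar>tjet \<psi> (Some i) x\<bar>" for x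
            unfolding abs_mult by (rule mult_right_mono[OF b2]) simp
          show "0 \<le> 2 / N n * \<bar>tjet \<psi> (Some i) x\<bar>" for x using N[of n] by simp
        qed
        also have "\<dots> = 2 / N n * B" unfolding B_def by (rule integral_mult_right_zero)
        finally show ?thesis unfolding eq by simp
      qed
      have lim1: "(\<lambda>n. \<integral>x. \<eta>' n (v x) * g x $ i * \<psi> x \<partial>M) \<longlonglongrightarrow> 0"
      proof (rule Lim_null_comparison)
        show "\<forall>\<^sub>F n in sequentially. norm (\<integral>x. \<eta>' n (v x) * g x $ i * \<psi> x \<partial>M) \<le> 2 / N n * B"
          unfolding real_norm_def by (intro always_eventually allI bd)
        have "2 * B * inverse (real (Suc n)) = 2 / N n * B" for n
          by (simp only: N_def divide_inverse of_nat_Suc mult_ac add_ac)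
        then show "(\<lambda>n. 2 / N n * B) \<longlonglongrightarrow> 0"
          using tendsto_mult_right_zero[OF LIMSEQ_inverse_real_of_nat, of "2 * B"] by (simp only:)
      qed
      have "(\<lambda>n. \<integral>x. \<eta>' n (v x) * g x $ i * \<psi> x \<partial>M) \<longlonglongrightarrow> (\<integral>x. indicator {x. v x = c} x * g x $ i * \<psi> x \<partial>M)"
      proof (rule integral_dominated_convergence[where w="\<lambda>x. \<bar>g x $ i * \<psi> x\<bar>"])
        have "\<eta>' n \<in> borel_measurable borel" for n by (rule borel_measurable_continuous_onI[OF cont])
        then have [measurable]: "(\<lambda>x. \<eta>' n (v x)) \<in> borel_measurable M" for n
          by (rule measurable_compose[OF vm])
        show "(\<lambda>x. \<eta>' n (v x) * g x $ i * \<psi> x) \<in> borel_measurable M" for n by measurable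
        show "(\<lambda>x. indicator {x. v x = c} x * g x $ i * \<psi> x) \<in> borel_measurable M" by measurable
        show "integrable M (\<lambda>x. \<bar>g x $ i * \<psi> x\<bar>)" by (rule integrable_abs[OF gi])
        show "AE x in M. norm (\<eta>' n (v x) * g x $ i * \<psi> x) \<le> \<bar>g x $ i * \<psi> x\<bar>" for n
        proof (rule AE_I2)
          fix x
          have "\<bar>\<eta>' n (v x)\<bar> * \<bar>g x $ i * \<psi> x\<bar> \<le> 1 * \<bar>g x $ i * \<psi> x\<bar>" by (rule mult_right_mono[OF b1]) simp
          then show "norm (\<eta>' n (v x) * g x $ i * \<psi> x) \<le> \<bar>g x $ i * \<psi> x\<bar>" by (simp add: abs_mult mult.assoc)
        qed
        show "AE x in M. (\<lambda>n. \<eta>' n (v x) * g x $ i * \<psi> x) \<longlonglongrightarrow> indicator {x. v x = c} x * g x $ i * \<psi> x"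
        proof (intro AE_I2 tendsto_mult tendsto_const)
          fix x
          show "(\<lambda>n. \<eta>' n (v x)) \<longlonglongrightarrow> indicator {x. v x = c} x"
          proof (cases "v x = c")
            case False
            then have "v x + - c \<noteq> 0" by simp
            from tanh_scaled_tendsto[OF tendsto_const this]
            have "(\<lambda>n. \<eta>' n (v x)) \<longlonglongrightarrow> 1 - (sgn (v x + - c))\<^sup>2"
              unfolding \<eta>'_def N_def by (intro tendsto_diff tendsto_const tendsto_power)
            then show ?thesis using False by (simp add: sgn_if split: if_splits)
          qed (simp add: \<eta>'_def)
        qed
      qed
      from LIMSEQ_unique[OF this lim1] show ?thesis .
    qed
  qed
  then have "AE x in M. \<forall>i\<in>UNIV. indicator {x. v x = c} x * g x $ i = 0"
    by (intro AE_finite_allI) auto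
  then show ?thesis by eventually_elim (auto simp: vec_eq_iff)
qed

text \<open>The approximants are truncated smoothly with \<epsilon> = 1 / (j + 1). Convergence of
  the gradients is in doubt only on {|v| = k}, a union of two level sets. The uniform bound k is
  recorded because the entropy inequality will be tested with bounded families.\<close>

lemma dom_approx_trunc:
  assumes da: "dom_approx \<phi> v g" and k: "k > 0"
  shows "\<exists>\<phi>'. dom_approx \<phi>' (\<lambda>x. trunc k (v x)) (\<lambda>x. indicator {y. \<bar>v y\<bar> < k} x *\<^sub>R g x) \<and>
    (\<forall>j x. \<bar>\<phi>' j x\<bar> \<le> k)"
proof -
  obtain E where E: "\<And>j. \<phi> j \<in> C0_infty \<Omega>" "integrable M E"
    "AE x in M. x \<in> \<Omega> \<and> dominated \<phi> v g E x"
    using dom_approxD[OF da] by blast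
  define e where "e j = 1 / (real j + 1)" for j
  have e: "e j > 0" for j by (simp add: e_def)
  have k0: "k \<ge> 0" using k by simp
  define \<phi>' where "\<phi>' j x = strunc (e j) k (\<phi> j x)" for j x
  have tj: "tjet (\<phi>' j) (Some i) x = dtrunc (e j) k (\<phi> j x) * tjet (\<phi> j) (Some i) x" for i j x
    unfolding \<phi>'_def by (rule tjet_compose[OF strunc_DERIV[OF e] C0_infty_C1[OF E(1)]])
  have "dom_approx \<phi>' (\<lambda>x. trunc k (v x)) (\<lambda>x. indicator {y. \<bar>v y\<bar> < k} x *\<^sub>R g x)"
    unfolding dom_approx_def
  proof (intro conjI allI exI[of _ E] E(2))
    show "\<phi>' j \<in> C0_infty \<Omega>" for j unfolding \<phi>'_def by (rule C0_infty_compose[OF E(1) smooth_strunc strunc_0])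
    show "AE x in M. \<forall>c. (\<lambda>j. tjet (\<phi>' j) c x) \<longlonglongrightarrow> jet (\<lambda>x. trunc k (v x)) (\<lambda>x. indicator {y. \<bar>v y\<bar> < k} x *\<^sub>R g x) c x \<and>
        (\<forall>j. \<bar>tjet (\<phi>' j) c x\<bar> powr ex c x \<le> E x)"
      using E(3) dom_approx_gradient_level_set[OF da, of k] dom_approx_gradient_level_set[OF da, of "-k"]
    proof eventually_elim
      case (elim x)
      have lim: "(\<lambda>j. tjet (\<phi> j) c x) \<longlonglongrightarrow> jet v g c x" and bd: "\<bar>tjet (\<phi> j) c x\<bar> powr ex c x \<le> E x" for c j
        using elim by auto
      have lim0: "(\<lambda>j. \<phi> j x) \<longlonglongrightarrow> v x" using lim[of None] by simp
      show ?case
      proof (intro allI conjI)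
        fix c j
        have "\<bar>tjet (\<phi>' j) c x\<bar> \<le> \<bar>tjet (\<phi> j) c x\<bar>"
        proof (cases c)
          case (Some i)
          show ?thesis unfolding Some tj abs_mult using dtrunc_bounds[OF e k0] by (simp add: mult_left_le_one_le)
        qed (simp add: strunc_le_ident[OF e k0] \<phi>'_def)
        then show "\<bar>tjet (\<phi>' j) c x\<bar> powr ex c x \<le> E x"
          using elim by (intro order_trans[OF powr_abs_mono bd]) auto
      next
        fix c
        show "(\<lambda>j. tjet (\<phi>' j) c x) \<longlonglongrightarrow> jet (\<lambda>x. trunc k (v x)) (\<lambda>x. indicator {y. \<bar>v y\<bar> < k} x *\<^sub>R g x) c x"
        proof (cases c)
          case None
          then show ?thesis unfolding \<phi>'_def e_def using strunc_tendsto[OF lim0 k0] by simp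
        next
          case (Some i)
          show ?thesis
          proof (cases "\<bar>v x\<bar> = k")
            case True
            \<comment> \<open>The factor \<open>dtrunc\<close> may oscillate here, but it is bounded
              and multiplies a sequence that tends to g x = 0.\<close>
            then have "v x = k \<or> v x = - k" by linarith
            then have g0: "g x = 0" using elim by blast
            then have z: "(\<lambda>j. tjet (\<phi> j) (Some i) x) \<longlonglongrightarrow> 0" using lim[of "Some i"] by simp
            have "(\<lambda>j. tjet (\<phi>' j) (Some i) x) \<longlonglongrightarrow> 0"
            proof (rule Lim_null_comparison)
              show "\<forall>\<^sub>F j in sequentially. norm (tjet (\<phi>' j) (Some i) x) \<le> \<bar>tjet (\<phi> j) (Some i) x\<bar>"
                unfolding tj using dtrunc_bounds[OF e k0]
                by (intro always_eventually allI) (simp add: abs_mult mult_left_le_one_le)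
              show "(\<lambda>j. \<bar>tjet (\<phi> j) (Some i) x\<bar>) \<longlonglongrightarrow> 0" by (rule tendsto_rabs_zero[OF z])
            qed
            then show ?thesis using g0 Some by simp
          next
            case False
            have "(\<lambda>j. tjet (\<phi>' j) (Some i) x) \<longlonglongrightarrow> (if \<bar>v x\<bar> < k then 1 else 0) * jet v g (Some i) x"
              unfolding tj e_def by (rule tendsto_mult[OF dtrunc_tendsto[OF lim0 k False] lim])
            then show ?thesis using Some by (auto simp: indicator_def)
          qed
        qed
      qed
    qed
  qed
  moreover have "\<forall>j x. \<bar>\<phi>' j x\<bar> \<le> k" by (simp add: \<phi>'_def strunc_le[OF e k0])
  ultimately show ?thesis by blast
qed

end

subsection \<open>Gradients of truncations\<close>

lemma trunc_trunc: "0 < k \<Longrightarrow> k \<le> m \<Longrightarrow> trunc k (trunc m s) = trunc k s"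
  and abs_trunc_less_iff: "0 < k \<Longrightarrow> k \<le> m \<Longrightarrow> \<bar>trunc m s\<bar> < k \<longleftrightarrow> \<bar>s\<bar> < k"
  by (auto simp: trunc_def min_def max_def)

lemma abs_trunc_le: "0 \<le> k \<Longrightarrow> \<bar>trunc k s\<bar> \<le> k"
  by (auto simp: trunc_def min_def max_def)

lemma trunc_eq: "s \<ge> k \<Longrightarrow> 0 \<le> k \<Longrightarrow> trunc k s = k" "s \<le> - k \<Longrightarrow> 0 \<le> k \<Longrightarrow> trunc k s = - k"
  "\<bar>s\<bar> \<le> k \<Longrightarrow> trunc k s = s"
  by (auto simp: trunc_def)

text \<open>Once |s| exceeds N, both differences have passed the level k with the same sign. So u
  may be replaced by T_N(u), which belongs to the Sobolev space, inside T_k(u - c).\<close>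

lemma trunc_diff_trunc:
  assumes "0 < k" "k + \<bar>c\<bar> \<le> N"
  shows "trunc k (trunc N s - c) = trunc k (s - c)" and "\<bar>trunc N s - c\<bar> < k \<longleftrightarrow> \<bar>s - c\<bar> < k"
proof -
  have c: "k \<le> N - c" "k \<le> N + c" "0 \<le> N" "0 \<le> k" using assms abs_ge_self[of c] abs_ge_minus_self[of c] by linarith+
  consider "\<bar>s\<bar> \<le> N" | "s > N" | "s < - N" by linarith
  then have "trunc k (trunc N s - c) = trunc k (s - c) \<and> (\<bar>trunc N s - c\<bar> < k \<longleftrightarrow> \<bar>s - c\<bar> < k)"
  proof cases
    case 1
    then show ?thesis by (simp add: trunc_eq(3))
  next
    case 2
    then have "trunc N s = N" using c by (intro trunc_eq(1)) auto
    moreover have "trunc k (N - c) = k" "trunc k (s - c) = k" using 2 c by (auto intro!: trunc_eq(1))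
    moreover have "\<not> \<bar>N - c\<bar> < k" "\<not> \<bar>s - c\<bar> < k" using 2 c by linarith+
    ultimately show ?thesis by simp
  next
    case 3
    then have "trunc N s = - N" using c by (intro trunc_eq(2)) auto
    moreover have "trunc k (- N - c) = - k" "trunc k (s - c) = - k" using 3 c by (auto intro!: trunc_eq(2))
    moreover have "\<not> \<bar>- N - c\<bar> < k" "\<not> \<bar>s - c\<bar> < k" using 3 c by linarith+
    ultimately show ?thesis by simp
  qed
  then show "trunc k (trunc N s - c) = trunc k (s - c)" and "\<bar>trunc N s - c\<bar> < k \<longleftrightarrow> \<bar>s - c\<bar> < k" by auto
qed

lemma measurable_vec_componentwise:
  fixes G :: "'a \<Rightarrow> real^'n"
  assumes "\<And>i. (\<lambda>x. G x $ i) \<in> borel_measurable N"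
  shows "G \<in> borel_measurable N"
  by (rule borel_measurable_euclidean_space[THEN iffD2]) (auto simp: Basis_vec_def inner_axis assms)

text \<open>Simple functions approximating (u, U) take finitely many values, and for each fixed
  value c is measurable in x. Continuity in the other variables passes to the limit for almost every
  x, and completeness absorbs the exceptional set.\<close>

lemma measurable_caratheodory:
  fixes c :: "real^'n \<Rightarrow> real \<Rightarrow> real^'n \<Rightarrow> real"
  assumes \<Omega>: "open \<Omega>" and c: "caratheodory \<Omega> c"
    and u: "u \<in> borel_measurable (lebesgue_on \<Omega>)" and U: "U \<in> borel_measurable (lebesgue_on \<Omega>)"
  shows "(\<lambda>x. c x (u x) (U x)) \<in> borel_measurable (lebesgue_on \<Omega>)"
proof -
  let ?M = "lebesgue_on \<Omega>"
  have "(\<lambda>x. (u x, U x)) \<in> borel_measurable ?M" using u U by (rule borel_measurable_Pair)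
  from borel_measurable_implies_sequence_metric[OF this, of "(0, 0)"]
  obtain F where F: "\<And>i. simple_function ?M (F i)" "\<And>x. x \<in> space ?M \<Longrightarrow> (\<lambda>i. F i x) \<longlonglongrightarrow> (u x, U x)"
    by blast
  define G where "G i x = (\<lambda>(s0, s). c x s0 s) (F i x)" for i x
  have [measurable]: "G i \<in> borel_measurable ?M" for i
    unfolding G_def
  proof (rule measurable_compose_countable'[where f="\<lambda>y x. (\<lambda>(s0, s). c x s0 s) y" and g="F i" and I="F i ` space ?M"])
    show "(\<lambda>x. case y of (s0, s) \<Rightarrow> c x s0 s) \<in> borel_measurable ?M" for y
      using c by (cases y) (simp add: caratheodory_def)
    have fin: "finite (F i ` space ?M)" using F(1) by (rule simple_functionD)
    show "F i \<in> measurable ?M (count_space (F i ` space ?M))"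
      unfolding measurable_count_space_eq2[OF fin] using simple_functionD(2)[OF F(1), of i] by auto
    show "countable (F i ` space ?M)" using fin by (rule countable_finite)
  qed
  have lim: "(\<lambda>x. lim (\<lambda>i. G i x)) \<in> borel_measurable ?M" by measurable
  have "AE x in ?M. continuous_on UNIV (\<lambda>(s0, s). c x s0 s)" using c by (simp add: caratheodory_def)
  moreover have "AE x in ?M. x \<in> space ?M" by (rule AE_I2)
  ultimately have "AE x in ?M. lim (\<lambda>i. G i x) = c x (u x) (U x)"
  proof eventually_elim
    case (elim x)
    then have "isCont (\<lambda>(s0, s). c x s0 s) (u x, U x)" by (simp add: continuous_on_eq_continuous_at)
    from isCont_tendsto_compose[OF this F(2)[OF elim(2)]]
    have "(\<lambda>i. G i x) \<longlonglongrightarrow> c x (u x) (U x)" by (simp add: G_def)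
    then show ?case by (rule limI)
  qed
  then show ?thesis by (rule measurable_lebesgue_on_AE[OF \<Omega> lim])
qed

lemma C_1_has_derivative: "C_k 1 f \<Longrightarrow> (f has_derivative frechet_derivative f (at x)) (at x)"
  using C_k_SucD(1)[of 0 f] by simp

context exponents
begin

lemma W0_imp_dom_approx:
  assumes "v \<in> W0 \<Omega> p0 p"
  shows "\<exists>\<phi>. dom_approx \<phi> v (wgrad \<Omega> p0 p v)"
proof -
  have "(v, wgrad \<Omega> p0 p v) \<in> W0_pairs \<Omega> p0 p"
    using assms unfolding W0_def wgrad_def by (auto intro: someI[of "\<lambda>g. (v, g) \<in> W0_pairs \<Omega> p0 p"])
  then show ?thesis by (rule W0_pairs_imp_dom_approx)
qed

lemma wgrad_eq_AE:
  assumes "dom_approx \<phi> v g"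
  shows "AE x in M. wgrad \<Omega> p0 p v x = g x"
proof -
  have "v \<in> W0 \<Omega> p0 p" using dom_approx_imp_W0_pairs[OF assms] by (auto simp: W0_def)
  then obtain \<phi>' where "dom_approx \<phi>' v (wgrad \<Omega> p0 p v)" using W0_imp_dom_approx by blast
  then show ?thesis by (rule dom_approx_gradient_unique[OF _ assms])
qed

text \<open>Follows from T_k = T_k after T_m; it makes the gradients at different levels fit
  together.\<close>

lemma T0_trunc_consistent:
  assumes u: "u \<in> T0 \<Omega> p0 p" and k: "0 < k" "k \<le> m"
  shows "AE x in M. wgrad \<Omega> p0 p (\<lambda>y. trunc k (u y)) x = indicator {y. \<bar>u y\<bar> < k} x *\<^sub>R wgrad \<Omega> p0 p (\<lambda>y. trunc m (u y)) x"
proof -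
  have "(\<lambda>y. trunc m (u y)) \<in> W0 \<Omega> p0 p" using u k by (simp add: T0_def)
  then obtain \<phi> where "dom_approx \<phi> (\<lambda>y. trunc m (u y)) (wgrad \<Omega> p0 p (\<lambda>y. trunc m (u y)))"
    using W0_imp_dom_approx by blast
  then obtain \<phi>' where "dom_approx \<phi>' (\<lambda>x. trunc k (trunc m (u x)))
      (\<lambda>x. indicator {y. \<bar>trunc m (u y)\<bar> < k} x *\<^sub>R wgrad \<Omega> p0 p (\<lambda>y. trunc m (u y)) x)"
    using dom_approx_trunc[OF _ k(1)] by blast
  from wgrad_eq_AE[OF this] show ?thesis unfolding trunc_trunc[OF k] abs_trunc_less_iff[OF k] .
qed

text \<open>Justifies the choice in \<open>tgrad\<close>: the gradient is glued from those of the
  truncations, using level n + 1 on {n \<le> |u| < n + 1}.\<close>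

lemma tgrad_ex:
  assumes u: "u \<in> T0 \<Omega> p0 p"
  shows "\<exists>U. U \<in> borel_measurable M \<and> (\<forall>k>0. AE x in M.
    wgrad \<Omega> p0 p (\<lambda>y. trunc k (u y)) x = indicator {y. \<bar>u y\<bar> < k} x *\<^sub>R U x)"
proof -
  define G where "G n = wgrad \<Omega> p0 p (\<lambda>y. trunc (real n + 1) (u y))" for n :: nat
  \<comment> \<open>With the floor, |u x| lies strictly below the level N x + 1, so the truncation
    at that level is inactive near the value u x.\<close>
  define N where "N x = nat \<lfloor>\<bar>u x\<bar>\<rfloor>" for x
  define U where "U x = G (N x) x" for x
  have um [measurable]: "u \<in> borel_measurable M" using u by (simp add: T0_def)
  have Gm: "G n \<in> borel_measurable M" for n
  proof (rule measurable_vec_componentwise)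
    fix i
    have "(\<lambda>y. trunc (real n + 1) (u y)) \<in> W0 \<Omega> p0 p" using u by (simp add: T0_def)
    from W0_imp_dom_approx[OF this]
    obtain \<phi> where "dom_approx \<phi> (\<lambda>y. trunc (real n + 1) (u y)) (G n)"
      unfolding G_def by blast
    from dom_approx_Lp(1)[OF this, of "Some i"] show "(\<lambda>x. G n x $ i) \<in> borel_measurable M" by simp
  qed
  have "U \<in> borel_measurable M" unfolding U_def
  proof (rule measurable_compose_countable[OF Gm])
    show "N \<in> measurable M (count_space UNIV)" unfolding N_def by measurable
  qed
  moreover have "AE x in M. wgrad \<Omega> p0 p (\<lambda>y. trunc k (u y)) x = indicator {y. \<bar>u y\<bar> < k} x *\<^sub>R U x" if k: "k > 0" for k
  proof -
    obtain m :: nat where "k \<le> real m" using real_arch_simple[of k] by blast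
    then have m: "k \<le> real m + 1" by simp
    \<comment> \<open>The index N x depends on x, so consistency is needed for all levels n outside
      one common null set.\<close>
    have cons: "AE x in M. \<forall>n. n \<le> m \<longrightarrow> G n x = indicator {y. \<bar>u y\<bar> < real n + 1} x *\<^sub>R G m x"
      unfolding AE_all_countable
    proof
      fix n
      show "AE x in M. n \<le> m \<longrightarrow> G n x = indicator {y. \<bar>u y\<bar> < real n + 1} x *\<^sub>R G m x"
      proof (cases "n \<le> m")
        case True
        then show ?thesis using T0_trunc_consistent[OF u, of "real n + 1" "real m + 1"] by (simp add: G_def)
      qed simp
    qed
    have "AE x in M. wgrad \<Omega> p0 p (\<lambda>y. trunc k (u y)) x = indicator {y. \<bar>u y\<bar> < k} x *\<^sub>R G m x"
      using T0_trunc_consistent[OF u k m] by (simp add: G_def)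
    with cons show ?thesis
    proof eventually_elim
      case (elim x)
      show ?case
      proof (cases "\<bar>u x\<bar> < k")
        case True
        have "real (N x) = of_int \<lfloor>\<bar>u x\<bar>\<rfloor>" unfolding N_def by (rule of_nat_nat) simp
        then have "real (N x) \<le> \<bar>u x\<bar>" "\<bar>u x\<bar> < real (N x) + 1" by linarith+
        then have "N x < m + 1" using True m by linarith
        then have "N x \<le> m" by simp
        with elim(1) have "G (N x) x = indicator {y. \<bar>u y\<bar> < real (N x) + 1} x *\<^sub>R G m x" by blast
        also have "\<dots> = G m x" using \<open>\<bar>u x\<bar> < real (N x) + 1\<close> by simp
        finally have "G (N x) x = G m x" .
        then show ?thesis using elim(2) by (simp add: U_def)
      next
        case False
        then show ?thesis using elim(2) by simp
      qed
    qed
  qed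
  ultimately show ?thesis by (auto intro!: exI[of _ U])
qed

lemma tgrad_spec:
  assumes "u \<in> T0 \<Omega> p0 p"
  shows "tgrad \<Omega> p0 p u \<in> borel_measurable M \<and> (\<forall>k>0. AE x in M.
    wgrad \<Omega> p0 p (\<lambda>y. trunc k (u y)) x = indicator {y. \<bar>u y\<bar> < k} x *\<^sub>R tgrad \<Omega> p0 p u x)"
  unfolding tgrad_def by (rule someI_ex[OF tgrad_ex[OF assms]])

lemma tgrad_measurable: "u \<in> T0 \<Omega> p0 p \<Longrightarrow> tgrad \<Omega> p0 p u \<in> borel_measurable M"
  and wgrad_trunc: "u \<in> T0 \<Omega> p0 p \<Longrightarrow> k > 0 \<Longrightarrow>
    AE x in M. wgrad \<Omega> p0 p (\<lambda>y. trunc k (u y)) x = indicator {y. \<bar>u y\<bar> < k} x *\<^sub>R tgrad \<Omega> p0 p u x"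
  using tgrad_spec[of u] by simp_all

text \<open>The sequence delivered by the completion need not be bounded. Since T_k is idempotent,
  truncating its members once more approximates the same function and adds the bound k.\<close>

lemma T0_dom_approx:
  assumes u: "u \<in> T0 \<Omega> p0 p" and k: "k > 0"
  shows "\<exists>\<phi>. dom_approx \<phi> (\<lambda>x. trunc k (u x)) (\<lambda>x. indicator {y. \<bar>u y\<bar> < k} x *\<^sub>R tgrad \<Omega> p0 p u x) \<and>
    (\<forall>j x. \<bar>\<phi> j x\<bar> \<le> k)"
proof -
  have "(\<lambda>y. trunc k (u y)) \<in> W0 \<Omega> p0 p" using u k by (simp add: T0_def)
  then obtain \<phi> where "dom_approx \<phi> (\<lambda>y. trunc k (u y)) (wgrad \<Omega> p0 p (\<lambda>y. trunc k (u y)))"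
    using W0_imp_dom_approx by blast
  then have "dom_approx \<phi> (\<lambda>y. trunc k (u y)) (\<lambda>x. indicator {y. \<bar>u y\<bar> < k} x *\<^sub>R tgrad \<Omega> p0 p u x)"
    by (rule dom_approx_cong) (use wgrad_trunc[OF u k] in simp)
  then obtain \<phi>' where \<phi>': "dom_approx \<phi>' (\<lambda>x. trunc k (trunc k (u x)))
      (\<lambda>x. indicator {y. \<bar>trunc k (u y)\<bar> < k} x *\<^sub>R indicator {y. \<bar>u y\<bar> < k} x *\<^sub>R tgrad \<Omega> p0 p u x)"
      "\<forall>j x. \<bar>\<phi>' j x\<bar> \<le> k"
    using dom_approx_trunc[OF _ k] by blast
  have "dom_approx \<phi>' (\<lambda>x. trunc k (u x)) (\<lambda>x. indicator {y. \<bar>u y\<bar> < k} x *\<^sub>R tgrad \<Omega> p0 p u x)"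
    by (rule dom_approx_cong[OF \<phi>'(1)])
      (auto simp: trunc_trunc[OF k order_refl] abs_trunc_less_iff[OF k order_refl] indicator_def)
  with \<phi>'(2) show ?thesis by blast
qed

lemma dom_approx_diff:
  assumes da: "dom_approx \<phi> v g" and db: "dom_approx \<psi> w h"
  shows "dom_approx (\<lambda>j x. \<phi> j x - \<psi> j x) (\<lambda>x. v x - w x) (\<lambda>x. g x - h x)"
proof -
  obtain E where E: "\<And>j. \<phi> j \<in> C0_infty \<Omega>" "integrable M E"
    "AE x in M. x \<in> \<Omega> \<and> dominated \<phi> v g E x"
    using dom_approxD[OF da] by blast
  obtain D where D: "\<And>j. \<psi> j \<in> C0_infty \<Omega>" "integrable M D"
    "AE x in M. x \<in> \<Omega> \<and> dominated \<psi> w h D x"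
    using dom_approxD[OF db] by blast
  have tj: "tjet (\<lambda>x. \<phi> j x - \<psi> j x) c x = tjet (\<phi> j) c x - tjet (\<psi> j) c x" for j c x
  proof (cases c)
    case (Some i)
    have "frechet_derivative (\<lambda>x. \<phi> j x - \<psi> j x) (at x)
      = (\<lambda>h. frechet_derivative (\<phi> j) (at x) h - frechet_derivative (\<psi> j) (at x) h)"
      by (rule frechet_derivative_eqI, rule has_derivative_diff)
        (intro C_1_has_derivative C0_infty_C1 E(1) D(1))+
    then show ?thesis using Some by (simp add: grad_def)
  qed simp
  have jt: "jet (\<lambda>x. v x - w x) (\<lambda>x. g x - h x) c x = jet v g c x - jet w h c x" for c x
    by (cases c) auto
  show ?thesis unfolding dom_approx_def
  proof (intro conjI allI exI[of _ "\<lambda>x. 2 powr pmax * (E x + D x)"])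
    show "(\<lambda>x. \<phi> j x - \<psi> j x) \<in> C0_infty \<Omega>" for j
      using C0_infty_add[OF E(1) C0_infty_uminus[OF D(1)]] by simp
    show "integrable M (\<lambda>x. 2 powr pmax * (E x + D x))"
      by (intro integrable_mult_right Bochner_Integration.integrable_add E(2) D(2))
    show "AE x in M. \<forall>c. (\<lambda>j. tjet (\<lambda>x. \<phi> j x - \<psi> j x) c x) \<longlonglongrightarrow> jet (\<lambda>x. v x - w x) (\<lambda>x. g x - h x) c x \<and>
        (\<forall>j. \<bar>tjet (\<lambda>x. \<phi> j x - \<psi> j x) c x\<bar> powr ex c x \<le> 2 powr pmax * (E x + D x))"
      using E(3) D(3)
    proof eventually_elim
      case (elim x)
      show ?case unfolding tj jt
      proof (intro allI conjI)
        fix c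
        show "(\<lambda>j. tjet (\<phi> j) c x - tjet (\<psi> j) c x) \<longlonglongrightarrow> jet v g c x - jet w h c x"
          using elim by (intro tendsto_diff) blast+
        fix j
        have "\<bar>tjet (\<phi> j) c x - tjet (\<psi> j) c x\<bar> powr ex c x \<le> 2 powr pmax * (\<bar>tjet (\<phi> j) c x\<bar> powr ex c x + \<bar>tjet (\<psi> j) c x\<bar> powr ex c x)"
          by (rule powr_abs_diff_le) (use elim ex_bounds[of x c] in auto)
        also have "\<dots> \<le> 2 powr pmax * (E x + D x)"
        proof (intro mult_left_mono add_mono)
          show "\<bar>tjet (\<phi> j) c x\<bar> powr ex c x \<le> E x" using elim by blast
          show "\<bar>tjet (\<psi> j) c x\<bar> powr ex c x \<le> D x" using elim by blast
        qed simp
        finally show "\<bar>tjet (\<phi> j) c x - tjet (\<psi> j) c x\<bar> powr ex c x \<le> 2 powr pmax * (E x + D x)" .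
      qed
    qed
  qed
qed

lemma dom_approx_const:
  assumes \<xi>: "\<xi> \<in> C0_infty \<Omega>"
  shows "dom_approx (\<lambda>_. \<xi>) \<xi> (grad \<xi>)"
  unfolding dom_approx_def
proof (intro conjI allI exI[of _ "\<lambda>x. \<Sum>c\<in>UNIV. \<bar>tjet \<xi> c x\<bar> powr ex c x"] \<xi>)
  show "integrable M (\<lambda>x. \<Sum>c\<in>UNIV. \<bar>tjet \<xi> c x\<bar> powr ex c x)"
    by (intro Bochner_Integration.integrable_sum tjet_integrable \<xi>)
  show "AE x in M. \<forall>c. (\<lambda>j::nat. tjet \<xi> c x) \<longlonglongrightarrow> tjet \<xi> c x \<and>
      (\<forall>j::nat. \<bar>tjet \<xi> c x\<bar> powr ex c x \<le> (\<Sum>c\<in>UNIV. \<bar>tjet \<xi> c x\<bar> powr ex c x))"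
    by (intro AE_I2 allI conjI tendsto_const member_le_sum) auto
qed

text \<open>u itself need not belong to the space, but T_N(u) does, and N = k + sup |\<xi>| is so
  large that the outer truncation does not notice the inner one.\<close>

lemma wgrad_trunc_diff:
  assumes u: "u \<in> T0 \<Omega> p0 p" and k: "k > 0" and \<xi>: "\<xi> \<in> C0_infty \<Omega>"
  shows "AE x in M. wgrad \<Omega> p0 p (\<lambda>y. trunc k (u y - \<xi> y)) x
    = indicator {y. \<bar>u y - \<xi> y\<bar> < k} x *\<^sub>R (tgrad \<Omega> p0 p u x - grad \<xi> x)"
proof -
  obtain B where B: "\<And>x. \<bar>\<xi> x\<bar> \<le> B" using tjet_test(2)[OF \<xi>, of None] by auto
  define N where "N = k + B"
  have kN: "k + \<bar>\<xi> x\<bar> \<le> N" for x using B[of x] by (simp add: N_def)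
  have N: "N > 0" using kN[of 0] k by linarith
  obtain \<phi> where "dom_approx \<phi> (\<lambda>x. trunc N (u x)) (\<lambda>x. indicator {y. \<bar>u y\<bar> < N} x *\<^sub>R tgrad \<Omega> p0 p u x)"
    using T0_dom_approx[OF u N] by blast
  from dom_approx_diff[OF this dom_approx_const[OF \<xi>]]
  obtain \<phi>' where "dom_approx \<phi>' (\<lambda>x. trunc k (trunc N (u x) - \<xi> x))
      (\<lambda>x. indicator {y. \<bar>trunc N (u y) - \<xi> y\<bar> < k} x *\<^sub>R (indicator {y. \<bar>u y\<bar> < N} x *\<^sub>R tgrad \<Omega> p0 p u x - grad \<xi> x))"
    using dom_approx_trunc[OF _ k] by blast
  from wgrad_eq_AE[OF this]
  have "AE x in M. wgrad \<Omega> p0 p (\<lambda>y. trunc k (u y - \<xi> y)) x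
    = indicator {y. \<bar>u y - \<xi> y\<bar> < k} x *\<^sub>R (indicator {y. \<bar>u y\<bar> < N} x *\<^sub>R tgrad \<Omega> p0 p u x - grad \<xi> x)"
    unfolding trunc_diff_trunc[OF k kN] .
  then show ?thesis
  proof eventually_elim
    case (elim x)
    show ?case
    proof (cases "\<bar>u x - \<xi> x\<bar> < k")
      case True
      then have "\<bar>u x\<bar> < N" using kN[of x] by linarith
      then show ?thesis using elim by simp
    qed (use elim in simp)
  qed
qed

end

subsection \<open>The entropy inequality\<close>

lemma measurable_indicator_pred:
  "{x \<in> space N. P x} \<in> sets N \<Longrightarrow> (\<lambda>x. indicator {y. P y} x :: real) \<in> borel_measurable N"
proof -
  assume "{x \<in> space N. P x} \<in> sets N"
  then have "(\<lambda>x. if P x then 1 else 0 :: real) \<in> borel_measurable N" by (intro measurable_If) auto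
  moreover have "(\<lambda>x. indicator {y. P y} x :: real) = (\<lambda>x. if P x then 1 else 0)"
    by (auto simp: indicator_def)
  ultimately show ?thesis by simp
qed

text \<open>Young's inequality with both constants replaced by 1: comparing x with y powr (q - 1)
  bounds the product by just one of the two powers.\<close>

lemma young_powr:
  fixes x y q :: real
  assumes "1 < q" "0 \<le> x" "0 \<le> y"
  shows "x * y \<le> x powr (q / (q - 1)) + y powr q"
proof (cases "x \<le> y powr (q - 1)")
  case True
  then have "x * y \<le> y powr (q - 1) * y" by (rule mult_right_mono) (rule assms)
  also have "\<dots> = y powr q"
    using assms(1,3) powr_add[of y "q - 1" 1] by (cases "y = 0") (auto simp: powr_one)
  finally show ?thesis using powr_ge_zero[of x "q / (q - 1)"] by linarith
next
  case False
  then have "x > 0" using powr_ge_zero[of y "q - 1"] by linarith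
  have "y = (y powr (q - 1)) powr (1 / (q - 1))" using assms by (simp add: powr_powr)
  also have "\<dots> \<le> x powr (1 / (q - 1))" by (rule powr_mono2) (use False assms in auto)
  finally have "x * y \<le> x * x powr (1 / (q - 1))" by (rule mult_left_mono) (rule assms)
  also have "\<dots> = x powr (1 + 1 / (q - 1))" using \<open>x > 0\<close> by (simp add: powr_add)
  also have "1 + 1 / (q - 1) = q / (q - 1)" using assms by (simp add: field_simps)
  finally show ?thesis using powr_ge_zero[of y q] by linarith
qed

text \<open>The product is at most the q-th power of the larger of |u| and |t|.\<close>

lemma powr_minus_2_mult:
  fixes u t q :: real
  assumes "1 < q"
  shows "\<bar>\<bar>u\<bar> powr (q - 2) * u\<bar> * \<bar>t\<bar> \<le> \<bar>u\<bar> powr q + \<bar>t\<bar> powr q"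
proof (cases "u = 0")
  case False
  have e: "\<bar>\<bar>u\<bar> powr (q - 2) * u\<bar> = \<bar>u\<bar> powr (q - 1)"
    using False powr_add[of "\<bar>u\<bar>" "q - 2" 1] by (simp add: abs_mult)
  define m where "m = max \<bar>u\<bar> \<bar>t\<bar>"
  have m: "\<bar>u\<bar> \<le> m" "\<bar>t\<bar> \<le> m" "m > 0" using False by (auto simp: m_def)
  have "\<bar>u\<bar> powr (q - 1) * \<bar>t\<bar> \<le> m powr (q - 1) * m"
    by (rule mult_mono) (use m assms in \<open>auto intro: powr_mono2\<close>)
  also have "\<dots> = m powr q" using m powr_add[of m "q - 1" 1] by simp
  also have "\<dots> \<le> \<bar>u\<bar> powr q + \<bar>t\<bar> powr q" by (auto simp: m_def max_def)
  finally show ?thesis unfolding e .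
qed simp

text \<open>If |c| \<le> |s|, subtracting c cannot reverse the sign of s. This is the source of
  every sign argument for the zero-order term.\<close>

lemma trunc_sign: "\<bar>c\<bar> \<le> \<bar>s\<bar> \<Longrightarrow> 0 < k \<Longrightarrow> 0 \<le> s * trunc k (s - c)"
proof -
  assume c: "\<bar>c\<bar> \<le> \<bar>s\<bar>" and k: "0 < k"
  show ?thesis
  proof (cases "s \<ge> 0")
    case True
    then have "0 \<le> trunc k (s - c)" using c k by (auto simp: trunc_def)
    then show ?thesis using True by simp
  next
    case False
    then have "trunc k (s - c) \<le> 0" using c k by (auto simp: trunc_def)
    then show ?thesis using False by (simp add: mult_nonpos_nonpos)
  qed
qed

lemma abs_trunc_le_abs: "0 \<le> k \<Longrightarrow> \<bar>trunc k s\<bar> \<le> \<bar>s\<bar>"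
  by (auto simp: trunc_def)

lemma isCont_trunc: "isCont (trunc k) s"
  using continuous_trunc[of UNIV k] by (simp add: continuous_on_eq_continuous_at)

locale entropy_setting = exponents \<Omega> p0 p
  for \<Omega> :: "(real^'n) set" and p0 :: "real^'n \<Rightarrow> real" and p :: "'n \<Rightarrow> real^'n \<Rightarrow> real" +
  fixes a :: "real^'n \<Rightarrow> real \<Rightarrow> real^'n \<Rightarrow> real^'n" and b :: "real^'n \<Rightarrow> real \<Rightarrow> real^'n \<Rightarrow> real"
    and f u :: "real^'n \<Rightarrow> real"
    and \<Phi> :: "'n \<Rightarrow> real^'n \<Rightarrow> real" and \<phi>a :: "real^'n \<Rightarrow> real" and ahat :: "'n \<Rightarrow> real \<Rightarrow> real" and abar :: real
  assumes f: "integrable (lebesgue_on \<Omega>) f"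
    and cara: "\<And>i. caratheodory \<Omega> (\<lambda>x s0 s. a x s0 s $ i)"
    and \<Phi>: "\<And>i. \<Phi> i \<in> Lp_var \<Omega> (conj_exp (p i))" "\<And>i x. x \<in> \<Omega> \<Longrightarrow> 0 \<le> \<Phi> i x"
    and \<phi>a: "integrable (lebesgue_on \<Omega>) \<phi>a" "\<And>x. x \<in> \<Omega> \<Longrightarrow> 0 \<le> \<phi>a x"
    and ahat: "\<And>i. mono_on {0..} (ahat i)" "\<And>i r. r \<ge> 0 \<Longrightarrow> 0 < ahat i r"
    and abar: "abar > 0"
    and growth: "AE x in lebesgue_on \<Omega>. \<forall>s0 s i. \<bar>a x s0 s $ i\<bar>
      \<le> ahat i \<bar>s0\<bar> * (Pfun p x s powr (1 / conj_exp (p i) x) + \<Phi> i x)"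
    and coercive: "AE x in lebesgue_on \<Omega>. \<forall>s0 s. a x s0 s \<bullet> s \<ge> abar * Pfun p x s - \<phi>a x"
    and entropy: "entropy_solution \<Omega> p0 p a b f u"
begin

definition U :: "real^'n \<Rightarrow> real^'n" where "U = tgrad \<Omega> p0 p u"
definition au :: "real^'n \<Rightarrow> real^'n" where "au x = a x (u x) (U x)"
definition bu :: "real^'n \<Rightarrow> real" where "bu x = b x (u x) (U x)"
text \<open>Kept apart from \<open>bu\<close> and \<open>f\<close>: those are integrable, whereas
  this term is handled through its product with a truncation, by a modular bound for small |u| and
  by sign for large |u|.\<close>

definition z :: "real^'n \<Rightarrow> real" where "z x = \<bar>u x\<bar> powr (p0 x - 2) * u x"

lemma uT0: "u \<in> T0 \<Omega> p0 p"
  using entropy by (simp add: entropy_solution_def)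

lemma u_measurable [measurable]: "u \<in> borel_measurable M"
  using uT0 by (simp add: T0_def)

lemma U_measurable [measurable]: "U \<in> borel_measurable M"
  unfolding U_def by (rule tgrad_measurable[OF uT0])

lemma Ui_measurable [measurable]: "(\<lambda>x. U x $ i) \<in> borel_measurable M"
proof -
  have "(\<lambda>x. U x \<bullet> axis i 1) \<in> borel_measurable M" by measurable
  then show ?thesis by (simp add: inner_axis)
qed

lemma au_measurable [measurable]: "au \<in> borel_measurable M"
  unfolding au_def
  by (rule measurable_vec_componentwise) (rule measurable_caratheodory[OF \<Omega>(1) cara u_measurable U_measurable])

lemma bu_integrable: "integrable M bu"
  using entropy by (simp add: entropy_solution_def L1_def bu_def[abs_def] U_def)

lemma p_measurable [measurable]: "p i \<in> borel_measurable M"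
  and p0_measurable [measurable]: "p0 \<in> borel_measurable M"
  using ex_measurable[of "Some i"] ex_measurable[of None] by simp_all

lemma bu_measurable [measurable]: "bu \<in> borel_measurable M" and f_measurable [measurable]: "f \<in> borel_measurable M"
  and \<phi>a_measurable [measurable]: "\<phi>a \<in> borel_measurable M"
  using bu_integrable f \<phi>a(1) by auto

lemma z_measurable [measurable]: "z \<in> borel_measurable M"
  unfolding z_def by measurable

lemma Pfun_measurable [measurable]: "(\<lambda>x. Pfun p x (U x)) \<in> borel_measurable M"
  unfolding Pfun_def by measurable

lemma Pfun_nonneg: "0 \<le> Pfun p x s"
  unfolding Pfun_def by (intro sum_nonneg) auto

lemma integrable_u_powr:
  assumes N: "N > 0"
  shows "integrable M (\<lambda>x. indicator {y. \<bar>u y\<bar> < N} x * \<bar>u x\<bar> powr p0 x)"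
proof -
  obtain \<phi> where "dom_approx \<phi> (\<lambda>x. trunc N (u x)) (\<lambda>x. indicator {y. \<bar>u y\<bar> < N} x *\<^sub>R tgrad \<Omega> p0 p u x)"
    using T0_dom_approx[OF uT0 N] by blast
  from dom_approx_Lp(2)[OF this, of None] have "integrable M (\<lambda>x. \<bar>trunc N (u x)\<bar> powr p0 x)" by simp
  then show ?thesis
  proof (rule Bochner_Integration.integrable_bound)
    show "(\<lambda>x. indicator {y. \<bar>u y\<bar> < N} x * \<bar>u x\<bar> powr p0 x) \<in> borel_measurable M"
      by (intro borel_measurable_times measurable_indicator_pred) measurable
    show "AE x in M. norm (indicator {y. \<bar>u y\<bar> < N} x * \<bar>u x\<bar> powr p0 x) \<le> norm (\<bar>trunc N (u x)\<bar> powr p0 x)"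
      by (rule AE_I2) (auto simp: indicator_def trunc_eq(3))
  qed
qed

lemma integrable_Pfun:
  assumes N: "N > 0"
  shows "integrable M (\<lambda>x. indicator {y. \<bar>u y\<bar> < N} x * Pfun p x (U x))"
proof -
  obtain \<phi> where \<phi>: "dom_approx \<phi> (\<lambda>x. trunc N (u x)) (\<lambda>x. indicator {y. \<bar>u y\<bar> < N} x *\<^sub>R tgrad \<Omega> p0 p u x)"
    using T0_dom_approx[OF uT0 N] by blast
  have "integrable M (\<lambda>x. \<bar>indicator {y. \<bar>u y\<bar> < N} x * U x $ i\<bar> powr p i x)" for i
    using dom_approx_Lp(2)[OF \<phi>, of "Some i"] by (simp add: U_def)
  then have "integrable M (\<lambda>x. \<Sum>i\<in>UNIV. \<bar>indicator {y. \<bar>u y\<bar> < N} x * U x $ i\<bar> powr p i x)"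
    by (intro Bochner_Integration.integrable_sum)
  moreover have "(\<lambda>x. \<Sum>i\<in>UNIV. \<bar>indicator {y. \<bar>u y\<bar> < N} x * U x $ i\<bar> powr p i x)
      = (\<lambda>x. indicator {y. \<bar>u y\<bar> < N} x * Pfun p x (U x))"
    by (auto simp: Pfun_def indicator_def fun_eq_iff)
  ultimately show ?thesis by simp
qed

lemma integrable_Phi: "integrable M (\<lambda>x. \<bar>\<Phi> i x\<bar> powr conj_exp (p i) x)"
  using \<Phi>(1)[of i] by (simp add: Lp_var_def)

text \<open>The majorant of the flux term on {|u| < N}. The factor 2 counts two uses of Young's
  inequality, one for the P-part and one for \<Phi>.\<close>

definition gbound :: "real \<Rightarrow> real^'n \<Rightarrow> real^'n \<Rightarrow> real" where
  "gbound N x D = (\<Sum>i\<in>UNIV. ahat i N * (Pfun p x (U x) + \<bar>\<Phi> i x\<bar> powr conj_exp (p i) x + 2 * \<bar>D $ i\<bar> powr p i x))"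

text \<open>Growth combined with Young's inequality: raising P powr (1 / p') to the conjugate power
  p' returns P. The quantifiers over N and D stand inside the almost everywhere statement because D
  will be a gradient depending on x and on the approximation index.\<close>

lemma au_inner_bound:
  "AE x in M. \<forall>N D. \<bar>u x\<bar> < N \<longrightarrow> \<bar>au x \<bullet> D\<bar> \<le> gbound N x D"
  using growth AE_in_\<Omega>
proof eventually_elim
  case (elim x)
  show ?case
  proof (intro allI impI)
    fix N D assume N: "\<bar>u x\<bar> < N"
    have "\<bar>au x \<bullet> D\<bar> \<le> (\<Sum>i\<in>UNIV. \<bar>au x $ i * D $ i\<bar>)"
      unfolding inner_vec_def by (rule order_trans[OF sum_abs]) simp
    also have "\<dots> \<le> gbound N x D" unfolding gbound_def
    proof (rule sum_mono)
      fix i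
      have q: "1 < p i x" using ex_bounds(1)[OF elim(2), of "Some i"] by simp
      define P where "P = Pfun p x (U x)"
      have P: "0 \<le> P" unfolding P_def by (rule Pfun_nonneg)
      have "ahat i \<bar>u x\<bar> \<le> ahat i N" using N by (intro mono_onD[OF ahat(1)]) auto
      moreover have "0 \<le> P powr (1 / conj_exp (p i) x) + \<Phi> i x" using \<Phi>(2)[OF elim(2), of i] by simp
      ultimately have "\<bar>au x $ i\<bar> \<le> ahat i N * (P powr (1 / conj_exp (p i) x) + \<Phi> i x)"
        using elim(1) unfolding au_def P_def by (meson mult_right_mono order_trans)
      then have "\<bar>au x $ i\<bar> * \<bar>D $ i\<bar> \<le> ahat i N * (P powr (1 / conj_exp (p i) x) + \<Phi> i x) * \<bar>D $ i\<bar>"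
        by (rule mult_right_mono) simp
      also have "\<dots> = ahat i N * (P powr (1 / conj_exp (p i) x) * \<bar>D $ i\<bar> + \<Phi> i x * \<bar>D $ i\<bar>)"
        by (simp add: algebra_simps)
      also have "\<dots> \<le> ahat i N * ((P + \<bar>D $ i\<bar> powr p i x) + (\<bar>\<Phi> i x\<bar> powr conj_exp (p i) x + \<bar>D $ i\<bar> powr p i x))"
      proof (intro mult_left_mono add_mono)
        have "(P powr (1 / conj_exp (p i) x)) powr (p i x / (p i x - 1)) = P"
          using P q by (simp add: powr_powr conj_exp_def)
        then show "P powr (1 / conj_exp (p i) x) * \<bar>D $ i\<bar> \<le> P + \<bar>D $ i\<bar> powr p i x"
          using young_powr[OF q, of "P powr (1 / conj_exp (p i) x)" "\<bar>D $ i\<bar>"] by simp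
        show "\<Phi> i x * \<bar>D $ i\<bar> \<le> \<bar>\<Phi> i x\<bar> powr conj_exp (p i) x + \<bar>D $ i\<bar> powr p i x"
          using young_powr[OF q, of "\<Phi> i x" "\<bar>D $ i\<bar>"] \<Phi>(2)[OF elim(2), of i] by (simp add: conj_exp_def)
        show "0 \<le> ahat i N" using N by (intro less_imp_le ahat(2)) linarith
      qed
      finally show "\<bar>au x $ i * D $ i\<bar> \<le> ahat i N * (Pfun p x (U x) + \<bar>\<Phi> i x\<bar> powr conj_exp (p i) x + 2 * \<bar>D $ i\<bar> powr p i x)"
        by (simp add: abs_mult P_def algebra_simps)
    qed
    finally show "\<bar>au x \<bullet> D\<bar> \<le> gbound N x D" .
  qed
qed

text \<open>Replaces the abstractly chosen gradient of the truncated difference by an explicit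
  expression in which limits can be taken.\<close>

lemma entropy_test:
  assumes k: "k > 0" and \<xi>: "\<xi> \<in> C0_infty \<Omega>"
  defines "F \<equiv> \<lambda>x. (bu x + z x + f x) * trunc k (u x - \<xi> x)"
    and "G \<equiv> \<lambda>x. indicator {y. \<bar>u y - \<xi> y\<bar> < k} x * (au x \<bullet> (U x - grad \<xi> x))"
  shows "integrable M F" "integrable M G" "integral\<^sup>L M F + integral\<^sup>L M G \<le> 0"
proof -
  define G' where "G' x = au x \<bullet> wgrad \<Omega> p0 p (\<lambda>y. trunc k (u y - \<xi> y)) x" for x
  have e: "integrable M F \<and> integrable M G' \<and> integral\<^sup>L M F + integral\<^sup>L M G' \<le> 0"
    using entropy k C0_infty_imp_C0_1[OF \<xi>]
    unfolding entropy_solution_def Let_def F_def G'_def au_def bu_def z_def U_def L1_def by simp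
  have GG': "AE x in M. G' x = G x"
    using wgrad_trunc_diff[OF uT0 k \<xi>] by eventually_elim (simp add: G'_def G_def U_def)
  have [measurable]: "\<xi> \<in> borel_measurable M"
    using tjet_measurable[OF C0_infty_C1[OF \<xi>], of None] by simp
  have [measurable]: "grad \<xi> \<in> borel_measurable M"
    by (rule measurable_vec_componentwise) (use tjet_measurable[OF C0_infty_C1[OF \<xi>], of "Some _"] in simp)
  have Gm: "G \<in> borel_measurable M" unfolding G_def
    by (intro borel_measurable_times measurable_indicator_pred) measurable
  have G'm: "G' \<in> borel_measurable M" using e by auto
  show "integrable M F" using e by blast
  show "integrable M G" using e integrable_cong_AE[OF G'm Gm GG'] by blast
  show "integral\<^sup>L M F + integral\<^sup>L M G \<le> 0" using e integral_cong_AE[OF G'm Gm GG'] by simp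
qed

text \<open>Where \<open>|u| \<ge> B\<close> the product of \<open>z\<close> with the truncation is nonnegative.  This part need not be
  integrable uniformly in the approximating test functions, and it is dropped before the limit.\<close>

lemma entropy_test_dom_approx:
  assumes k: "k > 0" and da: "dom_approx \<xi>s \<xi> g\<xi>" and B: "B > 0" "\<And>j x. \<bar>\<xi>s j x\<bar> \<le> B"
  defines "F \<equiv> \<lambda>x. (bu x + f x + indicator {y. \<bar>u y\<bar> < B} x * z x) * trunc k (u x - \<xi> x)"
    and "G \<equiv> \<lambda>x. indicator {y. \<bar>u y - \<xi> y\<bar> < k} x * (au x \<bullet> (U x - g\<xi> x))"
  shows "integrable M F" "integrable M G" "integral\<^sup>L M F + integral\<^sup>L M G \<le> 0"
proof -
  obtain E where E: "\<And>j. \<xi>s j \<in> C0_infty \<Omega>" "integrable M E"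
    "AE x in M. x \<in> \<Omega> \<and> dominated \<xi>s \<xi> g\<xi> E x"
    using dom_approxD[OF da] by blast
  \<comment> \<open>If |u - \<xi>| \<le> k and |\<xi>| \<le> B, then |u| \<le> k + B; the additional
    1 makes this strictly less than N also on the boundary set |u - \<xi>| = k.\<close>
  define N where "N = k + B + 1"
  have N: "N > 0" "k + B < N" using k B by (auto simp: N_def)
  have \<xi>sm [measurable]: "\<xi>s j \<in> borel_measurable M" for j
    using tjet_measurable[OF C0_infty_C1[OF E(1)], of j None] by simp
  have [measurable]: "grad (\<xi>s j) \<in> borel_measurable M" for j
    by (rule measurable_vec_componentwise) (use tjet_measurable[OF C0_infty_C1[OF E(1)], of j "Some _"] in simp)
  have \<xi>m [measurable]: "\<xi> \<in> borel_measurable M" using dom_approx_Lp(1)[OF da, of None] by simp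
  have [measurable]: "g\<xi> \<in> borel_measurable M"
    by (rule measurable_vec_componentwise) (use dom_approx_Lp(1)[OF da, of "Some _"] in simp)
  have tm [measurable]: "trunc k \<in> borel_measurable borel"
    by (rule borel_measurable_continuous_onI[OF continuous_trunc])
  define Fj where "Fj j x = (bu x + f x + indicator {y. \<bar>u y\<bar> < B} x * z x) * trunc k (u x - \<xi>s j x)" for j x
  define Gj where "Gj j x = indicator {y. \<bar>u y - \<xi>s j y\<bar> < k} x * (au x \<bullet> (U x - grad (\<xi>s j) x))" for j x
  have Bm [measurable]: "(\<lambda>x. indicator {y. \<bar>u y\<bar> < r} x :: real) \<in> borel_measurable M" for r
    by (rule measurable_indicator_pred) measurable
  have Fm: "F \<in> borel_measurable M" and Fjm: "Fj j \<in> borel_measurable M" for j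
    unfolding F_def Fj_def by measurable
  have Gm: "G \<in> borel_measurable M" and Gjm: "Gj j \<in> borel_measurable M" for j
    unfolding G_def Gj_def by (intro borel_measurable_times measurable_indicator_pred; measurable)+
  \<comment> \<open>Even on {|u| < B} the function z need not be integrable. Its product with the
    truncation is bounded by powers of |u| and of |u - \<xi>|, and these have the modulars of a
    truncation and of the test functions as majorants.\<close>
  define W where "W x = k * \<bar>bu x\<bar> + k * \<bar>f x\<bar> + indicator {y. \<bar>u y\<bar> < B} x * \<bar>u x\<bar> powr p0 x
      + 2 powr pmax * (indicator {y. \<bar>u y\<bar> < B} x * \<bar>u x\<bar> powr p0 x + E x)" for x
  have Wint: "integrable M W" unfolding W_def
    by (intro Bochner_Integration.integrable_add integrable_mult_right integrable_abs bu_integrable f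
        integrable_u_powr B E)
  have Fbound: "AE x in M. norm (Fj j x) \<le> W x" for j
    using E(3)
  proof eventually_elim
    case (elim x)
    have q: "1 < p0 x" "p0 x \<le> pmax" using ex_bounds[of x None] elim by auto
    have tk: "\<bar>trunc k (u x - \<xi>s j x)\<bar> \<le> k" using k by (intro abs_trunc_le) simp
    have E0: "\<bar>\<xi>s j x\<bar> powr p0 x \<le> E x" using elim by (metis ex_simps(1) jet_simps(1))
    have 1: "\<bar>bu x * trunc k (u x - \<xi>s j x)\<bar> \<le> k * \<bar>bu x\<bar>" "\<bar>f x * trunc k (u x - \<xi>s j x)\<bar> \<le> k * \<bar>f x\<bar>"
      using mult_left_mono[OF tk, of "\<bar>bu x\<bar>"] mult_left_mono[OF tk, of "\<bar>f x\<bar>"] by (simp_all add: abs_mult mult.commute)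
    have 2: "\<bar>z x\<bar> * \<bar>trunc k (u x - \<xi>s j x)\<bar> \<le> \<bar>u x\<bar> powr p0 x + 2 powr pmax * (\<bar>u x\<bar> powr p0 x + E x)"
    proof -
      have "\<bar>trunc k (u x - \<xi>s j x)\<bar> powr p0 x \<le> \<bar>u x - \<xi>s j x\<bar> powr p0 x"
        by (rule powr_mono2) (use q k abs_trunc_le_abs in auto)
      also have "\<dots> \<le> 2 powr pmax * (\<bar>u x\<bar> powr p0 x + \<bar>\<xi>s j x\<bar> powr p0 x)"
        by (rule powr_abs_diff_le) (use q in auto)
      also have "\<dots> \<le> 2 powr pmax * (\<bar>u x\<bar> powr p0 x + E x)"
        using E0 by (intro mult_left_mono) auto
      finally show ?thesis
        using powr_minus_2_mult[OF q(1), of "u x" "trunc k (u x - \<xi>s j x)"] unfolding z_def by linarith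
    qed
    have Ege: "0 \<le> E x" by (rule order_trans[OF powr_ge_zero E0])
    have 3: "\<bar>indicator {y. \<bar>u y\<bar> < B} x * z x * trunc k (u x - \<xi>s j x)\<bar>
      \<le> indicator {y. \<bar>u y\<bar> < B} x * \<bar>u x\<bar> powr p0 x
        + 2 powr pmax * (indicator {y. \<bar>u y\<bar> < B} x * \<bar>u x\<bar> powr p0 x + E x)"
      using 2 Ege by (cases "\<bar>u x\<bar> < B") (simp_all add: abs_mult)
    have "norm (Fj j x) \<le> \<bar>bu x * trunc k (u x - \<xi>s j x)\<bar> + \<bar>f x * trunc k (u x - \<xi>s j x)\<bar>
      + \<bar>indicator {y. \<bar>u y\<bar> < B} x * z x * trunc k (u x - \<xi>s j x)\<bar>"
      unfolding Fj_def real_norm_def distrib_right by linarith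
    then show ?case using 1 3 unfolding W_def by linarith
  qed
  have Flim: "AE x in M. (\<lambda>j. Fj j x) \<longlonglongrightarrow> F x"
    using E(3)
  proof eventually_elim
    case (elim x)
    then have "(\<lambda>j. tjet (\<xi>s j) None x) \<longlonglongrightarrow> jet \<xi> g\<xi> None x" by blast
    then have "(\<lambda>j. u x - \<xi>s j x) \<longlonglongrightarrow> u x - \<xi> x" by (intro tendsto_diff tendsto_const) simp
    then show ?case unfolding Fj_def F_def
      by (intro tendsto_mult tendsto_const isCont_tendsto_compose[OF isCont_trunc])
  qed
  have Fjint: "integrable M (Fj j)" for j
    by (rule Bochner_Integration.integrable_bound[OF Wint Fjm]) (use Fbound[of j] in eventually_elim, simp)
  define V where "V x = (\<Sum>i\<in>UNIV. ahat i N * (indicator {y. \<bar>u y\<bar> < N} x * Pfun p x (U x) + \<bar>\<Phi> i x\<bar> powr conj_exp (p i) x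
      + 2 * (2 powr pmax * (indicator {y. \<bar>u y\<bar> < N} x * Pfun p x (U x) + E x))))" for x
  have Vint: "integrable M V" unfolding V_def
    by (intro Bochner_Integration.integrable_sum Bochner_Integration.integrable_add integrable_mult_right
        integrable_Pfun N integrable_Phi E)
  have Gbound: "AE x in M. norm (Gj j x) \<le> V x" for j
    using E(3) au_inner_bound
  proof eventually_elim
    case (elim x)
    have E0: "\<bar>grad (\<xi>s j) x $ i\<bar> powr p i x \<le> E x" for i using elim(1) by (metis ex_simps(2) jet_simps(2))
    have Ege: "0 \<le> E x" by (rule order_trans[OF powr_ge_zero E0])
    have aN: "0 \<le> ahat i N" for i using N by (intro less_imp_le ahat(2)) simp
    show ?case
    proof (cases "\<bar>u x - \<xi>s j x\<bar> < k")
      case True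
      then have uN: "\<bar>u x\<bar> < N" using B(2)[of j x] N by linarith
      have "\<bar>au x \<bullet> (U x - grad (\<xi>s j) x)\<bar> \<le> gbound N x (U x - grad (\<xi>s j) x)"
        using elim(2) uN by blast
      also have "\<dots> \<le> V x" unfolding gbound_def V_def
      proof (rule sum_mono, rule mult_left_mono[OF _ aN])
        fix i
        have q: "0 \<le> p i x" "p i x \<le> pmax" using ex_bounds[of x "Some i"] elim(1) by auto
        have "\<bar>(U x - grad (\<xi>s j) x) $ i\<bar> powr p i x \<le> 2 powr pmax * (\<bar>U x $ i\<bar> powr p i x + \<bar>grad (\<xi>s j) x $ i\<bar> powr p i x)"
          using powr_abs_diff_le[OF q] by simp
        also have "\<dots> \<le> 2 powr pmax * (Pfun p x (U x) + E x)"
        proof (intro mult_left_mono add_mono E0)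
          show "\<bar>U x $ i\<bar> powr p i x \<le> Pfun p x (U x)" unfolding Pfun_def by (rule member_le_sum) auto
        qed simp
        finally show "Pfun p x (U x) + \<bar>\<Phi> i x\<bar> powr conj_exp (p i) x + 2 * \<bar>(U x - grad (\<xi>s j) x) $ i\<bar> powr p i x
          \<le> indicator {y. \<bar>u y\<bar> < N} x * Pfun p x (U x) + \<bar>\<Phi> i x\<bar> powr conj_exp (p i) x
            + 2 * (2 powr pmax * (indicator {y. \<bar>u y\<bar> < N} x * Pfun p x (U x) + E x))"
          using uN by simp
      qed
      finally show ?thesis using True by (simp add: Gj_def)
    next
      case False
      have "0 \<le> V x" unfolding V_def
        by (intro sum_nonneg mult_nonneg_nonneg add_nonneg_nonneg aN Pfun_nonneg Ege) auto
      then show ?thesis using False by (simp add: Gj_def)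
    qed
  qed
  \<comment> \<open>The indicator in G jumps where |u - \<xi>| = k. There T_N(u) - \<xi> equals u -
    \<xi>, so the points lie on level sets of a function of the space, where its gradient
    vanishes.\<close>
  have level: "AE x in M. \<bar>u x - \<xi> x\<bar> = k \<and> \<bar>\<xi> x\<bar> \<le> B \<longrightarrow> U x - g\<xi> x = 0"
  proof -
    obtain \<phi> where "dom_approx \<phi> (\<lambda>x. trunc N (u x)) (\<lambda>x. indicator {y. \<bar>u y\<bar> < N} x *\<^sub>R tgrad \<Omega> p0 p u x)"
      using T0_dom_approx[OF uT0 N(1)] by blast
    note d = dom_approx_gradient_level_set[OF dom_approx_diff[OF this da]]
    show ?thesis using d[of k] d[of "- k"]
    proof eventually_elim
      case (elim x)
      show ?case
      proof
        assume *: "\<bar>u x - \<xi> x\<bar> = k \<and> \<bar>\<xi> x\<bar> \<le> B"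
        then have uN: "\<bar>u x\<bar> < N" using N by linarith
        then have t: "trunc N (u x) = u x" by (intro trunc_eq(3)) simp
        have "u x - \<xi> x = k \<or> u x - \<xi> x = - k" using * by linarith
        then show "U x - g\<xi> x = 0" using elim uN unfolding t U_def by auto
      qed
    qed
  qed
  have Glim: "AE x in M. (\<lambda>j. Gj j x) \<longlonglongrightarrow> G x"
    using E(3) level
  proof eventually_elim
    case (elim x)
    have lim: "(\<lambda>j. tjet (\<xi>s j) c x) \<longlonglongrightarrow> jet \<xi> g\<xi> c x" for c using elim(1) by blast
    have l0: "(\<lambda>j. \<xi>s j x) \<longlonglongrightarrow> \<xi> x" using lim[of None] by simp
    have lg: "(\<lambda>j. grad (\<xi>s j) x) \<longlonglongrightarrow> g\<xi> x"
    proof (rule vec_tendstoI)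
      show "(\<lambda>j. grad (\<xi>s j) x $ i) \<longlonglongrightarrow> g\<xi> x $ i" for i using lim[of "Some i"] by simp
    qed
    have la: "(\<lambda>j. au x \<bullet> (U x - grad (\<xi>s j) x)) \<longlonglongrightarrow> au x \<bullet> (U x - g\<xi> x)"
      by (intro tendsto_inner tendsto_diff tendsto_const lg)
    have ld: "(\<lambda>j. \<bar>u x - \<xi>s j x\<bar>) \<longlonglongrightarrow> \<bar>u x - \<xi> x\<bar>"
      by (intro tendsto_rabs tendsto_diff tendsto_const l0)
    consider "\<bar>u x - \<xi> x\<bar> < k" | "\<bar>u x - \<xi> x\<bar> > k" | "\<bar>u x - \<xi> x\<bar> = k" by linarith
    then show ?case
    proof cases
      case 1
      have "\<forall>\<^sub>F j in sequentially. \<bar>u x - \<xi>s j x\<bar> < k" by (rule order_tendstoD(2)[OF ld 1])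
      then have "\<forall>\<^sub>F j in sequentially. au x \<bullet> (U x - grad (\<xi>s j) x) = Gj j x"
        by eventually_elim (simp add: Gj_def)
      from Lim_transform_eventually[OF la this] show ?thesis using 1 by (simp add: G_def)
    next
      case 2
      have "\<forall>\<^sub>F j in sequentially. k < \<bar>u x - \<xi>s j x\<bar>" by (rule order_tendstoD(1)[OF ld 2])
      then have "\<forall>\<^sub>F j in sequentially. Gj j x = 0" by eventually_elim (simp add: Gj_def)
      then have "(\<lambda>j. Gj j x) \<longlonglongrightarrow> 0" by (rule tendsto_eventually)
      then show ?thesis using 2 by (simp add: G_def)
    next
      case 3
      have "(\<lambda>j. \<bar>\<xi>s j x\<bar>) \<longlonglongrightarrow> \<bar>\<xi> x\<bar>" by (rule tendsto_rabs[OF l0])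
      then have "\<bar>\<xi> x\<bar> \<le> B" by (rule LIMSEQ_le_const2) (use B(2) in auto)
      then have 0: "U x - g\<xi> x = 0" using elim(2) 3 by blast
      \<comment> \<open>Whether the indicator converges is immaterial: the flux factor itself tends
        to 0.\<close>
      have "(\<lambda>j. Gj j x) \<longlonglongrightarrow> 0"
      proof (rule Lim_null_comparison)
        show "\<forall>\<^sub>F j in sequentially. norm (Gj j x) \<le> \<bar>au x \<bullet> (U x - grad (\<xi>s j) x)\<bar>"
          by (intro always_eventually allI) (simp add: Gj_def indicator_def)
        show "(\<lambda>j. \<bar>au x \<bullet> (U x - grad (\<xi>s j) x)\<bar>) \<longlonglongrightarrow> 0"
          using tendsto_rabs[OF la] unfolding 0 by simp
      qed
      then show ?thesis using 0 by (simp add: G_def)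
    qed
  qed
  show "integrable M F" by (rule integrable_dominated_convergence[OF Fm Fjm Wint Flim Fbound])
  show "integrable M G" by (rule integrable_dominated_convergence[OF Gm Gjm Vint Glim Gbound])
  have lim: "(\<lambda>j. integral\<^sup>L M (Fj j) + integral\<^sup>L M (Gj j)) \<longlonglongrightarrow> integral\<^sup>L M F + integral\<^sup>L M G"
    by (intro tendsto_add integral_dominated_convergence[OF Fm Fjm Wint Flim Fbound]
        integral_dominated_convergence[OF Gm Gjm Vint Glim Gbound])
  have "integral\<^sup>L M (Fj j) + integral\<^sup>L M (Gj j) \<le> 0" for j
  proof -
    have "integral\<^sup>L M (Fj j) \<le> (\<integral>x. (bu x + z x + f x) * trunc k (u x - \<xi>s j x) \<partial>M)"
    proof (rule Bochner_Integration.integral_mono[OF Fjint entropy_test(1)[OF k E(1)]])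
      fix x
      show "Fj j x \<le> (bu x + z x + f x) * trunc k (u x - \<xi>s j x)"
      proof (cases "\<bar>u x\<bar> < B")
        case True
        then show ?thesis by (simp add: Fj_def algebra_simps)
      next
        case False
        then have "\<bar>\<xi>s j x\<bar> \<le> \<bar>u x\<bar>" using B(2)[of j x] by linarith
        then have "0 \<le> u x * trunc k (u x - \<xi>s j x)" using k by (rule trunc_sign)
        then have "0 \<le> \<bar>u x\<bar> powr (p0 x - 2) * (u x * trunc k (u x - \<xi>s j x))"
          by (rule mult_nonneg_nonneg[OF powr_ge_zero])
        then show ?thesis using False by (simp add: Fj_def z_def algebra_simps)
      qed
    qed
    then show ?thesis using entropy_test(3)[OF k E(1), of j] unfolding Gj_def[abs_def] by linarith
  qed
  then show "integral\<^sup>L M F + integral\<^sup>L M G \<le> 0" by (intro LIMSEQ_le_const2[OF lim]) auto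
qed

end

subsection \<open>The energy estimate and the renormalized equation\<close>

lemma mollify_C1:
  fixes g :: "'a::euclidean_space \<Rightarrow> real"
  assumes \<Omega>: "open \<Omega>" and g: "g \<in> C0_1 \<Omega>"
  shows "\<exists>\<psi> K C. (\<forall>n. \<psi> n \<in> C0_infty \<Omega>) \<and> compact K \<and> (\<forall>n. supp (\<psi> n) \<subseteq> K) \<and>
    (\<forall>n x. \<bar>\<psi> n x\<bar> \<le> C) \<and> (\<forall>x. (\<lambda>n::nat. \<psi> n x) \<longlonglongrightarrow> g x) \<and>
    (\<forall>n x. \<forall>e\<in>Basis. \<bar>frechet_derivative (\<psi> n) (at x) e\<bar> \<le> C) \<and>
    (\<forall>x. \<forall>e\<in>Basis. (\<lambda>n. frechet_derivative (\<psi> n) (at x) e) \<longlonglongrightarrow> frechet_derivative g (at x) e)"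
proof -
  have g1: "C_k 1 g" "compact (supp g)" "supp g \<subseteq> \<Omega>" using g unfolding C0_1_def by blast+
  show ?thesis
  proof (rule mollify[OF \<Omega> C_k_continuous[OF g1(1)] g1(2,3)])
    fix \<psi> :: "nat \<Rightarrow> 'a \<Rightarrow> real" and K C
    assume *: "\<And>n. \<psi> n \<in> C0_infty \<Omega>" "compact K" "K \<subseteq> \<Omega>" "\<And>n. supp (\<psi> n) \<subseteq> K"
      "\<And>n x. \<bar>\<psi> n x\<bar> \<le> C" "\<And>x. (\<lambda>n. \<psi> n x) \<longlonglongrightarrow> g x"
      "C_k 1 g \<Longrightarrow> \<forall>n x. \<forall>e\<in>Basis. \<bar>frechet_derivative (\<psi> n) (at x) e\<bar> \<le> C"
      "C_k 1 g \<Longrightarrow> \<forall>x. \<forall>e\<in>Basis. (\<lambda>n. frechet_derivative (\<psi> n) (at x) e) \<longlonglongrightarrow> frechet_derivative g (at x) e"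
    show ?thesis
      by (rule exI[of _ \<psi>], rule exI[of _ K], rule exI[of _ C]) (intro conjI allI * g1(1))
  qed
qed

lemma deriv_outside_supp:
  fixes S :: "real \<Rightarrow> real"
  assumes "s \<notin> supp S" shows "deriv S s = 0"
proof (rule DERIV_imp_deriv)
  have "(*) (0::real) = (\<lambda>_. 0)" by auto
  then show "(S has_field_derivative 0) (at s)"
    using has_derivative_zero_outside_supp[OF assms] by (simp add: has_field_derivative_def)
qed

context entropy_setting
begin

abbreviation (input) RF :: "(real \<Rightarrow> real) \<Rightarrow> (real^'n \<Rightarrow> real) \<Rightarrow> real^'n \<Rightarrow> real" where
  "RF S \<zeta> \<equiv> \<lambda>x. (bu x + z x + f x) * S (u x) * \<zeta> x"

abbreviation (input) RG :: "(real \<Rightarrow> real) \<Rightarrow> (real^'n \<Rightarrow> real) \<Rightarrow> real^'n \<Rightarrow> real" where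
  "RG S \<zeta> \<equiv> \<lambda>x. au x \<bullet> ((deriv S (u x) * \<zeta> x) *\<^sub>R U x + S (u x) *\<^sub>R grad \<zeta> x)"

abbreviation (input) energy :: "real \<Rightarrow> real" where
  "energy h \<equiv> \<integral>x. indicator {y. h \<le> \<bar>u y\<bar> \<and> \<bar>u y\<bar> < h + 1} x * Pfun p x (U x) \<partial>M"

text \<open>The error beyond the height h: L bounds the truncation multiplying the data, and \<phi>a
  is the defect in coercivity.\<close>

abbreviation (input) tail :: "real \<Rightarrow> real \<Rightarrow> real" where
  "tail L h \<equiv> \<integral>x. indicator {y. h \<le> \<bar>u y\<bar>} x * (L * (\<bar>bu x\<bar> + \<bar>f x\<bar>) + \<phi>a x) \<partial>M"

text \<open>u is real-valued, so every point leaves {|u| \<ge> h} once h is large; dominated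
  convergence does the rest.\<close>

lemma tail_tendsto_0:
  fixes w :: "real^'n \<Rightarrow> real"
  assumes w: "integrable M w"
  shows "((\<lambda>h. \<integral>x. indicator {y. h \<le> \<bar>u y\<bar>} x * w x \<partial>M) \<longlongrightarrow> 0) at_top"
proof -
  have [measurable]: "w \<in> borel_measurable M" using w by auto
  have "((\<lambda>h. \<integral>x. indicator {y. h \<le> \<bar>u y\<bar>} x * w x \<partial>M) \<longlongrightarrow> (\<integral>x. 0 \<partial>M)) at_top"
  proof (rule integral_dominated_convergence_at_top[where w="\<lambda>x. \<bar>w x\<bar>"])
    show "integrable M (\<lambda>x. \<bar>w x\<bar>)" using w by (rule integrable_abs)
    show "(\<lambda>x. indicator {y. h \<le> \<bar>u y\<bar>} x * w x) \<in> borel_measurable M" for h :: real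
      by (intro borel_measurable_times measurable_indicator_pred) measurable
    show "\<forall>\<^sub>F h in at_top. AE x in M. norm (indicator {y. h \<le> \<bar>u y\<bar>} x * w x) \<le> \<bar>w x\<bar>"
      by (intro always_eventually allI AE_I2) (simp add: indicator_def)
    show "AE x in M. ((\<lambda>h. indicator {y. h \<le> \<bar>u y\<bar>} x * w x) \<longlongrightarrow> 0) at_top"
    proof (rule AE_I2)
      fix x
      have "\<forall>\<^sub>F h in at_top. indicator {y. h \<le> \<bar>u y\<bar>} x * w x = 0"
        using eventually_gt_at_top[of "\<bar>u x\<bar>"] by eventually_elim simp
      then show "((\<lambda>h. indicator {y. h \<le> \<bar>u y\<bar>} x * w x) \<longlongrightarrow> 0) at_top" by (rule tendsto_eventually)
    qed
  qed simp
  then show ?thesis by simp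
qed

context
  fixes S :: "real \<Rightarrow> real" and \<zeta> :: "real^'n \<Rightarrow> real" and Cs R C :: real and \<psi> :: "nat \<Rightarrow> real^'n \<Rightarrow> real" and K
  assumes S: "smooth S" "\<And>s. \<bar>S s\<bar> \<le> Cs" "\<And>s. \<bar>deriv S s\<bar> \<le> Cs"
    "\<And>s. \<bar>s\<bar> > R \<Longrightarrow> S s = 0" "\<And>s. \<bar>s\<bar> > R \<Longrightarrow> deriv S s = 0"
    and \<zeta>: "C_k 1 \<zeta>"
    and \<psi>: "\<And>n. \<psi> n \<in> C0_infty \<Omega>" "compact K" "\<And>n. supp (\<psi> n) \<subseteq> K"
      "\<And>n x. \<bar>\<psi> n x\<bar> \<le> C" "\<And>x. (\<lambda>n. \<psi> n x) \<longlonglongrightarrow> \<zeta> x"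
      "\<And>n x e. e \<in> Basis \<Longrightarrow> \<bar>frechet_derivative (\<psi> n) (at x) e\<bar> \<le> C"
      "\<And>x e. e \<in> Basis \<Longrightarrow> (\<lambda>n. frechet_derivative (\<psi> n) (at x) e) \<longlonglongrightarrow> frechet_derivative \<zeta> (at x) e"
begin

lemma constants_nonneg: "0 \<le> Cs" "0 \<le> C"
  using S(2)[of 0] \<psi>(4)[of 0 0] by linarith+

lemma \<zeta>_bound: "\<bar>\<zeta> x\<bar> \<le> C"
proof -
  have "(\<lambda>n. \<bar>\<psi> n x\<bar>) \<longlonglongrightarrow> \<bar>\<zeta> x\<bar>" by (rule tendsto_rabs[OF \<psi>(5)])
  then show ?thesis by (rule LIMSEQ_le_const2) (use \<psi>(4) in auto)
qed

lemma tjet_\<psi>_bound: "\<bar>tjet (\<psi> j) c x\<bar> \<le> C * indicator K x"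
proof (cases "x \<in> K")
  case True
  then show ?thesis using \<psi>(4)[of j x] \<psi>(6)[of "axis _ 1" j x] by (cases c) (auto simp: grad_def)
next
  case False
  then have "x \<notin> supp (\<psi> j)" using \<psi>(3)[of j] by blast
  then show ?thesis using False by (simp add: tjet_outside_supp)
qed

lemma tjet_\<psi>_tendsto: "(\<lambda>j. tjet (\<psi> j) c x) \<longlonglongrightarrow> tjet \<zeta> c x"
  using \<psi>(5)[of x] \<psi>(7)[of "axis _ 1" x] by (cases c) (auto simp: grad_def)

text \<open>S need not vanish at 0, so compact support of the perturbation comes from the factor
  \<psi>, not from the composition. The smooth \<psi> stand in for \<zeta>, which is only C^1. Their
  uniform bounds on K give the jet estimate L (|jet of \<phi>| + indicator of K), hence the
  majorant.\<close>

lemma dom_approx_perturbed: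
  assumes da: "dom_approx \<phi> v g"
  shows "dom_approx (\<lambda>j x. \<phi> j x + S (\<phi> j x) * \<psi> j x) (\<lambda>x. v x + S (v x) * \<zeta> x)
    (\<lambda>x. g x + (deriv S (v x) * \<zeta> x) *\<^sub>R g x + S (v x) *\<^sub>R grad \<zeta> x)"
proof -
  obtain E where E: "\<And>j. \<phi> j \<in> C0_infty \<Omega>" "integrable M E"
    "AE x in M. x \<in> \<Omega> \<and> dominated \<phi> v g E x"
    using dom_approxD[OF da] by blast
  define \<xi> where "\<xi> j x = \<phi> j x + S (\<phi> j x) * \<psi> j x" for j x
  define L where "L = 1 + Cs * C"
  have L: "1 \<le> L" "Cs * C \<le> L" using constants_nonneg by (auto simp: L_def)
  have tS: "tjet (\<xi> j) (Some i) x = tjet (\<phi> j) (Some i) x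
      + (deriv S (\<phi> j x) * \<psi> j x * tjet (\<phi> j) (Some i) x + S (\<phi> j x) * tjet (\<psi> j) (Some i) x)" for j i x
  proof -
    note d\<phi> = C_1_has_derivative[OF C0_infty_C1[OF E(1)], of j x]
    note d\<psi> = C_1_has_derivative[OF C0_infty_C1[OF \<psi>(1)], of j x]
    note dS = has_derivative_compose_real[OF smooth_real_DERIV[OF S(1)] d\<phi>]
    have "frechet_derivative (\<xi> j) (at x) = (\<lambda>h. frechet_derivative (\<phi> j) (at x) h
      + (S (\<phi> j x) * frechet_derivative (\<psi> j) (at x) h + deriv S (\<phi> j x) * frechet_derivative (\<phi> j) (at x) h * \<psi> j x))"
      unfolding \<xi>_def by (rule frechet_derivative_eqI[OF has_derivative_add[OF d\<phi> has_derivative_mult[OF dS d\<psi>]]])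
    then show ?thesis by (simp add: grad_def algebra_simps)
  qed
  have bd: "\<bar>tjet (\<xi> j) c x\<bar> \<le> L * \<bar>\<bar>tjet (\<phi> j) c x\<bar> + indicator K x\<bar>" for j c x
  proof -
    let ?I = "indicator K x :: real"
    have SC: "\<bar>s\<bar> * \<bar>tjet (\<psi> j) c x\<bar> \<le> Cs * C * ?I" if "\<bar>s\<bar> \<le> Cs" for s c
      using mult_mono[OF that tjet_\<psi>_bound[of j c x]] constants_nonneg by (simp add: mult.assoc)
    have LI: "Cs * C * ?I \<le> L * ?I" using L(2) by (rule mult_right_mono) simp
    have L1: "\<bar>t\<bar> \<le> L * \<bar>t\<bar>" for t using mult_right_mono[OF L(1), of "\<bar>t\<bar>"] by simp
    have "\<bar>tjet (\<xi> j) c x\<bar> \<le> L * \<bar>tjet (\<phi> j) c x\<bar> + Cs * C * ?I"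
    proof (cases c)
      case None
      have "\<bar>\<xi> j x\<bar> \<le> \<bar>\<phi> j x\<bar> + \<bar>S (\<phi> j x)\<bar> * \<bar>\<psi> j x\<bar>"
        unfolding \<xi>_def abs_mult[symmetric] by (rule abs_triangle_ineq)
      then show ?thesis using SC[OF S(2), of "\<phi> j x" None] L1[of "\<phi> j x"] None by simp
    next
      case (Some i)
      let ?t = "tjet (\<phi> j) (Some i) x"
      have "\<bar>deriv S (\<phi> j x)\<bar> * \<bar>\<psi> j x\<bar> \<le> Cs * C"
        using S(3) \<psi>(4) constants_nonneg by (intro mult_mono) auto
      then have "\<bar>deriv S (\<phi> j x)\<bar> * \<bar>\<psi> j x\<bar> * \<bar>?t\<bar> \<le> Cs * C * \<bar>?t\<bar>" by (rule mult_right_mono) simp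
      moreover have "\<bar>tjet (\<xi> j) (Some i) x\<bar> \<le> \<bar>?t\<bar> + (\<bar>deriv S (\<phi> j x)\<bar> * \<bar>\<psi> j x\<bar> * \<bar>?t\<bar>
          + \<bar>S (\<phi> j x)\<bar> * \<bar>tjet (\<psi> j) (Some i) x\<bar>)"
        unfolding tS abs_mult[symmetric] by (intro order_trans[OF abs_triangle_ineq] add_left_mono abs_triangle_ineq)
      moreover have "L * \<bar>?t\<bar> = \<bar>?t\<bar> + Cs * C * \<bar>?t\<bar>" by (simp add: L_def algebra_simps)
      ultimately show ?thesis using SC[OF S(2), of "\<phi> j x" "Some i"] unfolding Some by linarith
    qed
    then show ?thesis using LI by (simp add: distrib_left)
  qed
  have "dom_approx \<xi> (\<lambda>x. v x + S (v x) * \<zeta> x)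
    (\<lambda>x. g x + (deriv S (v x) * \<zeta> x) *\<^sub>R g x + S (v x) *\<^sub>R grad \<zeta> x)"
    unfolding dom_approx_def
  proof (intro conjI allI exI[of _ "\<lambda>x. L powr pmax * (2 powr pmax * (E x + indicator K x))"])
    show "\<xi> j \<in> C0_infty \<Omega>" for j unfolding \<xi>_def
      by (intro C0_infty_add E(1) C0_infty_mult smooth_compose[OF S(1) C0_infty_smooth[OF E(1)]] \<psi>(1))
    show "integrable M (\<lambda>x. L powr pmax * (2 powr pmax * (E x + indicator K x)))"
      by (intro integrable_mult_right Bochner_Integration.integrable_add E(2) integrable_indicator_compact \<Omega>(1) \<psi>(2))
    show "AE x in M. \<forall>c. (\<lambda>j. tjet (\<xi> j) c x) \<longlonglongrightarrow> jet (\<lambda>x. v x + S (v x) * \<zeta> x)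
          (\<lambda>x. g x + (deriv S (v x) * \<zeta> x) *\<^sub>R g x + S (v x) *\<^sub>R grad \<zeta> x) c x \<and>
        (\<forall>j. \<bar>tjet (\<xi> j) c x\<bar> powr ex c x \<le> L powr pmax * (2 powr pmax * (E x + indicator K x)))"
      using E(3)
    proof eventually_elim
      case (elim x)
      have lim: "(\<lambda>j. tjet (\<phi> j) c x) \<longlonglongrightarrow> jet v g c x" and bE: "\<bar>tjet (\<phi> j) c x\<bar> powr ex c x \<le> E x" for c j
        using elim by auto
      have l0: "(\<lambda>j. \<phi> j x) \<longlonglongrightarrow> v x" using lim[of None] by simp
      have lS: "(\<lambda>j. S (\<phi> j x)) \<longlonglongrightarrow> S (v x)"
        by (rule isCont_tendsto_compose[OF DERIV_isCont[OF smooth_real_DERIV[OF S(1)]] l0])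
      have lS': "(\<lambda>j. deriv S (\<phi> j x)) \<longlonglongrightarrow> deriv S (v x)"
        by (rule isCont_tendsto_compose[OF DERIV_isCont[OF smooth_real_DERIV[OF smooth_deriv[OF S(1)]]] l0])
      show ?case
      proof (intro allI conjI)
        fix c
        show "(\<lambda>j. tjet (\<xi> j) c x) \<longlonglongrightarrow> jet (\<lambda>x. v x + S (v x) * \<zeta> x)
          (\<lambda>x. g x + (deriv S (v x) * \<zeta> x) *\<^sub>R g x + S (v x) *\<^sub>R grad \<zeta> x) c x"
        proof (cases c)
          case None
          have "(\<lambda>j. \<xi> j x) \<longlonglongrightarrow> v x + S (v x) * \<zeta> x"
            unfolding \<xi>_def by (intro tendsto_add tendsto_mult l0 lS \<psi>(5))
          then show ?thesis using None by simp
        next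
          case (Some i)
          have "(\<lambda>j. tjet (\<xi> j) (Some i) x) \<longlonglongrightarrow> jet v g (Some i) x
            + (deriv S (v x) * \<zeta> x * jet v g (Some i) x + S (v x) * tjet \<zeta> (Some i) x)"
            unfolding tS by (intro tendsto_add tendsto_mult lim lS lS' \<psi>(5) tjet_\<psi>_tendsto)
          then show ?thesis using Some by (simp add: add.assoc)
        qed
        fix j
        have q: "0 < ex c x" "0 \<le> ex c x" "ex c x \<le> pmax" using ex_bounds[of x c] elim by auto
        have "\<bar>tjet (\<xi> j) c x\<bar> powr ex c x \<le> L powr pmax * \<bar>\<bar>tjet (\<phi> j) c x\<bar> + indicator K x\<bar> powr ex c x"
          by (rule powr_abs_le[OF q(2,3) bd L(1)])
        also have "\<dots> \<le> L powr pmax * (2 powr pmax * (\<bar>\<bar>tjet (\<phi> j) c x\<bar>\<bar> powr ex c x + \<bar>indicator K x\<bar> powr ex c x))"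
          by (intro mult_left_mono powr_abs_add_le[OF q(2,3)]) simp
        also have "\<dots> \<le> L powr pmax * (2 powr pmax * (E x + indicator K x))"
        proof (intro mult_left_mono add_mono)
          show "\<bar>\<bar>tjet (\<phi> j) c x\<bar>\<bar> powr ex c x \<le> E x" using bE by simp
          show "\<bar>indicator K x\<bar> powr ex c x \<le> (indicator K x :: real)" using q(1) by (simp add: indicator_def)
        qed auto
        finally show "\<bar>tjet (\<xi> j) c x\<bar> powr ex c x \<le> L powr pmax * (2 powr pmax * (E x + indicator K x))" .
      qed
    qed
  qed
  then show ?thesis unfolding \<xi>_def .
qed

text \<open>Test with \<open>\<xi> = T\<^sub>h(u) + S(u) \<zeta>\<close> and truncation level \<open>L > sup |S(u) \<zeta>|\<close>: where \<open>|u| < h\<close> the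
  integrands are those of the renormalized equation with the opposite sign, and where \<open>|u| \<ge> h\<close>
  only \<open>u - T\<^sub>h(u)\<close> remains, which coercivity controls.\<close>

lemma energy_estimate:
  assumes h: "h > R" "h > 0"
  defines "L \<equiv> 1 + Cs * C"
  shows "integrable M (RF S \<zeta>)" "integrable M (RG S \<zeta>)"
    "abar * energy h
      \<le> integral\<^sup>L M (RF S \<zeta>) + integral\<^sup>L M (RG S \<zeta>)
        + tail L h"
proof -
  \<comment> \<open>The summand 1 in L does two things: it makes L strictly larger than |S(u)
    \<zeta>|, and it lets {|u - \<xi>| < L} contain the whole strip h \<le> |u| < h + 1.\<close>
  have "1 \<le> L" using constants_nonneg by (simp add: L_def)
  then have L: "1 \<le> L" "L > 0" by linarith+
  obtain \<phi> where \<phi>: "dom_approx \<phi> (\<lambda>x. trunc h (u x)) (\<lambda>x. indicator {y. \<bar>u y\<bar> < h} x *\<^sub>R U x)"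
    and \<phi>h: "\<And>j x. \<bar>\<phi> j x\<bar> \<le> h"
    using T0_dom_approx[OF uT0 h(2)] unfolding U_def by blast
  \<comment> \<open>Bounds all approximating test functions at once; this relies on the approximants
    of T_h(u) being bounded by h.\<close>
  define B where "B = h + Cs * C"
  have B: "B > 0" "h \<le> B" using h constants_nonneg by (auto simp: B_def intro: add_pos_nonneg)
  have \<xi>B: "\<bar>\<phi> j x + S (\<phi> j x) * \<psi> j x\<bar> \<le> B" for j x
  proof -
    have "\<bar>S (\<phi> j x)\<bar> * \<bar>\<psi> j x\<bar> \<le> Cs * C" using S(2) \<psi>(4) constants_nonneg by (intro mult_mono) auto
    then show ?thesis using \<phi>h[of j x] abs_triangle_ineq[of "\<phi> j x" "S (\<phi> j x) * \<psi> j x"]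
      by (simp add: B_def abs_mult)
  qed
  define v where "v x = trunc h (u x)" for x
  define \<xi> where "\<xi> x = v x + S (v x) * \<zeta> x" for x
  define g where "g x = indicator {y. \<bar>u y\<bar> < h} x *\<^sub>R U x" for x
  define g\<xi> where "g\<xi> x = g x + (deriv S (v x) * \<zeta> x) *\<^sub>R g x + S (v x) *\<^sub>R grad \<zeta> x" for x
  define F where "F x = (bu x + f x + indicator {y. \<bar>u y\<bar> < B} x * z x) * trunc L (u x - \<xi> x)" for x
  define G where "G x = indicator {y. \<bar>u y - \<xi> y\<bar> < L} x * (au x \<bullet> (U x - g\<xi> x))" for x
  have da: "dom_approx (\<lambda>j x. \<phi> j x + S (\<phi> j x) * \<psi> j x) \<xi> g\<xi>"
    using dom_approx_perturbed[OF \<phi>] unfolding \<xi>_def[abs_def] g\<xi>_def[abs_def] v_def g_def .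
  note T = entropy_test_dom_approx[OF L(2) da B(1) \<xi>B, folded F_def[abs_def] G_def[abs_def]]
  have below: "F x = - RF S \<zeta> x" "G x = - RG S \<zeta> x" if "\<bar>u x\<bar> < h" for x
  proof -
    have v: "v x = u x" unfolding v_def using that by (intro trunc_eq(3)) simp
    have g: "g x = U x" using that by (simp add: g_def)
    have "\<bar>S (u x)\<bar> * \<bar>\<zeta> x\<bar> \<le> Cs * C" using S(2) \<zeta>_bound constants_nonneg by (intro mult_mono) auto
    then have le: "\<bar>u x - \<xi> x\<bar> < L" by (simp add: \<xi>_def v L_def abs_mult)
    then have "trunc L (u x - \<xi> x) = - (S (u x) * \<zeta> x)" by (subst trunc_eq(3)) (auto simp: \<xi>_def v)
    then show "F x = - RF S \<zeta> x" using that B(2) by (simp add: F_def algebra_simps)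
    have "U x - g\<xi> x = - ((deriv S (u x) * \<zeta> x) *\<^sub>R U x + S (u x) *\<^sub>R grad \<zeta> x)"
      by (simp add: g\<xi>_def g v)
    then show "G x = - RG S \<zeta> x" using le by (simp add: G_def inner_diff_right inner_add_right)
  qed
  have above: "RF S \<zeta> x = 0" "RG S \<zeta> x = 0" "\<xi> x = v x" "g\<xi> x = 0" "\<bar>u x - v x\<bar> = \<bar>u x\<bar> - h" "\<bar>v x\<bar> \<le> \<bar>u x\<bar>"
    if "\<not> \<bar>u x\<bar> < h" for x
  proof -
    have Su: "S (u x) = 0" "deriv S (u x) = 0" using that h S(4,5)[of "u x"] by auto
    then show "RF S \<zeta> x = 0" "RG S \<zeta> x = 0" by simp_all
    have v: "v x = h \<or> v x = - h" "\<bar>v x\<bar> = h" "\<bar>u x - v x\<bar> = \<bar>u x\<bar> - h"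
      using that h(2) by (auto simp: v_def trunc_def)
    then show "\<bar>u x - v x\<bar> = \<bar>u x\<bar> - h" "\<bar>v x\<bar> \<le> \<bar>u x\<bar>" using that by auto
    \<comment> \<open>Here |v x| = h, so the strict inequality h > R is what removes S at the
      truncated value as well as at u x.\<close>
    have "S (v x) = 0" using S(4)[of "v x"] h(1) v(2) by simp
    then show "\<xi> x = v x" "g\<xi> x = 0" using that by (simp_all add: \<xi>_def g\<xi>_def g_def)
  qed
  have contS: "continuous_on UNIV S" "continuous_on UNIV (deriv S)"
    by (rule smooth_continuous[OF S(1)], rule smooth_continuous[OF smooth_deriv[OF S(1)]])
  have [measurable]: "S \<in> borel_measurable borel" "deriv S \<in> borel_measurable borel"
    by (intro borel_measurable_continuous_onI contS)+
  have [measurable]: "\<zeta> \<in> borel_measurable M" using tjet_measurable[OF \<zeta>, of None] by simp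
  have [measurable]: "grad \<zeta> \<in> borel_measurable M"
    by (rule measurable_vec_componentwise) (use tjet_measurable[OF \<zeta>, of "Some _"] in simp)
  \<comment> \<open>Up to sign, the renormalized integrands are F and G cut off to {|u| < h}, so
    they inherit integrability.\<close>
  show RF: "integrable M (RF S \<zeta>)"
  proof (rule Bochner_Integration.integrable_bound[OF T(1)])
    show "RF S \<zeta> \<in> borel_measurable M" by measurable
    show "AE x in M. norm (RF S \<zeta> x) \<le> norm (F x)"
    proof (rule AE_I2)
      fix x show "norm (RF S \<zeta> x) \<le> norm (F x)"
      proof (cases "\<bar>u x\<bar> < h")
        case True
        then show ?thesis by (simp only: below(1)[OF True] norm_minus_cancel order_refl)
      next
        case False
        then show ?thesis by (simp only: above(1)[OF False] norm_zero norm_ge_zero)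
      qed
    qed
  qed
  show RG: "integrable M (RG S \<zeta>)"
  proof (rule Bochner_Integration.integrable_bound[OF T(2)])
    show "RG S \<zeta> \<in> borel_measurable M" by measurable
    show "AE x in M. norm (RG S \<zeta> x) \<le> norm (G x)"
    proof (rule AE_I2)
      fix x show "norm (RG S \<zeta> x) \<le> norm (G x)"
      proof (cases "\<bar>u x\<bar> < h")
        case True
        then show ?thesis by (simp only: below(2)[OF True] norm_minus_cancel order_refl)
      next
        case False
        then show ?thesis by (simp only: above(2)[OF False] norm_zero norm_ge_zero)
      qed
    qed
  qed
  define I where "I x = indicator {y. h \<le> \<bar>u y\<bar> \<and> \<bar>u y\<bar> < h + 1} x * Pfun p x (U x)" for x
  define W where "W x = indicator {y. h \<le> \<bar>u y\<bar>} x * (L * (\<bar>bu x\<bar> + \<bar>f x\<bar>) + \<phi>a x)" for x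
  have Iint: "integrable M I"
  proof (rule Bochner_Integration.integrable_bound[OF integrable_Pfun[of "h + 1"]])
    show "I \<in> borel_measurable M" unfolding I_def
      by (intro borel_measurable_times measurable_indicator_pred) measurable
    show "AE x in M. norm (I x) \<le> norm (indicator {y. \<bar>u y\<bar> < h + 1} x * Pfun p x (U x))"
      by (rule AE_I2) (simp add: I_def indicator_def)
  qed (use h in simp)
  have Wint: "integrable M W"
  proof (rule Bochner_Integration.integrable_bound)
    show "integrable M (\<lambda>x. L * (\<bar>bu x\<bar> + \<bar>f x\<bar>) + \<phi>a x)"
      by (intro Bochner_Integration.integrable_add integrable_mult_right integrable_abs bu_integrable f \<phi>a(1))
    show "W \<in> borel_measurable M" unfolding W_def
      by (intro borel_measurable_times measurable_indicator_pred) measurable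
    show "AE x in M. norm (W x) \<le> norm (L * (\<bar>bu x\<bar> + \<bar>f x\<bar>) + \<phi>a x)"
      by (rule AE_I2) (simp add: W_def indicator_def)
  qed
  have ineq: "AE x in M. abar * I x - RF S \<zeta> x - RG S \<zeta> x - W x \<le> F x + G x"
    using coercive AE_in_\<Omega>
  proof eventually_elim
    case (elim x)
    show ?case
    proof (cases "\<bar>u x\<bar> < h")
      case True
      then show ?thesis using below[OF True] by (simp add: I_def W_def)
    next
      case False
      note ab = above[OF False]
      have W: "W x = L * (\<bar>bu x\<bar> + \<bar>f x\<bar>) + \<phi>a x" using False by (simp add: W_def)
      let ?t = "trunc L (u x - v x)"
      have t: "\<bar>?t\<bar> \<le> L" using L by (intro abs_trunc_le) simp
      have "\<bar>(bu x + f x) * ?t\<bar> \<le> (\<bar>bu x\<bar> + \<bar>f x\<bar>) * L"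
        unfolding abs_mult by (intro mult_mono t abs_triangle_ineq) auto
      then have 1: "- (L * (\<bar>bu x\<bar> + \<bar>f x\<bar>)) \<le> (bu x + f x) * ?t"
        by (simp add: mult.commute abs_le_iff)
      have "0 \<le> u x * ?t" by (rule trunc_sign[OF ab(6) L(2)])
      then have "0 \<le> indicator {y. \<bar>u y\<bar> < B} x * (\<bar>u x\<bar> powr (p0 x - 2) * (u x * ?t))"
        by (intro mult_nonneg_nonneg[OF _ mult_nonneg_nonneg[OF powr_ge_zero]]) simp_all
      then have "0 \<le> indicator {y. \<bar>u y\<bar> < B} x * z x * ?t" by (simp add: z_def mult.assoc)
      then have F: "- (L * (\<bar>bu x\<bar> + \<bar>f x\<bar>)) \<le> F x"
        using 1 unfolding F_def ab(3) distrib_right by linarith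
      have G: "abar * I x - \<phi>a x \<le> G x"
      \<comment> \<open>For |u| \<ge> h + L the truncation is saturated and G vanishes. The strip of
        \<open>energy\<close> ends at h + 1 \<le> h + L, so nothing is to be shown there except
        \<phi>a \<ge> 0.\<close>
      proof (cases "\<bar>u x\<bar> < h + L")
        case True
        have "G x = au x \<bullet> U x" using True ab(3,4,5) by (simp add: G_def)
        moreover have "abar * Pfun p x (U x) - \<phi>a x \<le> au x \<bullet> U x" using elim(1) unfolding au_def by blast
        moreover have "abar * I x \<le> abar * Pfun p x (U x)"
          using abar Pfun_nonneg[of x "U x"] by (intro mult_left_mono) (auto simp: I_def indicator_def)
        ultimately show ?thesis by linarith
      next
        case False
        then have "G x = 0" using ab(3,5) by (simp add: G_def)
        moreover have "I x = 0" using False L(1) by (simp add: I_def)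
        ultimately show ?thesis using \<phi>a(2)[OF elim(2)] by simp
      qed
      show ?thesis using F G W ab(1,2) by linarith
    qed
  qed
  have int1: "integrable M (\<lambda>x. abar * I x - RF S \<zeta> x - RG S \<zeta> x - W x)"
    by (intro Bochner_Integration.integrable_diff integrable_mult_right Iint RF RG Wint)
  have "(\<integral>x. abar * I x - RF S \<zeta> x - RG S \<zeta> x - W x \<partial>M) \<le> (\<integral>x. F x + G x \<partial>M)"
    by (rule integral_mono_AE[OF int1 Bochner_Integration.integrable_add[OF T(1,2)] ineq])
  also have "\<dots> = integral\<^sup>L M F + integral\<^sup>L M G"
    by (rule Bochner_Integration.integral_add[OF T(1,2)])
  also have "\<dots> \<le> 0" by (rule T(3))
  also have "(\<integral>x. abar * I x - RF S \<zeta> x - RG S \<zeta> x - W x \<partial>M)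
      = abar * integral\<^sup>L M I - integral\<^sup>L M (RF S \<zeta>) - integral\<^sup>L M (RG S \<zeta>) - integral\<^sup>L M W"
    using Iint RF RG Wint
    by (simp only: Bochner_Integration.integral_diff Bochner_Integration.integrable_diff integrable_mult_right integral_mult_right_zero)
  finally have "abar * integral\<^sup>L M I \<le> integral\<^sup>L M (RF S \<zeta>) + integral\<^sup>L M (RG S \<zeta>) + integral\<^sup>L M W" by linarith
  then show "abar * energy h
      \<le> integral\<^sup>L M (RF S \<zeta>) + integral\<^sup>L M (RG S \<zeta>)
        + tail L h"
    unfolding I_def[abs_def] W_def[abs_def] .
qed

end

text \<open>Collects the constants for given S and \<zeta>: R bounds the support of S, and L arises
  from the bounds of S, its derivative and the mollifications of \<zeta>. Both are fixed before h,
  so that h may tend to infinity.\<close>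

lemma energy_estimate_ex:
  assumes S: "smooth S" "compact (supp S)" and \<zeta>: "\<zeta> \<in> C0_1 \<Omega>"
  shows "\<exists>L R. R > 0 \<and> (\<forall>h>R.
    integrable M (RF S \<zeta>) \<and>
    integrable M (RG S \<zeta>) \<and>
    abar * energy h
      \<le> integral\<^sup>L M (RF S \<zeta>)
        + integral\<^sup>L M (RG S \<zeta>)
        + tail L h)"
proof -
  obtain C1 where C1: "\<And>s. \<bar>S s\<bar> \<le> C1"
    using continuous_compact_supp_bounded[OF smooth_continuous[OF S(1)] S(2)] by metis
  have "supp (deriv S) \<subseteq> closure (supp S)"
    unfolding supp_def[of "deriv S"] by (rule closure_mono) (auto intro: ccontr simp: deriv_outside_supp)
  then have "supp (deriv S) \<subseteq> supp S" by (simp add: supp_def)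
  then have "compact (supp (deriv S))" by (rule compact_supp_subset[OF S(2)])
  then obtain C2 where C2: "\<And>s. \<bar>deriv S s\<bar> \<le> C2"
    using continuous_compact_supp_bounded[OF smooth_continuous[OF smooth_deriv[OF S(1)]]] by metis
  obtain R where R: "R > 0" "supp S \<subseteq> cball 0 R" using compact_support_cbox[OF S(2)] by metis
  have out: "s \<notin> supp S" if "\<bar>s\<bar> > R" for s using that R(2) by auto
  obtain \<psi> K C where \<psi>: "\<forall>n. \<psi> n \<in> C0_infty \<Omega>" "compact K" "\<forall>n. supp (\<psi> n) \<subseteq> K"
    "\<forall>n x. \<bar>\<psi> n x\<bar> \<le> C" "\<forall>x. (\<lambda>n::nat. \<psi> n x) \<longlonglongrightarrow> \<zeta> x"
    "\<forall>n x. \<forall>e\<in>Basis. \<bar>frechet_derivative (\<psi> n) (at x) e\<bar> \<le> C"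
    "\<forall>x. \<forall>e\<in>Basis. (\<lambda>n. frechet_derivative (\<psi> n) (at x) e) \<longlonglongrightarrow> frechet_derivative \<zeta> (at x) e"
    using mollify_C1[OF \<Omega>(1) \<zeta>] by blast
  define Cs where "Cs = max C1 C2"
  have \<zeta>1: "C_k 1 \<zeta>" using \<zeta> unfolding C0_1_def by blast
  have Cs: "\<bar>S s\<bar> \<le> Cs" "\<bar>deriv S s\<bar> \<le> Cs" for s
    using C1[of s] C2[of s] by (auto simp: Cs_def)
  note E = energy_estimate[OF S(1) Cs(1) Cs(2) not_in_supp[OF out] deriv_outside_supp[OF out] \<zeta>1
    \<psi>(1)[rule_format] \<psi>(2) \<psi>(3)[rule_format] \<psi>(4)[rule_format] \<psi>(5)[rule_format]
    \<psi>(6)[rule_format] \<psi>(7)[rule_format]]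
  show ?thesis
  proof (rule exI[of _ "1 + Cs * C"], rule exI[of _ R], intro conjI allI impI R(1))
    fix h assume h: "R < h"
    then have h0: "h > 0" using R(1) by linarith
    show "integrable M (RF S \<zeta>)" by (rule E(1)[OF _ _ _ _ h h0])
    show "integrable M (RG S \<zeta>)" by (rule E(2)[OF _ _ _ _ h h0])
    show "abar * energy h
      \<le> integral\<^sup>L M (RF S \<zeta>)
        + integral\<^sup>L M (RG S \<zeta>)
        + tail (1 + Cs * C) h"
      by (rule E(3)[OF _ _ _ _ h h0])
  qed
qed

section \<open>The limit of large truncation heights\<close>

lemma integrable_tail_weight: "integrable M (\<lambda>x. L * (\<bar>bu x\<bar> + \<bar>f x\<bar>) + \<phi>a x)"
  by (intro Bochner_Integration.integrable_add integrable_mult_right integrable_abs bu_integrable f \<phi>a(1))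

lemma energy_nonneg: "0 \<le> (\<integral>x. indicator A x * Pfun p x (U x) \<partial>M)"
  by (intro Bochner_Integration.integral_nonneg mult_nonneg_nonneg Pfun_nonneg) simp

text \<open>The energy is nonnegative and may be dropped; in what remains only the tail depends on
  h, and it tends to 0.\<close>

lemma renormalized_ge:
  assumes "smooth S" "compact (supp S)" "\<zeta> \<in> C0_1 \<Omega>"
  shows "integrable M (RF S \<zeta>)"
    "integrable M (RG S \<zeta>)"
    "0 \<le> integral\<^sup>L M (RF S \<zeta>)
        + integral\<^sup>L M (RG S \<zeta>)" (is "0 \<le> ?X")
proof -
  obtain L R where E: "R > 0" "\<And>h. h > R \<Longrightarrow>
    integrable M (RF S \<zeta>) \<and>
    integrable M (RG S \<zeta>) \<and>
    abar * energy h
      \<le> ?X + tail L h"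
    using energy_estimate_ex[OF assms] by blast
  show "integrable M (RF S \<zeta>)"
    "integrable M (RG S \<zeta>)"
    using E(2)[of "R + 1"] by simp_all
  have "((\<lambda>h. ?X + tail L h) \<longlongrightarrow> ?X + 0) at_top"
    by (intro tendsto_add tendsto_const tail_tendsto_0 integrable_tail_weight)
  moreover have "\<forall>\<^sub>F h in at_top. 0 \<le> ?X + tail L h"
    using eventually_gt_at_top[of R]
  proof eventually_elim
    case (elim h)
    have "0 \<le> abar * energy h"
      using abar energy_nonneg by simp
    also have "\<dots> \<le> ?X + tail L h"
      using E(2)[OF elim] by blast
    finally show ?case .
  qed
  ultimately have "0 \<le> ?X + 0" by (rule tendsto_lowerbound) simp
  then show "0 \<le> ?X" by simp
qed

lemma renormalized_eq:
  assumes S: "smooth S" "compact (supp S)" and \<zeta>: "\<zeta> \<in> C0_1 \<Omega>"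
  shows "integral\<^sup>L M (RF S \<zeta>)
        + integral\<^sup>L M (RG S \<zeta>) = 0"
proof (rule antisym)
  let ?S = "\<lambda>s. - S s"
  have sm: "smooth ?S" using smooth_diff[OF smooth_const S(1), of 0] by simp
  have "supp ?S \<subseteq> supp S" by (rule supp_subsetI) simp
  then have cs: "compact (supp ?S)" by (rule compact_supp_subset[OF S(2)])
  \<comment> \<open>Both integrands are odd in S, so the lower bound for -S is the upper bound for
    S.\<close>
  have d: "deriv ?S s = - deriv S s" for s
    by (intro DERIV_imp_deriv DERIV_minus smooth_real_DERIV S(1))
  have "au x \<bullet> ((deriv ?S (u x) * \<zeta> x) *\<^sub>R U x + ?S (u x) *\<^sub>R grad \<zeta> x)
      = - (au x \<bullet> ((deriv S (u x) * \<zeta> x) *\<^sub>R U x + S (u x) *\<^sub>R grad \<zeta> x))" for x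
    unfolding d by (simp add: inner_add_right inner_diff_right)
  then show "integral\<^sup>L M (RF S \<zeta>)
        + integral\<^sup>L M (RG S \<zeta>) \<le> 0"
    using renormalized_ge(3)[OF sm cs \<zeta>] by simp
  show "0 \<le> integral\<^sup>L M (RF S \<zeta>)
        + integral\<^sup>L M (RG S \<zeta>)"
    by (rule renormalized_ge(3)[OF assms])
qed

text \<open>With S = 0 and \<zeta> = 0 the energy is at most the tail divided by
  \<open>abar\<close>. The claim concerns an extended nonnegative integral; on {|u| < h + 1}
  integrability of the modular of the gradient turns it into an ordinary one.\<close>

lemma energy_decay:
  "((\<lambda>h. \<integral>\<^sup>+ x. ennreal (Pfun p x (U x)) * indicator {y. h \<le> \<bar>u y\<bar> \<and> \<bar>u y\<bar> < h + 1} x \<partial>M) \<longlongrightarrow> 0) at_top"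
proof -
  have C0: "(\<lambda>_. 0) \<in> C0_1 \<Omega>" "compact (supp (\<lambda>_::real. 0::real))"
    by (simp_all add: C0_1_def C_k_const supp_def del: C_k.simps)
  have d0: "deriv (\<lambda>_. 0) s = 0" for s :: real by simp
  obtain L R where E: "R > 0" "\<And>h. h > R \<Longrightarrow>
    abar * energy h \<le> tail L h"
    using energy_estimate_ex[OF smooth_const C0(2) C0(1)] by auto
  have lim: "((\<lambda>h. ennreal (tail L h / abar)) \<longlongrightarrow> ennreal (0 / abar)) at_top"
    by (intro tendsto_ennrealI tendsto_divide tendsto_const tail_tendsto_0 integrable_tail_weight) (use abar in simp)
  have le: "\<forall>\<^sub>F h in at_top. (\<integral>\<^sup>+ x. ennreal (Pfun p x (U x)) * indicator {y. h \<le> \<bar>u y\<bar> \<and> \<bar>u y\<bar> < h + 1} x \<partial>M)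
      \<le> ennreal (tail L h / abar)"
    using eventually_gt_at_top[of R]
  proof eventually_elim
    case (elim h)
    let ?I = "\<lambda>x. indicator {y. h \<le> \<bar>u y\<bar> \<and> \<bar>u y\<bar> < h + 1} x * Pfun p x (U x)"
    have Iint: "integrable M ?I"
    proof (rule Bochner_Integration.integrable_bound[OF integrable_Pfun[of "h + 1"]])
      show "?I \<in> borel_measurable M"
        by (intro borel_measurable_times measurable_indicator_pred) measurable
      show "AE x in M. norm (?I x) \<le> norm (indicator {y. \<bar>u y\<bar> < h + 1} x * Pfun p x (U x))"
        by (rule AE_I2) (simp add: indicator_def)
    qed (use elim E(1) in simp)
    have "(\<integral>\<^sup>+ x. ennreal (Pfun p x (U x)) * indicator {y. h \<le> \<bar>u y\<bar> \<and> \<bar>u y\<bar> < h + 1} x \<partial>M) = (\<integral>\<^sup>+ x. ennreal (?I x) \<partial>M)"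
      by (intro nn_integral_cong) (simp add: indicator_def)
    also have "\<dots> = ennreal (integral\<^sup>L M ?I)"
      by (rule nn_integral_eq_integral[OF Iint]) (auto intro!: AE_I2 mult_nonneg_nonneg Pfun_nonneg)
    also have "\<dots> \<le> ennreal (tail L h / abar)"
      using E(2)[OF elim] abar by (intro ennreal_leI) (simp add: pos_le_divide_eq mult.commute)
    finally show ?case .
  qed
  show ?thesis
    by (rule tendsto_sandwich[OF _ le tendsto_const]) (use lim in simp_all)
qed

end

theorem theorem2:
  fixes \<Omega> :: "(real^'n) set"
    and p0 :: "real^'n \<Rightarrow> real" and p :: "'n \<Rightarrow> real^'n \<Rightarrow> real"
    and a :: "real^'n \<Rightarrow> real \<Rightarrow> real^'n \<Rightarrow> real^'n"
    and b :: "real^'n \<Rightarrow> real \<Rightarrow> real^'n \<Rightarrow> real"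
    and f u :: "real^'n \<Rightarrow> real"
  assumes "CARD('n) \<ge> 2"
    and "domain \<Omega>" and "\<Omega> \<noteq> UNIV"
    and "p0 \<in> C_plus \<Omega>" and "\<And>i. p i \<in> C_plus \<Omega>"
    and "f \<in> L1 \<Omega>"
    and "structural_assumptions \<Omega> p0 p a b"
    and "entropy_solution \<Omega> p0 p a b f u"
    and "obtained_by_approximation \<Omega> p0 p a b f u"
  shows "renormalized_solution \<Omega> p0 p a b f u"
proof -
  obtain \<Phi> \<phi> \<Phi>0 ahat bhat abar where st:
      "\<forall>i. \<Phi> i \<in> Lp_var \<Omega> (conj_exp (p i)) \<and> (\<forall>x\<in>\<Omega>. 0 \<le> \<Phi> i x)"
      "\<phi> \<in> L1 \<Omega>" "\<forall>x\<in>\<Omega>. 0 \<le> \<phi> x"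
      "\<forall>i. continuous_on {0..} (ahat i) \<and> mono_on {0..} (ahat i) \<and> (\<forall>r\<ge>0. 0 < ahat i r)"
      "0 < abar"
    and AE: "AE x in lebesgue_on \<Omega>. \<forall>s0 s t.
           (\<forall>i. \<bar>a x s0 s $ i\<bar>
                 \<le> ahat i \<bar>s0\<bar> * (Pfun p x s powr (1 / conj_exp (p i) x) + \<Phi> i x)) \<and>
           (s \<noteq> t \<longrightarrow> (a x s0 s - a x s0 t) \<bullet> (s - t) > 0) \<and>
           a x s0 s \<bullet> s \<ge> abar * Pfun p x s - \<phi> x \<and>
           \<bar>b x s0 s\<bar> \<le> bhat \<bar>s0\<bar> * (Pfun p x s + \<Phi>0 x) \<and>
           b x s0 s * s0 \<ge> 0"
    using assms(7) unfolding structural_assumptions_def by blast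
  have cara: "\<forall>i. caratheodory \<Omega> (\<lambda>x s0 s. a x s0 s $ i)"
    using assms(7) unfolding structural_assumptions_def by blast
  \<comment> \<open>The growth and coercivity bounds with their witnesses are what the energy
    estimate consumes; they are extracted from the joint almost everywhere condition.\<close>
  interpret entropy_setting \<Omega> p0 p a b f u \<Phi> \<phi> ahat abar
  proof
    show "open \<Omega>" "\<Omega> \<noteq> {}" using assms(2) by (auto simp: domain_def)
    show "p0 \<in> C_plus \<Omega>" "p i \<in> C_plus \<Omega>" for i by fact+
    show "integrable (lebesgue_on \<Omega>) f" "integrable (lebesgue_on \<Omega>) \<phi>" using assms(6) st(2) by (simp_all add: L1_def)
    show "caratheodory \<Omega> (\<lambda>x s0 s. a x s0 s $ i)" for i using cara by blast
    show "AE x in lebesgue_on \<Omega>. \<forall>s0 s i. \<bar>a x s0 s $ i\<bar>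
      \<le> ahat i \<bar>s0\<bar> * (Pfun p x s powr (1 / conj_exp (p i) x) + \<Phi> i x)"
      using AE by eventually_elim blast
    show "AE x in lebesgue_on \<Omega>. \<forall>s0 s. a x s0 s \<bullet> s \<ge> abar * Pfun p x s - \<phi> x"
      using AE by eventually_elim blast
  qed (use st assms(8) in auto)
  show ?thesis
    unfolding renormalized_solution_def Let_def
  proof (intro conjI allI impI)
    show "u \<in> T0 \<Omega> p0 p" by (rule uT0)
    show "(\<lambda>x. b x (u x) (tgrad \<Omega> p0 p u x)) \<in> L1 \<Omega>"
      using bu_integrable by (simp add: L1_def bu_def[abs_def] U_def)
    show "((\<lambda>h. \<integral>\<^sup>+ x. ennreal (Pfun p x (tgrad \<Omega> p0 p u x))
                      * indicator {y. h \<le> \<bar>u y\<bar> \<and> \<bar>u y\<bar> < h + 1} x \<partial>lebesgue_on \<Omega>) \<longlongrightarrow> 0) at_top"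
      using energy_decay unfolding U_def .
    fix S \<xi>
    assume "smooth S \<and> bounded (range S) \<and> bounded (range (deriv S)) \<and> compact (supp S) \<and> \<xi> \<in> C0_1 \<Omega>"
    then have S: "smooth S" "compact (supp S)" "\<xi> \<in> C0_1 \<Omega>" by auto
    note eqs = bu_def au_def U_def z_def
    show "(\<lambda>x. (b x (u x) (tgrad \<Omega> p0 p u x) + \<bar>u x\<bar> powr (p0 x - 2) * u x + f x) * S (u x) * \<xi> x) \<in> L1 \<Omega>"
      using renormalized_ge(1)[OF S] unfolding eqs L1_def by simp
    show "(\<lambda>x. a x (u x) (tgrad \<Omega> p0 p u x)
      \<bullet> ((deriv S (u x) * \<xi> x) *\<^sub>R tgrad \<Omega> p0 p u x + S (u x) *\<^sub>R grad \<xi> x)) \<in> L1 \<Omega>"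
      using renormalized_ge(2)[OF S] unfolding eqs L1_def by simp
    show "(\<integral>x. (b x (u x) (tgrad \<Omega> p0 p u x) + \<bar>u x\<bar> powr (p0 x - 2) * u x + f x) * S (u x) * \<xi> x \<partial>lebesgue_on \<Omega>)
      + (\<integral>x. a x (u x) (tgrad \<Omega> p0 p u x)
      \<bullet> ((deriv S (u x) * \<xi> x) *\<^sub>R tgrad \<Omega> p0 p u x + S (u x) *\<^sub>R grad \<xi> x) \<partial>lebesgue_on \<Omega>) = 0"
      using renormalized_eq[OF S] unfolding eqs .
  qed
qed

end
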